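(* Let $d\in\mathbb{N}_{\ge1}$, $n\in\mathbb{N}_{\ge2}$ and $I=[0,1]$. For $\beta\in(0,1]$, the flow map $$L^1(I,C^{n,\beta-}_0(\mathbb{R}^d,\mathbb{R}^d))\to C(I,\mathcal{D}^{n,\beta-}(\mathbb{R}^d)),\quad u\mapsto\Phi,$$ is continuous and $C^{0,\omega}$, for any slowly vanishing modulus of continuity $\omega$.
   Context: $C^{n,\alpha}_0(\mathbb{R}^d,\mathbb{R}^d)$ ($\alpha\in(0,1]$) is the Banach space of $C^n$-maps $f:\mathbb{R}^d\to\mathbb{R}^d$ with $f^{(l)}(x)\to0$ as $\|x\|\to\infty$ for $0\le l\le n$ and $\|f\|_{n,\alpha}:=\max\{\sup_{x,\,0\le l\le n}\|f^{(l)}(x)\|,\ \sup_{x\ne y}\|f^{(n)}(x)-f^{(n)}(y)\|/\|x-y\|^\alpha\}<\infty$. $C^{n,\beta-}_0:=\bigcap_{\alpha\in(0,\beta)}C^{n,\alpha}_0$ with the Fréchet topology given by the norms $\|\cdot\|_{n,\alpha}$, $\alpha\in(0,\beta)$. $\mathcal{D}^{n,\beta-}(\mathbb{R}^d):=\{\Phi\in\mathrm{Id}+C^{n,\beta-}_0(\mathbb{R}^d,\mathbb{R}^d):\det d\Phi(x)>0\ \forall x\}$, topologized via the chart $\Phi\mapsto\Phi-\mathrm{Id}$ as an open subset of $C^{n,\beta-}_0(\mathbb{R}^d,\mathbb{R}^d)$. $L^1(I,C^{n,\beta-}_0(\mathbb{R}^d,\mathbb{R}^d))$ is the space of (classes of)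 functions $u:I\to C^{n,\beta-}_0(\mathbb{R}^d,\mathbb{R}^d)$ such that $u$ is Bochner integrable into $C^{n,\alpha}_0(\mathbb{R}^d,\mathbb{R}^d)$ for all $\alpha\in(0,\beta)$, with the seminorms $\int_0^1\|u(t)\|_{n,\alpha}\,dt$, $\alpha<\beta$. Each such $u$ has a unique pointwise flow $\Phi:I\times\mathbb{R}^d\to\mathbb{R}^d$, $\Phi(t,x)=x+\int_0^tu(s)(\Phi(s,x))\,ds$, and $t\mapsto\Phi(t,\cdot)$ is a continuous map $I\to\mathcal{D}^{n,\beta-}(\mathbb{R}^d)$; the flow map sends $u$ to this map. $C(I,\mathcal{D}^{n,\beta-}(\mathbb{R}^d))$ is regarded, via $\Phi\mapsto\Phi-\mathrm{Id}$, as a subset of $C(I,C^{n,\beta-}_0(\mathbb{R}^d,\mathbb{R}^d))$ with seminorms $\sup_{t\in I}\|\cdot\|_{n,\alpha}$, $\alpha<\beta$. A modulus of continuity $\omega:[0,\infty)\to[0,\infty)$ ($\lim_{t\to0}\omega(t)=\omega(0)=0$) is slowly vanishing if it is increasing, subadditive, and $\liminf_{t\downarrow0}\omega(t)/t^\gamma>0$ for all $\gamma>0$. A curve $c:\mathbb{R}\to F$ in a locally convex space is $C^{0,\omega}$ if for each bounded interval $J$ the set $\{(c(t)-c(s))/\omega(|t-s|):s\ne t\in J\}$ is bounded in $F$. A map is $C^{0,\omega}$ if it maps $C^\infty$-curves to $C^{0,\omega}$-curves. *)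

theory Defs
  imports "HOL-Analysis.Analysis" "HOL-Library.Function_Algebras"
begin

section \<open>Functions as a real vector space\<close>

text \<open>Addition, subtraction and zero on functions are the pointwise ones of
  \<^theory>\<open>HOL-Library.Function_Algebras\<close>.\<close>

instantiation "fun" :: (type, real_vector) real_vector
begin

definition scaleR_fun :: "real \<Rightarrow> ('a \<Rightarrow> 'b) \<Rightarrow> 'a \<Rightarrow> 'b" where
  "scaleR_fun c f = (\<lambda>x. c *\<^sub>R f x)"

instance
  by standard (auto simp: scaleR_fun_def fun_eq_iff algebra_simps)

end

lemma scaleR_fun_apply [simp]: "(c *\<^sub>R f) x = c *\<^sub>R f x"
  by (simp add: scaleR_fun_def)


section \<open>Locally convex spaces given by seminorms\<close>

text \<open>A locally convex space is a linear subspace \<open>V\<close> of the vector space \<open>'v\<close> together with a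
  nonempty set \<open>P\<close> of seminorms on \<open>V\<close>. Separation is not required: in an \<open>L\<^sup>1\<close> space the elements
  are functions, as usual in the library, and not classes modulo equality almost everywhere.
  Functions that agree almost everywhere are topologically indistinguishable there, so
  continuity, smoothness of curves and boundedness mean the same for functions as for classes.\<close>

definition lcs_topology :: "'v::real_vector set \<Rightarrow> ('v \<Rightarrow> real) set \<Rightarrow> 'v topology" where
  "lcs_topology V P =
     topology_generated_by {{v \<in> V. p (v - u) < e} | u p e. u \<in> V \<and> p \<in> P \<and> 0 < e}"

definition lcs_bounded :: "'v::real_vector set \<Rightarrow> ('v \<Rightarrow> real) set \<Rightarrow> 'v set \<Rightarrow> bool" where
  "lcs_bounded V P B \<longleftrightarrow> B \<subseteq> V \<and> (\<forall>p\<in>P. bdd_above (p ` B))"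

text \<open>In the following, \<open>cs k\<close> is the \<open>k\<close>-th derivative of the curve \<open>c\<close>.\<close>

definition smooth_curve ::
  "'v::real_vector set \<Rightarrow> ('v \<Rightarrow> real) set \<Rightarrow> (real \<Rightarrow> 'v) \<Rightarrow> bool" where
  "smooth_curve V P c \<longleftrightarrow>
     (\<exists>cs :: nat \<Rightarrow> real \<Rightarrow> 'v. cs 0 = c \<and> (\<forall>k t. cs k t \<in> V) \<and>
        (\<forall>k t. limitin (lcs_topology V P)
                 (\<lambda>h. (1 / h) *\<^sub>R (cs k (t + h) - cs k t)) (cs (Suc k) t) (at 0)))"

definition C0_omega_curve ::
  "'v::real_vector set \<Rightarrow> ('v \<Rightarrow> real) set \<Rightarrow> (real \<Rightarrow> real) \<Rightarrow> (real \<Rightarrow> 'v) \<Rightarrow> bool" where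
  "C0_omega_curve V P \<omega> c \<longleftrightarrow> range c \<subseteq> V \<and>
     (\<forall>J. is_interval J \<and> bounded J \<longrightarrow>
        lcs_bounded V P
          {(1 / \<omega> \<bar>t - s\<bar>) *\<^sub>R (c t - c s) | s t. s \<in> J \<and> t \<in> J \<and> s \<noteq> t})"

definition C0_omega_map ::
  "'v::real_vector set \<Rightarrow> ('v \<Rightarrow> real) set \<Rightarrow> 'w::real_vector set \<Rightarrow> ('w \<Rightarrow> real) set \<Rightarrow>
     (real \<Rightarrow> real) \<Rightarrow> ('v \<Rightarrow> 'w) \<Rightarrow> bool" where
  "C0_omega_map V P W Q \<omega> f \<longleftrightarrow>
     (\<forall>c. smooth_curve V P c \<longrightarrow> C0_omega_curve W Q \<omega> (f \<circ> c))"

definition slowly_vanishing :: "(real \<Rightarrow> real) \<Rightarrow> bool" where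
  "slowly_vanishing \<omega> \<longleftrightarrow>
     (\<forall>t\<ge>0. 0 \<le> \<omega> t) \<and> \<omega> 0 = 0 \<and> (\<omega> \<longlongrightarrow> 0) (at_right 0) \<and>
     mono_on {0..} \<omega> \<and>
     (\<forall>s\<ge>0. \<forall>t\<ge>0. \<omega> (s + t) \<le> \<omega> s + \<omega> t) \<and>
     (\<forall>\<gamma>>0. 0 < Liminf (at_right 0) (\<lambda>t. ereal (\<omega> t / t powr \<gamma>)))"


section \<open>Iterated derivatives and Hoelder spaces\<close>

text \<open>\<open>nderiv f [v\<^sub>l, \<dots>, v\<^sub>1] x\<close> is the value of the \<open>l\<close>-th derivative of \<open>f\<close> at \<open>x\<close>, an \<open>l\<close>-linear
  map, at the vectors \<open>v\<^sub>l, \<dots>, v\<^sub>1\<close>. Multilinear maps are represented by functions on lists of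
  vectors, since the order \<open>l\<close> is a variable.\<close>

primrec nderiv ::
  "('a::real_normed_vector \<Rightarrow> 'b::real_normed_vector) \<Rightarrow> 'a list \<Rightarrow> 'a \<Rightarrow> 'b" where
  "nderiv f [] = f"
| "nderiv f (v # vs) = (\<lambda>x. frechet_derivative (nderiv f vs) (at x) v)"

text \<open>On a finite-dimensional space, the space of \<open>l\<close>-linear maps is finite-dimensional as well, so
  that differentiability and continuity of the \<open>l\<close>-th derivative can be tested on fixed vectors.\<close>

definition C_n :: "nat \<Rightarrow> ('a::euclidean_space \<Rightarrow> 'b::euclidean_space) \<Rightarrow> bool" where
  "C_n n f \<longleftrightarrow>
     (\<forall>vs x. length vs < n \<longrightarrow> nderiv f vs differentiable (at x)) \<and>
     (\<forall>vs. length vs \<le> n \<longrightarrow> continuous_on UNIV (nderiv f vs))"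

text \<open>Operator norm of an \<open>l\<close>-linear map.\<close>

definition mlin_norm ::
  "nat \<Rightarrow> ('a::real_normed_vector list \<Rightarrow> 'b::real_normed_vector) \<Rightarrow> real" where
  "mlin_norm l T = (SUP vs \<in> {vs. length vs = l \<and> (\<forall>v\<in>set vs. norm v \<le> 1)}. norm (T vs))"

definition deriv_norms :: "nat \<Rightarrow> ('a::euclidean_space \<Rightarrow> 'b::euclidean_space) \<Rightarrow> real set" where
  "deriv_norms n f = {mlin_norm l (\<lambda>vs. nderiv f vs x) | l x. l \<le> n}"

definition hoelder_quotients ::
  "nat \<Rightarrow> real \<Rightarrow> ('a::euclidean_space \<Rightarrow> 'b::euclidean_space) \<Rightarrow> real set" where
  "hoelder_quotients n \<alpha> f =
     {mlin_norm n (\<lambda>vs. nderiv f vs x - nderiv f vs y) / norm (x - y) powr \<alpha> | x y. x \<noteq> y}"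

text \<open>Suprema of unbounded sets of reals are unspecified, so finiteness of the norm is a
  separate condition in the definition of the space.\<close>

definition hoelder_norm ::
  "nat \<Rightarrow> real \<Rightarrow> ('a::euclidean_space \<Rightarrow> 'b::euclidean_space) \<Rightarrow> real" where
  "hoelder_norm n \<alpha> f = max (Sup (deriv_norms n f)) (Sup (hoelder_quotients n \<alpha> f))"

definition C0_hoelder :: "nat \<Rightarrow> real \<Rightarrow> ('a::euclidean_space \<Rightarrow> 'a) set" where
  "C0_hoelder n \<alpha> = {f. C_n n f \<and>
     (\<forall>l\<le>n. ((\<lambda>x. mlin_norm l (\<lambda>vs. nderiv f vs x)) \<longlongrightarrow> 0) at_infinity) \<and>
     bdd_above (deriv_norms n f) \<and> bdd_above (hoelder_quotients n \<alpha> f)}"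

definition C0_minus :: "nat \<Rightarrow> real \<Rightarrow> ('a::euclidean_space \<Rightarrow> 'a) set" where
  "C0_minus n \<beta> = (\<Inter>\<alpha>\<in>{0<..<\<beta>}. C0_hoelder n \<alpha>)"

definition C0_minus_seminorms ::
  "nat \<Rightarrow> real \<Rightarrow> (('a::euclidean_space \<Rightarrow> 'a) \<Rightarrow> real) set" where
  "C0_minus_seminorms n \<beta> = hoelder_norm n ` {0<..<\<beta>}"

abbreviation C0_minus_topology ::
  "nat \<Rightarrow> real \<Rightarrow> ('a::euclidean_space \<Rightarrow> 'a) topology" where
  "C0_minus_topology n \<beta> \<equiv> lcs_topology (C0_minus n \<beta>) (C0_minus_seminorms n \<beta>)"


section \<open>The diffeomorphism group\<close>

definition Diff_minus :: "nat \<Rightarrow> real \<Rightarrow> (real^'d \<Rightarrow> real^'d) set" where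
  "Diff_minus n \<beta> = {\<Phi>. \<Phi> - id \<in> C0_minus n \<beta> \<and>
     (\<forall>x. 0 < det (matrix (frechet_derivative \<Phi> (at x))))}"

definition Diff_minus_topology :: "nat \<Rightarrow> real \<Rightarrow> (real^'d \<Rightarrow> real^'d) topology" where
  "Diff_minus_topology n \<beta> =
     pullback_topology (Diff_minus n \<beta>) (\<lambda>\<Phi>. \<Phi> - id) (C0_minus_topology n \<beta>)"


section \<open>Spaces of time-dependent maps\<close>

text \<open>Time-dependent maps are functions on all of \<open>real\<close>, whose values outside \<open>{0..1}\<close> are
  irrelevant: no space, seminorm or flow below depends on them.\<close>

definition bochner_integrable_in ::
  "'t measure \<Rightarrow> 'v::real_vector set \<Rightarrow> ('v \<Rightarrow> real) \<Rightarrow> ('t \<Rightarrow> 'v) \<Rightarrow> bool" where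
  "bochner_integrable_in M V N u \<longleftrightarrow> u \<in> space M \<rightarrow> V \<and>
     (\<exists>s :: nat \<Rightarrow> 't \<Rightarrow> 'v.
        (\<forall>k. simple_function M (s k) \<and> emeasure M {t \<in> space M. s k t \<noteq> 0} \<noteq> \<infinity> \<and>
              s k \<in> space M \<rightarrow> V) \<and>
        (AE t in M. (\<lambda>k. N (u t - s k t)) \<longlonglongrightarrow> 0) \<and>
        (\<lambda>k. \<integral>\<^sup>+t. ennreal (N (u t - s k t)) \<partial>M) \<longlonglongrightarrow> 0)"

definition L1_C0 :: "nat \<Rightarrow> real \<Rightarrow> (real \<Rightarrow> 'a::euclidean_space \<Rightarrow> 'a) set" where
  "L1_C0 n \<beta> = {u. (\<forall>t\<in>{0..1}. u t \<in> C0_minus n \<beta>) \<and>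
     (\<forall>\<alpha>\<in>{0<..<\<beta>}.
        bochner_integrable_in (lebesgue_on {0..1}) (C0_hoelder n \<alpha>) (hoelder_norm n \<alpha>) u)}"

definition L1_C0_seminorms ::
  "nat \<Rightarrow> real \<Rightarrow> ((real \<Rightarrow> 'a::euclidean_space \<Rightarrow> 'a) \<Rightarrow> real) set" where
  "L1_C0_seminorms n \<beta> =
     (\<lambda>\<alpha> u. \<integral>t. hoelder_norm n \<alpha> (u t) \<partial>(lebesgue_on {0..1})) ` {0<..<\<beta>}"

definition CI_C0 :: "nat \<Rightarrow> real \<Rightarrow> (real \<Rightarrow> 'a::euclidean_space \<Rightarrow> 'a) set" where
  "CI_C0 n \<beta> = {g. continuous_map (top_of_set {0..1}) (C0_minus_topology n \<beta>) g}"

definition CI_C0_seminorms ::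
  "nat \<Rightarrow> real \<Rightarrow> ((real \<Rightarrow> 'a::euclidean_space \<Rightarrow> 'a) \<Rightarrow> real) set" where
  "CI_C0_seminorms n \<beta> = (\<lambda>\<alpha> g. SUP t\<in>{0..1}. hoelder_norm n \<alpha> (g t)) ` {0<..<\<beta>}"

definition CI_Diff :: "nat \<Rightarrow> real \<Rightarrow> (real \<Rightarrow> real^'d \<Rightarrow> real^'d) set" where
  "CI_Diff n \<beta> = {\<Phi>. continuous_map (top_of_set {0..1}) (Diff_minus_topology n \<beta>) \<Phi>}"

definition minus_Id :: "(real \<Rightarrow> 'a::real_vector \<Rightarrow> 'a) \<Rightarrow> real \<Rightarrow> 'a \<Rightarrow> 'a" where
  "minus_Id \<Phi> = (\<lambda>t. \<Phi> t - id)"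

abbreviation L1_C0_topology ::
  "nat \<Rightarrow> real \<Rightarrow> (real \<Rightarrow> 'a::euclidean_space \<Rightarrow> 'a) topology" where
  "L1_C0_topology n \<beta> \<equiv> lcs_topology (L1_C0 n \<beta>) (L1_C0_seminorms n \<beta>)"

definition CI_Diff_topology :: "nat \<Rightarrow> real \<Rightarrow> (real \<Rightarrow> real^'d \<Rightarrow> real^'d) topology" where
  "CI_Diff_topology n \<beta> =
     pullback_topology (CI_Diff n \<beta>) minus_Id (lcs_topology (CI_C0 n \<beta>) (CI_C0_seminorms n \<beta>))"


section \<open>The flow map\<close>

definition is_flow ::
  "(real \<Rightarrow> 'a::euclidean_space \<Rightarrow> 'a) \<Rightarrow> (real \<Rightarrow> 'a \<Rightarrow> 'a) \<Rightarrow> bool" where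
  "is_flow u \<Phi> \<longleftrightarrow> (\<forall>t\<in>{0..1}. \<forall>x.
     has_bochner_integral (lebesgue_on {0..t}) (\<lambda>s. u s (\<Phi> s x)) (\<Phi> t x - x))"

text \<open>The flow of \<open>u \<in> L1_C0 n \<beta>\<close> exists and is unique on \<open>{0..1}\<close>; the choice operator is needed
  only because its values outside \<open>{0..1}\<close> are arbitrary.\<close>

definition flow :: "(real \<Rightarrow> 'a::euclidean_space \<Rightarrow> 'a) \<Rightarrow> real \<Rightarrow> 'a \<Rightarrow> 'a" where
  "flow u = (SOME \<Phi>. is_flow u \<Phi>)"

end

theory Submission
  imports Defs
begin

text \<open>The flow is Lipschitz in \<open>u\<close> only in the supremum norm, by the Gronwall inequality. But it also
  maps bounded sets to bounded sets of \<open>C\<^sup>n\<^sup>,\<^sup>\<alpha>\<close>, and the elementary interpolation inequality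
  \<open>\<parallel>f\<parallel>\<^sub>n\<^sub>,\<^sub>\<alpha> \<le> C sup |f|\<^sup>\<gamma>\<close> for \<open>f\<close> in a fixed ball of \<open>C\<^sup>n\<^sup>,\<^sup>\<alpha>\<^sup>'\<close>, \<open>\<alpha> < \<alpha>'\<close>, with some \<open>\<gamma> > 0\<close>, turns the
  Lipschitz estimate into a Hoelder estimate with respect to \<open>\<parallel>\<cdot>\<parallel>\<^sub>n\<^sub>,\<^sub>\<alpha>\<close>, at the cost of an arbitrarily small
  loss in \<open>\<alpha>\<close>. This gives continuity, and, as \<open>\<omega>\<close> dominates every power near 0, the \<open>C\<^sup>0\<^sup>,\<^sup>\<omega>\<close>
  property. The boundedness in \<open>C\<^sup>n\<^sup>,\<^sup>\<alpha>\<close> only needs a crude composition estimate: over time intervals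
  in which \<open>u\<close> has small mass the Picard iterates stay in the unit ball, and the flow is a composition
  of finitely many such short-time flows.\<close>

section \<open>Functions with bounded Hoelder norm\<close>

text \<open>A Gronwall argument in the norm of order n and exponent \<alpha> is blocked: as a
  function of the initial point, the difference of one field along two flows contains the top
  derivative of the field at two different points, and this is not controlled by a multiple of the
  distance of the flows in that norm. So the comparison is made at order 0, where only a Lipschitz
  bound of the field enters, and the derivatives are recovered afterwards. The loss in the exponent
  is harmless because the spaces carry seminorms with exponents in the open interval below \<beta>,
  so that there is always an \<alpha>' strictly between \<alpha> and \<beta>. Uniformity decides the
  order of quantifiers: the constants in the flow bounds depend on n, the exponents and a bound R
  for the time integral of the norm, and are fixed before the field. The number of short time pieces
  is bounded in terms of R, while their endpoints depend on the field. That the flow lands in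
  \<open>CI_Diff\<close> is a separate matter: the determinant is shown to be nonzero by running the
  Gronwall inequality backwards in time.\<close>

text \<open>\<open>hoelder_le n \<alpha> K f\<close> says \<open>\<parallel>f\<parallel>\<^sub>n\<^sub>,\<^sub>\<alpha> \<le> K\<close>, finiteness included. Recursion over the directional
  derivatives makes products and compositions accessible to induction on \<open>n\<close>, without the formulas
  of Leibniz and Faa di Bruno.\<close>

primrec hoelder_le ::
  "nat \<Rightarrow> real \<Rightarrow> real \<Rightarrow> ('a::real_normed_vector \<Rightarrow> 'b::real_normed_vector) \<Rightarrow> bool" where
  "hoelder_le 0 \<alpha> K f \<longleftrightarrow>
     (\<forall>x. norm (f x) \<le> K) \<and> (\<forall>x y. norm (f x - f y) \<le> K * norm (x - y) powr \<alpha>)"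
| "hoelder_le (Suc n) \<alpha> K f \<longleftrightarrow>
     (\<forall>x. norm (f x) \<le> K) \<and> (\<forall>x. f differentiable at x) \<and>
     (\<forall>v. norm v \<le> 1 \<longrightarrow> hoelder_le n \<alpha> K (\<lambda>x. frechet_derivative f (at x) v))"

lemma hoelder_le_norm: "hoelder_le n \<alpha> K f \<Longrightarrow> norm (f x) \<le> K"
  by (cases n) auto

lemma hoelder_le_nonneg: "hoelder_le n \<alpha> K f \<Longrightarrow> 0 \<le> K"
  by (rule order_trans[OF norm_ge_zero hoelder_le_norm])

lemma hoelder_le_mono:
  assumes "hoelder_le n \<alpha> K f" "K \<le> L"
  shows "hoelder_le n \<alpha> L f"
  using assms(1)
proof (induction n arbitrary: f)
  case 0
  have "norm (f x - f y) \<le> L * norm (x - y) powr \<alpha>" for x y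
    by (rule order_trans[OF _ mult_right_mono[OF assms(2)]]) (use 0 in simp_all)
  moreover have "norm (f x) \<le> L" for x
    using hoelder_le_norm[OF 0, of x] assms(2) by simp
  ultimately show ?case by simp
next
  case (Suc n)
  have "norm (f x) \<le> L" for x
    using hoelder_le_norm[OF Suc.prems, of x] assms(2) by simp
  then show ?case using Suc by simp
qed

lemma frechet_derivative_linear:
  assumes "f differentiable at x"
  shows "frechet_derivative f (at x) (v + w) = frechet_derivative f (at x) v + frechet_derivative f (at x) w"
    and "frechet_derivative f (at x) (c *\<^sub>R v) = c *\<^sub>R frechet_derivative f (at x) v"
  using linear_frechet_derivative[OF assms] by (simp_all add: linear_add linear_scale)

lemma norm_frechet_derivative_le:
  assumes "f differentiable at x"
    and "\<And>v. norm v \<le> 1 \<Longrightarrow> norm (frechet_derivative f (at x) v) \<le> K"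
  shows "norm (frechet_derivative f (at x) v) \<le> K * norm v"
proof (cases "v = 0")
  case True
  then show ?thesis
    using frechet_derivative_linear(2)[OF assms(1), of 0 v] by simp
next
  case False
  have "norm (frechet_derivative f (at x) ((1 / norm v) *\<^sub>R v)) \<le> K"
    using False by (intro assms(2)) simp
  then show ?thesis
    using False by (simp add: frechet_derivative_linear[OF assms(1)] field_simps)
qed

lemma hoelder_le_has_derivative:
  "hoelder_le (Suc n) \<alpha> K f \<Longrightarrow> (f has_derivative frechet_derivative f (at x)) (at x)"
  by (simp add: frechet_derivative_works)

lemma hoelder_le_norm_derivative:
  assumes "hoelder_le (Suc n) \<alpha> K f"
  shows "norm (frechet_derivative f (at x) v) \<le> K * norm v"
proof (rule norm_frechet_derivative_le)
  show "norm (frechet_derivative f (at x) v) \<le> K" if "norm v \<le> 1" for v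
    using assms that hoelder_le_norm[of n \<alpha> K "\<lambda>x. frechet_derivative f (at x) v"] by simp
qed (use assms in simp)

lemma hoelder_le_Lipschitz:
  fixes f :: "'a::real_normed_vector \<Rightarrow> 'b::real_normed_vector"
  assumes "hoelder_le (Suc n) \<alpha> K f"
  shows "norm (f x - f y) \<le> K * norm (x - y)"
proof (rule differentiable_bound[where S = UNIV])
  show "(f has_derivative frechet_derivative f (at x)) (at x within UNIV)" for x
    using hoelder_le_has_derivative[OF assms] by simp
  show "onorm (frechet_derivative f (at x)) \<le> K" for x
    using hoelder_le_norm_derivative[OF assms] hoelder_le_nonneg[OF assms] by (intro onorm_bound) auto
qed auto

text \<open>Distances up to 1 use the Lipschitz bound, since r is at most r powr \<alpha> there;
  larger ones use the supremum, which is where the factor 2 comes from.\<close>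

lemma Lipschitz_imp_Hoelder:
  fixes f :: "'a::real_normed_vector \<Rightarrow> 'b::real_normed_vector"
  assumes "0 < \<alpha>" "\<alpha> \<le> 1" and K: "\<And>x. norm (f x) \<le> K"
    and lip: "\<And>x y. norm (f x - f y) \<le> K * norm (x - y)"
  shows "norm (f x - f y) \<le> 2 * K * norm (x - y) powr \<alpha>"
proof -
  have "0 \<le> K" by (rule order_trans[OF norm_ge_zero K])
  show ?thesis
  proof (cases "norm (x - y) \<le> 1")
    case True
    then have "norm (x - y) \<le> norm (x - y) powr \<alpha>"
      using powr_mono'[of \<alpha> 1 "norm (x - y)"] assms(2) by (cases "x = y") auto
    then have "K * norm (x - y) \<le> K * norm (x - y) powr \<alpha>"
      using \<open>0 \<le> K\<close> mult_left_mono by blast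
    moreover have "0 \<le> K * norm (x - y) powr \<alpha>" using \<open>0 \<le> K\<close> by simp
    ultimately show ?thesis using lip[of x y] by linarith
  next
    case False
    then have "1 \<le> norm (x - y) powr \<alpha>" using assms(1) by (simp add: ge_one_powr_ge_zero)
    then have "2 * K * 1 \<le> 2 * K * norm (x - y) powr \<alpha>"
      using \<open>0 \<le> K\<close> by (intro mult_left_mono) auto
    moreover have "norm (f x - f y) \<le> K + K"
      using norm_triangle_ineq4[of "f x" "f y"] K[of x] K[of y] by linarith
    ultimately show ?thesis by linarith
  qed
qed

text \<open>The factor 2 arises only at order 0, from \<open>Lipschitz_imp_Hoelder\<close>; the
  recursion over derivatives passes it on unchanged. Products and compositions use this whenever an
  undifferentiated factor has to be regarded at the lower order.\<close>

lemma hoelder_le_SucD: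
  assumes "hoelder_le (Suc n) \<alpha> K f" "0 < \<alpha>" "\<alpha> \<le> 1"
  shows "hoelder_le n \<alpha> (2 * K) f"
  using assms
proof (induction n arbitrary: f)
  case 0
  have "0 \<le> K" using 0(1) by (rule hoelder_le_nonneg)
  then have "norm (f x) \<le> 2 * K" for x using hoelder_le_norm[OF 0(1), of x] by linarith
  then show ?case
    using Lipschitz_imp_Hoelder[OF 0(2,3) hoelder_le_norm[OF 0(1)] hoelder_le_Lipschitz[OF 0(1)]]
    by simp
next
  case (Suc n)
  have "0 \<le> K" using Suc(2) by (rule hoelder_le_nonneg)
  then have "norm (f x) \<le> 2 * K" for x using hoelder_le_norm[OF Suc(2), of x] by linarith
  then show ?case using Suc by simp
qed

lemma hoelder_le_imp_Hoelder:
  assumes "hoelder_le n \<alpha> K f" "0 < \<alpha>" "\<alpha> \<le> 1"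
  shows "norm (f x - f y) \<le> 2 * K * norm (x - y) powr \<alpha>"
proof (cases n)
  case 0
  then have "norm (f x - f y) \<le> K * norm (x - y) powr \<alpha>" using assms by simp
  moreover have "0 \<le> K * norm (x - y) powr \<alpha>" using hoelder_le_nonneg[OF assms(1)] by simp
  ultimately show ?thesis by linarith
next
  case (Suc m)
  then show ?thesis
    using Lipschitz_imp_Hoelder[OF assms(2,3), of f K] hoelder_le_norm[OF assms(1)]
      hoelder_le_Lipschitz[of m \<alpha> K f] assms(1) by blast
qed

lemma hoelder_le_continuous:
  assumes "hoelder_le n \<alpha> K f" "0 < \<alpha>" "\<alpha> \<le> 1"
  shows "continuous_on UNIV f"
proof -
  have "isCont f x" for x
  proof -
    have "((\<lambda>y. norm (y - x)) \<longlongrightarrow> 0) (at x)"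
      by (intro tendsto_norm_zero LIM_zero tendsto_ident_at)
    then have "((\<lambda>y. norm (y - x) powr \<alpha>) \<longlongrightarrow> 0) (at x)"
      using assms(2) by (intro tendsto_zero_powrI[where b = \<alpha>]) auto
    then have "((\<lambda>y. 2 * K * norm (y - x) powr \<alpha>) \<longlongrightarrow> 0) (at x)"
      by (rule tendsto_mult_right_zero)
    then have "((\<lambda>y. f y - f x) \<longlongrightarrow> 0) (at x)"
      by (rule Lim_null_comparison[rotated]) (simp add: hoelder_le_imp_Hoelder[OF assms])
    then show ?thesis unfolding isCont_def by (rule LIM_zero_cancel)
  qed
  then show ?thesis by (simp add: continuous_at_imp_continuous_on)
qed

lemma hoelder_le_const:
  fixes c :: "'b::real_normed_vector"
  assumes "norm c \<le> K"
  shows "hoelder_le n \<alpha> K (\<lambda>_ :: 'a::real_normed_vector. c)"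
proof -
  have K: "0 \<le> K" by (rule order_trans[OF norm_ge_zero assms])
  \<comment> \<open>The induction runs on the zero function, since every directional derivative of a
    constant is zero.\<close>
  have "hoelder_le n \<alpha> K (\<lambda>_ :: 'a. 0 :: 'b)"
    by (induction n) (use K in simp_all)
  then show ?thesis using K assms by (cases n) simp_all
qed

section \<open>Sums, linear images, products and compositions\<close>

lemma hoelder_le_add:
  assumes "hoelder_le n \<alpha> K f" "hoelder_le n \<alpha> L g"
  shows "hoelder_le n \<alpha> (K + L) (\<lambda>x. f x + g x)"
  using assms
proof (induction n arbitrary: f g)
  case 0
  have "norm (f x + g x - (f y + g y)) \<le> (K + L) * norm (x - y) powr \<alpha>" for x y
  proof -
    have "norm ((f x - f y) + (g x - g y)) \<le> K * norm (x - y) powr \<alpha> + L * norm (x - y) powr \<alpha>"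
      using 0 by (intro norm_triangle_mono) auto
    then show ?thesis by (simp add: algebra_simps)
  qed
  then show ?case using 0 by (auto intro: norm_triangle_mono)
next
  case (Suc n)
  have "frechet_derivative (\<lambda>x. f x + g x) (at x) =
      (\<lambda>v. frechet_derivative f (at x) v + frechet_derivative g (at x) v)" for x
    using Suc.prems by (intro frechet_derivative_at[symmetric] has_derivative_add)
      (auto simp: frechet_derivative_works[symmetric])
  then show ?case using Suc by (auto intro: norm_triangle_mono)
qed

lemma hoelder_le_bounded_linear:
  assumes "hoelder_le n \<alpha> K f" "bounded_linear T" and T: "\<And>y. norm (T y) \<le> B * norm y" and "0 \<le> B"
  shows "hoelder_le n \<alpha> (B * K) (\<lambda>x. T (f x))"
  using assms(1)
proof (induction n arbitrary: f)
  case 0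
  interpret bounded_linear T by fact
  have TB: "norm (T y) \<le> B * K'" if "norm y \<le> K'" for y K'
    using T[of y] that \<open>0 \<le> B\<close> by (meson mult_left_mono order_trans)
  have "norm (T (f x - f y)) \<le> B * (K * norm (x - y) powr \<alpha>)" for x y using 0 by (intro TB) auto
  then show ?case using 0 TB by (auto simp: diff mult.assoc)
next
  case (Suc n)
  interpret bounded_linear T by fact
  have D: "((\<lambda>x. T (f x)) has_derivative (\<lambda>v. T (frechet_derivative f (at x) v))) (at x)" for x
    using hoelder_le_has_derivative[OF Suc.prems] by (rule has_derivative)
  have "norm (T (f x)) \<le> B * K" for x
    using T[of "f x"] hoelder_le_norm[OF Suc.prems, of x] \<open>0 \<le> B\<close>
    by (meson mult_left_mono order_trans)
  moreover have "hoelder_le n \<alpha> (B * K) (\<lambda>x. T (frechet_derivative f (at x) v))" if "norm v \<le> 1" for v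
    using Suc that by simp
  moreover have "(\<lambda>x. T (f x)) differentiable at x" for x
    using D by (rule differentiableI)
  ultimately show ?case by (simp add: frechet_derivative_at[OF D, symmetric])
qed

lemma hoelder_le_scaleR:
  "hoelder_le n \<alpha> K f \<Longrightarrow> hoelder_le n \<alpha> (\<bar>c\<bar> * K) (\<lambda>x. c *\<^sub>R f x)"
  by (rule hoelder_le_bounded_linear[where T = "\<lambda>y. c *\<^sub>R y"]) (auto intro: bounded_linear_intros)

lemma hoelder_le_diff:
  assumes "hoelder_le n \<alpha> K f" "hoelder_le n \<alpha> L g"
  shows "hoelder_le n \<alpha> (K + L) (\<lambda>x. f x - g x)"
  using hoelder_le_add[OF assms(1) hoelder_le_scaleR[OF assms(2), of "-1"]] by simp

lemma hoelder_le_sum: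
  assumes "finite I" "\<And>i. i \<in> I \<Longrightarrow> hoelder_le n \<alpha> (K i) (f i)"
  shows "hoelder_le n \<alpha> (\<Sum>i\<in>I. K i) (\<lambda>x. \<Sum>i\<in>I. f i x)"
  using assms by (induction I rule: finite_induct) (auto intro: hoelder_le_const hoelder_le_add)

lemma norm_scaleR_le:
  fixes b :: "'b::real_normed_vector"
  assumes "norm (a :: real) \<le> K" "norm b \<le> L"
  shows "norm (a *\<^sub>R b) \<le> K * L"
  unfolding norm_scaleR using assms by (intro mult_mono') auto

text \<open>Origin of the constant: at order 0 the Leibniz splitting gives two terms K * L. Every
  derivative gives two products again, and in each of them the undifferentiated factor costs a 2
  through \<open>hoelder_le_SucD\<close>, hence the factor 4 per order.\<close>

lemma hoelder_le_mult:
  fixes f :: "'a::real_normed_vector \<Rightarrow> real" and g :: "'a \<Rightarrow> 'b::real_normed_vector"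
  assumes "hoelder_le n \<alpha> K f" "hoelder_le n \<alpha> L g" and \<alpha>: "0 < \<alpha>" "\<alpha> \<le> 1"
  shows "hoelder_le n \<alpha> (2 * 4 ^ n * K * L) (\<lambda>x. f x *\<^sub>R g x)"
  using assms(1,2)
proof (induction n arbitrary: f g K L)
  case 0
  then have KL: "0 \<le> K" "0 \<le> L" using hoelder_le_nonneg by blast+
  have "norm (f x *\<^sub>R g x) \<le> 2 * K * L" for x
  proof -
    have "norm (f x *\<^sub>R g x) \<le> K * L" using 0 by (intro norm_scaleR_le) (auto dest: hoelder_le_norm)
    then show ?thesis using mult_nonneg_nonneg[OF KL] by simp
  qed
  moreover have "norm (f x *\<^sub>R g x - f y *\<^sub>R g y) \<le> 2 * K * L * norm (x - y) powr \<alpha>" for x y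
  proof -
    have "norm ((f x - f y) *\<^sub>R g x + f y *\<^sub>R (g x - g y))
        \<le> (K * norm (x - y) powr \<alpha>) * L + K * (L * norm (x - y) powr \<alpha>)"
      using 0 by (intro norm_triangle_mono norm_scaleR_le) (simp_all only: hoelder_le.simps)
    then show ?thesis by (simp add: algebra_simps)
  qed
  ultimately show ?case by simp
next
  case (Suc n)
  then have KL: "0 \<le> K" "0 \<le> L" using hoelder_le_nonneg by blast+
  have d: "f differentiable at x" "g differentiable at x" for x using Suc.prems by auto
  have D: "((\<lambda>x. f x *\<^sub>R g x) has_derivative
      (\<lambda>v. f x *\<^sub>R frechet_derivative g (at x) v + frechet_derivative f (at x) v *\<^sub>R g x)) (at x)" for x
    by (intro has_derivative_scaleR d[unfolded frechet_derivative_works])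
  note D' = frechet_derivative_at[OF D, symmetric]
  have "norm (f x *\<^sub>R g x) \<le> 2 * 4 ^ Suc n * K * L" for x
  proof -
    have "norm (f x *\<^sub>R g x) \<le> K * L" using Suc.prems by (intro norm_scaleR_le) (auto dest: hoelder_le_norm)
    also have "\<dots> \<le> (2 * 4 ^ Suc n) * (K * L)"
      using mult_right_mono[of 1 "2 * 4 ^ Suc n" "K * L"] one_le_power[of "4 :: real" "Suc n"]
        mult_nonneg_nonneg[OF KL] by linarith
    finally show ?thesis by (simp add: mult.assoc)
  qed
  moreover have "hoelder_le n \<alpha> (2 * 4 ^ Suc n * K * L)
      (\<lambda>x. f x *\<^sub>R frechet_derivative g (at x) v + frechet_derivative f (at x) v *\<^sub>R g x)"
    if "norm v \<le> 1" for v
  proof -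
    have "hoelder_le n \<alpha> (2 * 4 ^ n * (2 * K) * L) (\<lambda>x. f x *\<^sub>R frechet_derivative g (at x) v)"
      using Suc.prems that \<alpha> by (intro Suc.IH hoelder_le_SucD) auto
    moreover have "hoelder_le n \<alpha> (2 * 4 ^ n * K * (2 * L)) (\<lambda>x. frechet_derivative f (at x) v *\<^sub>R g x)"
      using Suc.prems that \<alpha> by (intro Suc.IH hoelder_le_SucD) auto
    ultimately have "hoelder_le n \<alpha> (2 * 4 ^ n * (2 * K) * L + 2 * 4 ^ n * K * (2 * L))
      (\<lambda>x. f x *\<^sub>R frechet_derivative g (at x) v + frechet_derivative f (at x) v *\<^sub>R g x)"
      by (rule hoelder_le_add)
    then show ?thesis by (rule hoelder_le_mono) (simp add: algebra_simps)
  qed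
  moreover have "(\<lambda>x. f x *\<^sub>R g x) differentiable at x" for x using D by (rule differentiableI)
  ultimately show ?case by (simp add: D')
qed

text \<open>The bound is linear in \<kappa> with C independent of f, because f will be
  \<open>u t\<close>, whose norm is merely integrable in t. The separate Lipschitz assumption
  matters at order 0, where \<open>hoelder_le\<close> makes \<phi> only Hoelder continuous and the
  exponents would multiply. The displacement \<phi> is used because the inner map
  \<open>x + \<phi> x\<close> itself is unbounded.\<close>

lemma hoelder_le_compose:
  fixes L :: real
  assumes \<alpha>: "0 < \<alpha>" "\<alpha> \<le> 1" and "0 \<le> L"
  obtains C where "0 < C"
    "\<And>\<kappa> (f :: 'a::euclidean_space \<Rightarrow> 'b::real_normed_vector) (\<phi> :: 'a \<Rightarrow> 'a).
       hoelder_le n \<alpha> \<kappa> f \<Longrightarrow> hoelder_le n \<alpha> L \<phi> \<Longrightarrow>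
       (\<And>x y. norm (\<phi> x - \<phi> y) \<le> L * norm (x - y)) \<Longrightarrow>
       hoelder_le n \<alpha> (C * \<kappa>) (\<lambda>x. f (x + \<phi> x))"
proof -
  have "\<exists>C>0. \<forall>\<kappa> (f :: 'a \<Rightarrow> 'b) (\<phi> :: 'a \<Rightarrow> 'a). hoelder_le n \<alpha> \<kappa> f \<longrightarrow> hoelder_le n \<alpha> L \<phi> \<longrightarrow>
       (\<forall>x y. norm (\<phi> x - \<phi> y) \<le> L * norm (x - y)) \<longrightarrow>
       hoelder_le n \<alpha> (C * \<kappa>) (\<lambda>x. f (x + \<phi> x))"
    using \<open>0 \<le> L\<close>
  \<comment> \<open>L is generalized because regarding \<phi> at order n instead of
    \<open>Suc n\<close> doubles its bound.\<close>
  proof (induction n arbitrary: L)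
    case 0
    have "hoelder_le 0 \<alpha> ((1 + L) * \<kappa>) (\<lambda>x. f (x + \<phi> x))"
      if f: "hoelder_le 0 \<alpha> \<kappa> f" and lip: "\<forall>x y. norm (\<phi> x - \<phi> y) \<le> L * norm (x - y)"
      for \<kappa> and f :: "'a \<Rightarrow> 'b" and \<phi> :: "'a \<Rightarrow> 'a"
    proof -
      have \<kappa>: "0 \<le> \<kappa>" using f hoelder_le_nonneg by blast
      then have le: "\<kappa> \<le> (1 + L) * \<kappa>" using 0 by (simp add: algebra_simps)
      have "norm (f (x + \<phi> x) - f (y + \<phi> y)) \<le> (1 + L) * \<kappa> * norm (x - y) powr \<alpha>" for x y
      proof -
        have "norm ((x + \<phi> x) - (y + \<phi> y)) \<le> (1 + L) * norm (x - y)"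
          using norm_triangle_ineq[of "x - y" "\<phi> x - \<phi> y"] lip[rule_format, of x y]
          by (simp add: algebra_simps)
        then have "norm ((x + \<phi> x) - (y + \<phi> y)) powr \<alpha> \<le> ((1 + L) * norm (x - y)) powr \<alpha>"
          using \<alpha> by (intro powr_mono2) auto
        also have "\<dots> = (1 + L) powr \<alpha> * norm (x - y) powr \<alpha>"
          using 0 by (simp add: powr_mult)
        also have "\<dots> \<le> (1 + L) * norm (x - y) powr \<alpha>"
          using powr_mono[of \<alpha> 1 "1 + L"] \<alpha> 0 by (intro mult_right_mono) auto
        finally have "\<kappa> * norm ((x + \<phi> x) - (y + \<phi> y)) powr \<alpha> \<le> \<kappa> * ((1 + L) * norm (x - y) powr \<alpha>)"
          using \<kappa> by (rule mult_left_mono)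
        moreover have "norm (f (x + \<phi> x) - f (y + \<phi> y)) \<le> \<kappa> * norm ((x + \<phi> x) - (y + \<phi> y)) powr \<alpha>"
          using f unfolding hoelder_le.simps by blast
        ultimately show ?thesis by (simp add: mult_ac)
      qed
      moreover have "norm (f (x + \<phi> x)) \<le> (1 + L) * \<kappa>" for x
        using hoelder_le_norm[OF f, of "x + \<phi> x"] le by linarith
      ultimately show ?thesis by simp
    qed
    then show ?case using 0 by (intro exI[of _ "1 + L"]) auto
  next
    case (Suc n)
    obtain C where "0 < C" and C: "\<And>\<kappa> (f :: 'a \<Rightarrow> 'b) (\<phi> :: 'a \<Rightarrow> 'a). hoelder_le n \<alpha> \<kappa> f \<Longrightarrow> hoelder_le n \<alpha> (2 * L) \<phi> \<Longrightarrow>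
       (\<forall>x y. norm (\<phi> x - \<phi> y) \<le> 2 * L * norm (x - y)) \<Longrightarrow>
       hoelder_le n \<alpha> (C * \<kappa>) (\<lambda>x. f (x + \<phi> x))"
      using Suc.IH[of "2 * L"] Suc.prems by auto
    \<comment> \<open>The 1 pays for the values of f, C for the direction v in the chain rule, and
      each summand for one coordinate of the derivative of \<phi>.\<close>
    define C' where "C' = 1 + C + (\<Sum>b\<in>(Basis :: 'a set). 2 * 4 ^ n * L * C)"
    have C': "1 \<le> C'" "C + (\<Sum>b\<in>(Basis :: 'a set). 2 * 4 ^ n * L * C) \<le> C'"
      using Suc.prems \<open>0 < C\<close> by (auto simp: C'_def intro!: add_nonneg_nonneg)
    have "hoelder_le (Suc n) \<alpha> (C' * \<kappa>) (\<lambda>x. f (x + \<phi> x))"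
      if f: "hoelder_le (Suc n) \<alpha> \<kappa> f" and \<phi>: "hoelder_le (Suc n) \<alpha> L \<phi>"
        and lip: "\<forall>x y. norm (\<phi> x - \<phi> y) \<le> L * norm (x - y)"
      for \<kappa> and f :: "'a \<Rightarrow> 'b" and \<phi> :: "'a \<Rightarrow> 'a"
    proof -
      have \<kappa>: "0 \<le> \<kappa>" using f hoelder_le_nonneg by blast
      have \<phi>2: "hoelder_le n \<alpha> (2 * L) \<phi>" using hoelder_le_SucD[OF \<phi> \<alpha>] .
      have lip2: "\<forall>x y :: 'a. norm (\<phi> x - \<phi> y) \<le> 2 * L * norm (x - y)"
      proof (intro allI)
        fix x y :: 'a
        have "0 \<le> L * norm (x - y)" using Suc.prems by simp
        then show "norm (\<phi> x - \<phi> y) \<le> 2 * L * norm (x - y)" using lip[rule_format, of x y] by simp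
      qed
      have D: "((\<lambda>x. f (x + \<phi> x)) has_derivative
          (\<lambda>v. frechet_derivative f (at (x + \<phi> x)) (v + frechet_derivative \<phi> (at x) v))) (at x)" for x
        by (rule has_derivative_compose[OF
            has_derivative_add[OF has_derivative_ident hoelder_le_has_derivative[OF \<phi>]]
            hoelder_le_has_derivative[OF f]])
      \<comment> \<open>The direction in the chain rule depends on x, but \<open>hoelder_le\<close>
        speaks of fixed directions only. Expansion in the basis leaves products of a scalar function
        with a derivative of f in a fixed direction.\<close>
      have eq: "frechet_derivative f (at (x + \<phi> x)) (v + frechet_derivative \<phi> (at x) v) =
          frechet_derivative f (at (x + \<phi> x)) v +
          (\<Sum>b\<in>Basis. (frechet_derivative \<phi> (at x) v \<bullet> b) *\<^sub>R frechet_derivative f (at (x + \<phi> x)) b)" for x v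
      proof -
        have lin: "linear (frechet_derivative f (at (x + \<phi> x)))"
          using f by (intro linear_frechet_derivative) simp
        have "frechet_derivative f (at (x + \<phi> x)) (\<Sum>b\<in>Basis. (frechet_derivative \<phi> (at x) v \<bullet> b) *\<^sub>R b) =
          (\<Sum>b\<in>Basis. (frechet_derivative \<phi> (at x) v \<bullet> b) *\<^sub>R frechet_derivative f (at (x + \<phi> x)) b)"
          using lin by (simp add: linear_sum linear_scale)
        then show ?thesis using lin by (simp add: euclidean_representation linear_add)
      qed
      have "hoelder_le n \<alpha> (C' * \<kappa>)
          (\<lambda>x. frechet_derivative f (at (x + \<phi> x)) (v + frechet_derivative \<phi> (at x) v))" if v: "norm v \<le> 1" for v
      proof -
        have Df: "hoelder_le n \<alpha> (C * \<kappa>) (\<lambda>x. frechet_derivative f (at (x + \<phi> x)) w)" if "norm w \<le> 1" for w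
          using C[of \<kappa> "\<lambda>x. frechet_derivative f (at x) w", OF _ \<phi>2 lip2] f that by simp
        have "hoelder_le n \<alpha> (2 * 4 ^ n * L * (C * \<kappa>))
            (\<lambda>x. (frechet_derivative \<phi> (at x) v \<bullet> b) *\<^sub>R frechet_derivative f (at (x + \<phi> x)) b)" if b: "b \<in> Basis" for b
        proof (rule hoelder_le_mult[OF _ Df \<alpha>])
          have "hoelder_le n \<alpha> (1 * L) (\<lambda>x. frechet_derivative \<phi> (at x) v \<bullet> b)"
            using \<phi> v b Basis_le_norm[OF b] by (intro hoelder_le_bounded_linear[where T = "\<lambda>y. y \<bullet> b"])
              (auto intro: bounded_linear_intros)
          then show "hoelder_le n \<alpha> L (\<lambda>x. frechet_derivative \<phi> (at x) v \<bullet> b)" by simp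
        qed (use b in simp)
        then have "hoelder_le n \<alpha> (C * \<kappa> + (\<Sum>b\<in>(Basis :: 'a set). 2 * 4 ^ n * L * (C * \<kappa>)))
          (\<lambda>x. frechet_derivative f (at (x + \<phi> x)) (v + frechet_derivative \<phi> (at x) v))"
          unfolding eq using Df[OF v] by (intro hoelder_le_add hoelder_le_sum) auto
        moreover have "C * \<kappa> + (\<Sum>b\<in>(Basis :: 'a set). 2 * 4 ^ n * L * (C * \<kappa>)) \<le> C' * \<kappa>"
          using mult_right_mono[OF C'(2) \<kappa>] by (simp add: algebra_simps)
        ultimately show ?thesis by (rule hoelder_le_mono)
      qed
      moreover have "norm (f (x + \<phi> x)) \<le> C' * \<kappa>" for x
        using hoelder_le_norm[OF f, of "x + \<phi> x"] mult_right_mono[OF C'(1) \<kappa>] by simp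
      moreover have "(\<lambda>x. f (x + \<phi> x)) differentiable at x" for x using D by (rule differentiableI)
      ultimately show ?thesis by (simp add: frechet_derivative_at[OF D, symmetric])
    qed
    then show ?case using C' by (intro exI[of _ C']) auto
  qed
  then show ?thesis using that by auto
qed

section \<open>Taylor remainder and interpolation with the supremum norm\<close>

lemma hoelder_le_Taylor:
  fixes f :: "'a::real_normed_vector \<Rightarrow> 'b::real_normed_vector"
  assumes f: "hoelder_le (Suc n) \<alpha> K f" and \<alpha>: "0 < \<alpha>" "\<alpha> \<le> 1"
  shows "norm (f (x + w) - f x - frechet_derivative f (at x) w) \<le> norm w * (2 * K * norm w powr \<alpha>)"
proof -
  have "norm (f (x + w) - f x - frechet_derivative f (at x) ((x + w) - x))
      \<le> norm ((x + w) - x) * (2 * K * norm w powr \<alpha>)"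
  \<comment> \<open>Mean value inequality along the segment from x to \<open>x + w\<close>: the
    derivative deviates there from its value at x by at most
    \<open>2 * K * norm w powr \<alpha>\<close> in operator norm.\<close>
  proof (rule differentiable_bound_linearization[where S = "closed_segment x (x + w)"
        and f' = "\<lambda>y. frechet_derivative f (at y)"])
    show "x + t *\<^sub>R (x + w - x) \<in> closed_segment x (x + w)" if "t \<in> {0..1}" for t
      using that by (auto simp: in_segment algebra_simps intro!: exI[of _ t])
    show "(f has_derivative frechet_derivative f (at y)) (at y within closed_segment x (x + w))" for y
      using hoelder_le_has_derivative[OF f] by (rule has_derivative_at_withinI)
    show "onorm (frechet_derivative f (at y) - frechet_derivative f (at x)) \<le> 2 * K * norm w powr \<alpha>"
      if "y \<in> closed_segment x (x + w)" for y
    proof (rule onorm_bound)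
      have "0 \<le> K" using f by (rule hoelder_le_nonneg)
      then show "0 \<le> 2 * K * norm w powr \<alpha>" by simp
      have "norm (y - x) \<le> norm w"
        using segment_bound(1)[OF that] by (simp add: norm_minus_commute)
      then have le: "2 * K * norm (y - x) powr \<alpha> \<le> 2 * K * norm w powr \<alpha>"
        using \<alpha> \<open>0 \<le> K\<close> by (intro mult_left_mono powr_mono2) auto
      let ?g = "\<lambda>v. frechet_derivative f (at y) v - frechet_derivative f (at x) v"
      have D: "f differentiable at z" for z using f by simp
      have g1: "norm (?g v) \<le> 2 * K * norm w powr \<alpha>" if "norm v \<le> 1" for v
      proof -
        have "hoelder_le n \<alpha> K (\<lambda>x. frechet_derivative f (at x) v)" using f that by simp
        from hoelder_le_imp_Hoelder[OF this \<alpha>, of y x] le show ?thesis by linarith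
      qed
      fix v
      show "norm ((frechet_derivative f (at y) - frechet_derivative f (at x)) v)
          \<le> 2 * K * norm w powr \<alpha> * norm v"
      proof (cases "v = 0")
        case True
        then show ?thesis
          using linear_0[OF linear_frechet_derivative[OF D]] by (simp add: fun_diff_def)
      next
        case False
        have "?g ((1 / norm v) *\<^sub>R v) = (1 / norm v) *\<^sub>R ?g v"
          by (simp only: frechet_derivative_linear[OF D] scaleR_diff_right)
        then have "norm (?g ((1 / norm v) *\<^sub>R v)) = norm (?g v) / norm v" by simp
        moreover have "norm (?g ((1 / norm v) *\<^sub>R v)) \<le> 2 * K * norm w powr \<alpha>"
          using False by (intro g1) simp
        ultimately show ?thesis
          using False by (simp add: fun_diff_def pos_divide_le_eq)
      qed
    qed
  qed auto
  then show ?thesis by simp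
qed

text \<open>The derivative is a difference quotient with step h up to the Taylor remainder. Only the
  values at two points enter, so that the estimate can also be used locally, for the decay at
  infinity.\<close>

lemma norm_derivative_le_values:
  fixes f :: "'a::real_normed_vector \<Rightarrow> 'b::real_normed_vector"
  assumes f: "hoelder_le (Suc n) \<alpha> K f" and \<alpha>: "0 < \<alpha>" "\<alpha> \<le> 1"
    and v: "norm v \<le> 1" and h: "0 < h"
    and le: "norm (f x) \<le> \<epsilon>" "norm (f (x + h *\<^sub>R v)) \<le> \<epsilon>"
  shows "norm (frechet_derivative f (at x) v) \<le> 2 * \<epsilon> / h + 2 * K * h powr \<alpha>"
proof -
  have K: "0 \<le> K" using f by (rule hoelder_le_nonneg)
  have D: "f differentiable at x" using f by simp
  have hv: "norm (h *\<^sub>R v) \<le> h" using v h by (simp add: mult_left_le)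
  then have "norm (h *\<^sub>R v) powr \<alpha> \<le> h powr \<alpha>" using \<alpha> by (intro powr_mono2) auto
  then have "norm (h *\<^sub>R v) * (2 * K * norm (h *\<^sub>R v) powr \<alpha>) \<le> h * (2 * K * h powr \<alpha>)"
    using hv K h by (intro mult_mono mult_left_mono) auto
  with hoelder_le_Taylor[OF f \<alpha>, of x "h *\<^sub>R v"]
  have T: "norm (f (x + h *\<^sub>R v) - f x - h *\<^sub>R frechet_derivative f (at x) v) \<le> h * (2 * K * h powr \<alpha>)"
    by (simp add: frechet_derivative_linear[OF D])
  have "norm (h *\<^sub>R frechet_derivative f (at x) v) \<le>
      norm (f (x + h *\<^sub>R v)) + norm (f x) +
      norm (f (x + h *\<^sub>R v) - f x - h *\<^sub>R frechet_derivative f (at x) v)"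
    using norm_triangle_ineq4[of "f (x + h *\<^sub>R v) - f x" "f (x + h *\<^sub>R v) - f x - h *\<^sub>R frechet_derivative f (at x) v"]
      norm_triangle_ineq4[of "f (x + h *\<^sub>R v)" "f x"] by simp
  then have "h * norm (frechet_derivative f (at x) v) \<le> 2 * \<epsilon> + h * (2 * K * h powr \<alpha>)"
    using T le h by simp
  then show ?thesis using h by (simp add: field_simps)
qed

text \<open>A Landau-Kolmogorov inequality, with a Hoelder bound on the derivative in place of a
  bound on the second derivative.\<close>

lemma norm_derivative_interpolation:
  fixes f :: "'a::real_normed_vector \<Rightarrow> 'b::real_normed_vector"
  assumes f: "hoelder_le (Suc n) \<alpha> K f" and \<alpha>: "0 < \<alpha>" "\<alpha> \<le> 1"
    and v: "norm v \<le> 1" and \<epsilon>: "0 < \<epsilon>" and le: "\<And>x. norm (f x) \<le> \<epsilon>"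
  shows "norm (frechet_derivative f (at x) v) \<le> (2 + 2 * K) * \<epsilon> powr (\<alpha> / (1 + \<alpha>))"
proof -
  \<comment> \<open>This step size balances the two error terms: both \<epsilon> / h and h powr
    \<alpha> equal \<epsilon> powr (\<alpha> / (1 + \<alpha>)).\<close>
  define h where "h = \<epsilon> powr (1 / (1 + \<alpha>))"
  have h: "0 < h" using \<epsilon> by (simp add: h_def)
  have "\<epsilon> / h = \<epsilon> powr (1 - 1 / (1 + \<alpha>))"
    unfolding h_def using \<epsilon> by (simp add: powr_diff)
  moreover have "1 - 1 / (1 + \<alpha>) = \<alpha> / (1 + \<alpha>)" using \<alpha> by (simp add: field_simps)
  ultimately have "\<epsilon> / h = \<epsilon> powr (\<alpha> / (1 + \<alpha>))" by simp
  moreover have "h powr \<alpha> = \<epsilon> powr (\<alpha> / (1 + \<alpha>))"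
    unfolding h_def by (simp add: powr_powr)
  moreover have "norm (frechet_derivative f (at x) v) \<le> 2 * (\<epsilon> / h) + 2 * K * h powr \<alpha>"
    using norm_derivative_le_values[OF f \<alpha> v h le le, of x] by simp
  ultimately show ?thesis by (simp add: algebra_simps)
qed

lemma powr_interpolation:
  fixes a b c :: real
  assumes "0 \<le> a" "a \<le> b" "a \<le> c" "0 \<le> \<theta>" "\<theta> \<le> 1"
  shows "a \<le> b powr \<theta> * c powr (1 - \<theta>)"
proof (cases "a = 0")
  case False
  then have "a = a powr \<theta> * a powr (1 - \<theta>)" using assms by (simp flip: powr_add)
  also have "\<dots> \<le> b powr \<theta> * c powr (1 - \<theta>)"
    using assms by (intro mult_mono powr_mono2) auto
  finally show ?thesis .
qed simp

text \<open>Exponents may be lowered at the price of a constant as long as \<epsilon> stays bounded;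
  this is why an upper bound E accompanies the interpolation below.\<close>

lemma powr_le_powr_mult:
  fixes \<epsilon> E :: real
  assumes "0 < \<epsilon>" "\<epsilon> \<le> E" "\<gamma> \<le> \<delta>"
  shows "\<epsilon> powr \<delta> \<le> E powr (\<delta> - \<gamma>) * \<epsilon> powr \<gamma>"
proof -
  have "\<epsilon> powr \<delta> = \<epsilon> powr (\<delta> - \<gamma>) * \<epsilon> powr \<gamma>" using assms by (simp flip: powr_add)
  also have "\<dots> \<le> E powr (\<delta> - \<gamma>) * \<epsilon> powr \<gamma>"
    using assms by (intro mult_right_mono powr_mono2) auto
  finally show ?thesis .
qed

text \<open>The exponent is far from optimal; only its positivity matters.\<close>

lemma hoelder_le_interpolation:
  assumes \<alpha>: "0 < \<alpha>'" "\<alpha>' < \<alpha>" "\<alpha> \<le> 1" and "0 \<le> K" "0 < E"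
  obtains C \<gamma> where "0 < C" "0 < \<gamma>"
    "\<And>\<epsilon> (f :: 'a::real_normed_vector \<Rightarrow> 'b::real_normed_vector).
       hoelder_le n \<alpha> K f \<Longrightarrow> 0 < \<epsilon> \<Longrightarrow> \<epsilon> \<le> E \<Longrightarrow> (\<And>x. norm (f x) \<le> \<epsilon>) \<Longrightarrow>
       hoelder_le n \<alpha>' (C * \<epsilon> powr \<gamma>) f"
proof -
  \<comment> \<open>The clause \<open>\<gamma> \<le> 1\<close> is carried through the induction
    because the plain bound \<epsilon> on the values must be dominated by a multiple of \<epsilon>
    powr \<gamma>.\<close>
  have "\<exists>C>0. \<exists>\<gamma>>0. \<gamma> \<le> 1 \<and> (\<forall>\<epsilon> (f :: 'a \<Rightarrow> 'b). hoelder_le n \<alpha> K f \<longrightarrow> 0 < \<epsilon> \<longrightarrow> \<epsilon> \<le> E \<longrightarrow>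
      (\<forall>x. norm (f x) \<le> \<epsilon>) \<longrightarrow> hoelder_le n \<alpha>' (C * \<epsilon> powr \<gamma>) f)"
    using \<open>0 < E\<close>
  proof (induction n arbitrary: E)
    case 0
    \<comment> \<open>Geometric mean of the Hoelder bound with weight \<theta> and the trivial bound
      \<open>2 * \<epsilon>\<close> with weight \<open>1 - \<theta>\<close>; the weight turns the
      exponent \<alpha> of the distance into \<alpha>'.\<close>
    define \<theta> where "\<theta> = \<alpha>' / \<alpha>"
    define C where "C = E powr \<theta> + 2 * K powr \<theta>"
    have \<theta>: "0 < \<theta>" "\<theta> < 1" "\<alpha> * \<theta> = \<alpha>'" using \<alpha> by (auto simp: \<theta>_def)
    have "hoelder_le 0 \<alpha>' (C * \<epsilon> powr (1 - \<theta>)) f"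
      if f: "hoelder_le 0 \<alpha> K f" and \<epsilon>: "0 < \<epsilon>" "\<epsilon> \<le> E" and le: "\<forall>x. norm (f x) \<le> \<epsilon>"
      for \<epsilon> and f :: "'a \<Rightarrow> 'b"
    proof -
      have "norm (f x) \<le> C * \<epsilon> powr (1 - \<theta>)" for x
      proof -
        have "\<epsilon> powr 1 \<le> E powr (1 - (1 - \<theta>)) * \<epsilon> powr (1 - \<theta>)"
          using \<epsilon> \<theta> by (intro powr_le_powr_mult) auto
        also have "\<dots> \<le> C * \<epsilon> powr (1 - \<theta>)" by (intro mult_right_mono) (auto simp: C_def)
        finally show ?thesis using le[rule_format, of x] \<epsilon> by simp
      qed
      moreover have "norm (f x - f y) \<le> C * \<epsilon> powr (1 - \<theta>) * norm (x - y) powr \<alpha>'" for x y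
      proof -
        have "norm (f x - f y) \<le> (K * norm (x - y) powr \<alpha>) powr \<theta> * (2 * \<epsilon>) powr (1 - \<theta>)"
        proof (rule powr_interpolation)
          show "norm (f x - f y) \<le> 2 * \<epsilon>"
            using norm_triangle_ineq4[of "f x" "f y"] le[rule_format, of x] le[rule_format, of y] by simp
        qed (use f \<theta> in auto)
        also have "\<dots> = 2 powr (1 - \<theta>) * (K powr \<theta> * \<epsilon> powr (1 - \<theta>) * norm (x - y) powr \<alpha>')"
          using \<open>0 \<le> K\<close> \<epsilon> \<theta> by (simp add: powr_mult powr_powr)
        also have "\<dots> \<le> 2 * (K powr \<theta> * \<epsilon> powr (1 - \<theta>) * norm (x - y) powr \<alpha>')"
          using powr_mono[of "1 - \<theta>" 1 2] \<theta> by (intro mult_right_mono) auto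
        also have "\<dots> \<le> C * \<epsilon> powr (1 - \<theta>) * norm (x - y) powr \<alpha>'"
          by (simp add: C_def algebra_simps)
        finally show ?thesis .
      qed
      ultimately show ?thesis by simp
    qed
    moreover have "0 < C" using \<open>0 < E\<close> by (auto simp: C_def intro: add_pos_nonneg)
    ultimately show ?case using \<theta> by (intro exI[of _ C] conjI exI[of _ "1 - \<theta>"]) auto
  next
    case (Suc n)
    \<comment> \<open>The directional derivatives are of size
      \<open>(2 + 2 * K) * \<epsilon> powr \<eta>\<close> by
      \<open>norm_derivative_interpolation\<close>, so the induction hypothesis applies to them with
      this bound in place of \<epsilon>, and its exponent gets multiplied by \<eta>.\<close>
    define \<eta> where "\<eta> = \<alpha> / (1 + \<alpha>)"
    have \<eta>: "0 < \<eta>" "\<eta> \<le> 1" using \<alpha> by (auto simp: \<eta>_def)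
    \<comment> \<open>The range of the new bound, which is the reason for generalizing E.\<close>
    define E' where "E' = (2 + 2 * K) * E powr \<eta>"
    have "0 < E'" using Suc.prems \<open>0 \<le> K\<close> by (simp add: E'_def)
    then obtain C \<gamma> where C: "0 < C" "0 < \<gamma>" "\<gamma> \<le> 1" and
      IH: "\<And>\<epsilon> (f :: 'a \<Rightarrow> 'b). hoelder_le n \<alpha> K f \<Longrightarrow> 0 < \<epsilon> \<Longrightarrow> \<epsilon> \<le> E' \<Longrightarrow>
        (\<forall>x. norm (f x) \<le> \<epsilon>) \<Longrightarrow> hoelder_le n \<alpha>' (C * \<epsilon> powr \<gamma>) f"
      using Suc.IH by metis
    have \<eta>\<gamma>: "0 < \<eta> * \<gamma>" "\<eta> * \<gamma> \<le> 1" using C \<eta> by (auto intro: mult_le_one)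
    define C' where "C' = E powr (1 - \<eta> * \<gamma>) + C * (2 + 2 * K) powr \<gamma>"
    have "hoelder_le (Suc n) \<alpha>' (C' * \<epsilon> powr (\<eta> * \<gamma>)) f"
      if f: "hoelder_le (Suc n) \<alpha> K f" and \<epsilon>: "0 < \<epsilon>" "\<epsilon> \<le> E" and le: "\<forall>x. norm (f x) \<le> \<epsilon>"
      for \<epsilon> and f :: "'a \<Rightarrow> 'b"
    proof -
      have "norm (f x) \<le> C' * \<epsilon> powr (\<eta> * \<gamma>)" for x
      proof -
        have "\<epsilon> powr 1 \<le> E powr (1 - \<eta> * \<gamma>) * \<epsilon> powr (\<eta> * \<gamma>)"
          using \<epsilon> \<eta>\<gamma> by (intro powr_le_powr_mult) auto
        also have "\<dots> \<le> C' * \<epsilon> powr (\<eta> * \<gamma>)" using C by (intro mult_right_mono) (auto simp: C'_def)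
        finally show ?thesis using le[rule_format, of x] \<epsilon> by simp
      qed
      moreover have "hoelder_le n \<alpha>' (C' * \<epsilon> powr (\<eta> * \<gamma>)) (\<lambda>x. frechet_derivative f (at x) v)"
        if v: "norm v \<le> 1" for v
      proof (rule hoelder_le_mono)
        show "hoelder_le n \<alpha>' (C * ((2 + 2 * K) * \<epsilon> powr \<eta>) powr \<gamma>) (\<lambda>x. frechet_derivative f (at x) v)"
        proof (rule IH)
          show "hoelder_le n \<alpha> K (\<lambda>x. frechet_derivative f (at x) v)" using f v by simp
          show "0 < (2 + 2 * K) * \<epsilon> powr \<eta>" using \<epsilon> \<open>0 \<le> K\<close> by simp
          show "(2 + 2 * K) * \<epsilon> powr \<eta> \<le> E'"
            unfolding E'_def using \<epsilon> \<open>0 \<le> K\<close> \<eta> by (intro mult_left_mono powr_mono2) auto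
          show "\<forall>x. norm (frechet_derivative f (at x) v) \<le> (2 + 2 * K) * \<epsilon> powr \<eta>"
            unfolding \<eta>_def using norm_derivative_interpolation[OF f _ _ v \<epsilon>(1)] le \<alpha> by simp
        qed
        have "C * ((2 + 2 * K) * \<epsilon> powr \<eta>) powr \<gamma> = C * (2 + 2 * K) powr \<gamma> * \<epsilon> powr (\<eta> * \<gamma>)"
          using \<open>0 \<le> K\<close> by (simp add: powr_mult powr_powr)
        also have "\<dots> \<le> C' * \<epsilon> powr (\<eta> * \<gamma>)" by (intro mult_right_mono) (auto simp: C'_def)
        finally show "C * ((2 + 2 * K) * \<epsilon> powr \<eta>) powr \<gamma> \<le> C' * \<epsilon> powr (\<eta> * \<gamma>)" .
      qed
      ultimately show ?thesis using f by simp
    qed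
    moreover have "0 < C'" using C Suc.prems by (auto simp: C'_def intro!: add_pos_nonneg)
    ultimately show ?case using \<eta>\<gamma> by (intro exI[of _ C'] conjI exI[of _ "\<eta> * \<gamma>"]) auto
  qed
  then obtain C \<gamma> where "0 < C" "0 < \<gamma>" and
    C: "\<forall>\<epsilon> (f :: 'a \<Rightarrow> 'b). hoelder_le n \<alpha> K f \<longrightarrow> 0 < \<epsilon> \<longrightarrow> \<epsilon> \<le> E \<longrightarrow>
      (\<forall>x. norm (f x) \<le> \<epsilon>) \<longrightarrow> hoelder_le n \<alpha>' (C * \<epsilon> powr \<gamma>) f" by auto
  show ?thesis by (rule that[OF \<open>0 < C\<close> \<open>0 < \<gamma>\<close>]) (simp add: C)
qed

text \<open>Interpolation turns uniform smallness of \<open>g i x - g j x\<close> into uniform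
  smallness of the difference of the first derivatives, and the induction applies to their limits.
  This lets Picard iterates, whose convergence is only estimated in the supremum norm, pass their
  bound on to the flow.\<close>

lemma hoelder_le_uniform_limit:
  fixes f :: "'a::euclidean_space \<Rightarrow> 'b::banach"
  assumes "\<And>j. hoelder_le n \<alpha> K (g j)" and \<alpha>: "0 < \<alpha>" "\<alpha> \<le> 1"
    and "uniform_limit UNIV g f sequentially"
  shows "hoelder_le n \<alpha> K f"
  using assms(1,4)
proof (induction n arbitrary: f g)
  case 0
  have lim: "(\<lambda>j. g j x) \<longlonglongrightarrow> f x" for x using tendsto_uniform_limitI[OF 0(2)] by simp
  have "norm (f x) \<le> K" for x
    by (rule Lim_bounded[OF tendsto_norm[OF lim]]) (use 0(1) in auto)
  moreover have "norm (f x - f y) \<le> K * norm (x - y) powr \<alpha>" for x y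
    by (rule Lim_bounded[OF tendsto_norm[OF tendsto_diff[OF lim lim]]]) (use 0(1) in auto)
  ultimately show ?case by simp
next
  case (Suc n)
  note gS = Suc.prems(1)
  have K: "0 \<le> K" using gS by (rule hoelder_le_nonneg)
  have lim: "(\<lambda>j. g j x) \<longlonglongrightarrow> f x" for x using tendsto_uniform_limitI[OF Suc.prems(2)] by simp
  have le: "norm (f x) \<le> K" for x
    by (rule Lim_bounded[OF tendsto_norm[OF lim]]) (use gS in auto)
  have gD: "g j differentiable at x" for j x using gS[of j] by simp
  \<comment> \<open>The constants of \<open>norm_derivative_interpolation\<close> for a difference
    of two functions, whose bound is \<open>2 * K\<close>.\<close>
  define C where "C = 2 + 2 * (2 * K)"
  define \<eta> where "\<eta> = \<alpha> / (1 + \<alpha>)"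
  have C: "0 < C" using K by (simp add: C_def)
  have \<eta>: "0 < \<eta>" using \<alpha> by (simp add: \<eta>_def)
  have diff: "norm (frechet_derivative (g i) (at x) v - frechet_derivative (g j) (at x) v) \<le> C * \<epsilon> powr \<eta> * norm v"
    if "0 < \<epsilon>" "\<And>x. norm (g i x - g j x) \<le> \<epsilon>" for i j x v \<epsilon>
  proof -
    have 2: "hoelder_le (Suc n) \<alpha> (2 * K) (\<lambda>x. g i x - g j x)"
      using hoelder_le_diff[OF gS gS, of i j] by simp
    have "((\<lambda>x. g i x - g j x) has_derivative
        (\<lambda>v. frechet_derivative (g i) (at x) v - frechet_derivative (g j) (at x) v)) (at x)"
      using gD by (intro has_derivative_diff) (auto simp: frechet_derivative_works)
    from frechet_derivative_at[OF this]
    have eq: "frechet_derivative (\<lambda>x. g i x - g j x) (at x) =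
        (\<lambda>v. frechet_derivative (g i) (at x) v - frechet_derivative (g j) (at x) v)" by simp
    have "norm (frechet_derivative (\<lambda>x. g i x - g j x) (at x) v) \<le> C * \<epsilon> powr \<eta> * norm v"
      unfolding C_def \<eta>_def using 2 norm_derivative_interpolation[OF 2 \<alpha> _ that]
      by (intro norm_frechet_derivative_le) simp_all
    then show ?thesis unfolding eq .
  qed
  have small: "\<exists>\<epsilon>>0. C * \<epsilon> powr \<eta> \<le> e" if "0 < e" for e
    using C that \<eta> by (intro exI[of _ "(e / C) powr (1 / \<eta>)"]) (auto simp: powr_powr)
  have Cauchy: "\<exists>N. \<forall>i\<ge>N. \<forall>j\<ge>N. \<forall>x v.
      norm (frechet_derivative (g i) (at x) v - frechet_derivative (g j) (at x) v) \<le> e * norm v"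
    if e: "0 < e" for e
  proof -
    obtain \<epsilon> where \<epsilon>: "0 < \<epsilon>" "C * \<epsilon> powr \<eta> \<le> e" using small[OF e] by blast
    have "uniformly_Cauchy_on UNIV g"
      using Suc.prems(2) by (intro uniformly_convergent_Cauchy) (auto simp: uniformly_convergent_on_def)
    then obtain N where N: "\<forall>x\<in>UNIV. \<forall>i\<ge>N. \<forall>j\<ge>N. dist (g i x) (g j x) < \<epsilon>"
      using \<epsilon>(1) unfolding uniformly_Cauchy_on_def by auto
    have "norm (frechet_derivative (g i) (at x) v - frechet_derivative (g j) (at x) v) \<le> e * norm v"
      if "i \<ge> N" "j \<ge> N" for i j x v
    proof -
      have "norm (g i y - g j y) \<le> \<epsilon>" for y
        using N that by (simp add: dist_norm less_imp_le)
      from diff[OF \<epsilon>(1) this] mult_right_mono[OF \<epsilon>(2) norm_ge_zero] show ?thesis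
        by (rule order_trans)
    qed
    then show ?thesis by blast
  qed
  have "convergent (\<lambda>j. frechet_derivative (g j) (at x) v)" for x v
    unfolding Cauchy_convergent_iff[symmetric]
  proof (rule CauchyI)
    fix e :: real assume "0 < e"
    then obtain N where N: "\<forall>i\<ge>N. \<forall>j\<ge>N.
        norm (frechet_derivative (g i) (at x) v - frechet_derivative (g j) (at x) v) \<le> e / (1 + norm v) * norm v"
      using Cauchy[of "e / (1 + norm v)"] by (metis add_pos_nonneg divide_pos_pos norm_ge_zero zero_less_one)
    moreover have "e / (1 + norm v) * norm v < e"
      using \<open>0 < e\<close> by (simp add: divide_simps add_pos_nonneg)
    ultimately show "\<exists>N. \<forall>i\<ge>N. \<forall>j\<ge>N.
        norm (frechet_derivative (g i) (at x) v - frechet_derivative (g j) (at x) v) < e"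
      by (meson le_less_trans)
  qed
  then obtain g' where g': "\<And>x v. (\<lambda>j. frechet_derivative (g j) (at x) v) \<longlonglongrightarrow> g' x v"
    unfolding convergent_def by metis
  have unif: "\<exists>N. \<forall>j\<ge>N. \<forall>x v. norm (frechet_derivative (g j) (at x) v - g' x v) \<le> e * norm v"
    if e: "0 < e" for e
  proof -
    obtain N where N: "\<And>i j x v. i \<ge> N \<Longrightarrow> j \<ge> N \<Longrightarrow>
        norm (frechet_derivative (g i) (at x) v - frechet_derivative (g j) (at x) v) \<le> e * norm v"
      using Cauchy[OF e] by blast
    have "norm (frechet_derivative (g j) (at x) v - g' x v) \<le> e * norm v" if "j \<ge> N" for j x v
    proof (rule Lim_bounded[OF tendsto_norm[OF tendsto_diff[OF tendsto_const g']]])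
      show "\<forall>i\<ge>N. norm (frechet_derivative (g j) (at x) v - frechet_derivative (g i) (at x) v) \<le> e * norm v"
        using N that by blast
    qed
    then show ?thesis by blast
  qed
  \<comment> \<open>Uniform convergence of the derivatives makes the limit differentiable with the
    limit derivative; the limit is f because pointwise limits are unique.\<close>
  have "\<exists>f'. \<forall>x\<in>UNIV. (\<lambda>j. g j x) \<longlonglongrightarrow> f' x \<and> (f' has_derivative g' x) (at x within UNIV)"
  proof (rule has_derivative_sequence)
    show "(g j has_derivative frechet_derivative (g j) (at x)) (at x within UNIV)" for j x
      using hoelder_le_has_derivative[OF gS] by simp
    show "\<forall>\<^sub>F j in sequentially. \<forall>x\<in>UNIV. \<forall>v. norm (frechet_derivative (g j) (at x) v - g' x v) \<le> e * norm v"
      if "0 < e" for e using unif[OF that] by (auto simp: eventually_sequentially)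
  qed (use lim in auto)
  then obtain f' where f': "\<And>x. (\<lambda>j. g j x) \<longlonglongrightarrow> f' x" "\<And>x. (f' has_derivative g' x) (at x)"
    by auto
  have "f' = f" using LIMSEQ_unique[OF f'(1) lim] by blast
  then have D: "(f has_derivative g' x) (at x)" for x using f'(2) by simp
  have deriv: "hoelder_le n \<alpha> K (\<lambda>x. g' x v)" if v: "norm v \<le> 1" for v
  proof (rule Suc.IH)
    show "hoelder_le n \<alpha> K (\<lambda>x. frechet_derivative (g j) (at x) v)" for j using gS[of j] v by simp
    show "uniform_limit UNIV (\<lambda>j x. frechet_derivative (g j) (at x) v) (\<lambda>x. g' x v) sequentially"
    proof (rule uniform_limitI)
      fix e :: real assume "0 < e"
      then obtain N where N: "\<And>j x v. j \<ge> N \<Longrightarrow>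
          norm (frechet_derivative (g j) (at x) v - g' x v) \<le> e / 2 * norm v"
        using unif[of "e / 2"] by auto
      have "dist (frechet_derivative (g j) (at x) v) (g' x v) < e" if "j \<ge> N" for j x
      proof -
        have "e / 2 * norm v < e" using v \<open>0 < e\<close> mult_left_mono[OF v, of "e / 2"] by linarith
        then show ?thesis using N[OF that, of x v] unfolding dist_norm by linarith
      qed
      then show "\<forall>\<^sub>F j in sequentially. \<forall>x\<in>UNIV. dist (frechet_derivative (g j) (at x) v) (g' x v) < e"
        by (auto simp: eventually_sequentially)
    qed
  qed
  have "f differentiable at x" for x using D by (rule differentiableI)
  then show ?case using le deriv by (simp add: frechet_derivative_at[OF D, symmetric])
qed

section \<open>The Hoelder spaces in terms of norm bounds\<close>

text \<open>\<open>nderiv\<close> puts new directions at the head of the list, whereas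
  \<open>hoelder_le\<close> peels off the derivative taken first, which belongs to the last entry.
  This identity mediates between the two recursions, and it is why lists are split at their end
  below.\<close>

lemma nderiv_append: "nderiv f (vs @ [v]) = nderiv (\<lambda>x. frechet_derivative f (at x) v) vs"
  by (induction vs) simp_all

lemma C_n_mono: "C_n n f \<Longrightarrow> l \<le> n \<Longrightarrow> C_n l f"
  by (simp add: C_n_def)

lemma C_n_differentiable: "C_n (Suc n) f \<Longrightarrow> f differentiable at x"
  unfolding C_n_def by (metis list.size(3) nderiv.simps(1) zero_less_Suc)

lemma C_n_derivative:
  assumes "C_n (Suc n) f"
  shows "C_n n (\<lambda>x. frechet_derivative f (at x) v)"
proof -
  have "nderiv (\<lambda>x. frechet_derivative f (at x) v) vs differentiable at x" if "length vs < n" for vs x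
    using assms that nderiv_append[of f vs v] unfolding C_n_def
    by (metis Suc_less_eq length_append_singleton)
  moreover have "continuous_on UNIV (nderiv (\<lambda>x. frechet_derivative f (at x) v) vs)" if "length vs \<le> n" for vs
    using assms that nderiv_append[of f vs v] unfolding C_n_def
    by (metis Suc_le_mono length_append_singleton)
  ultimately show ?thesis by (simp add: C_n_def)
qed

lemma C_n_SucI:
  assumes D: "\<And>x. f differentiable at x"
    and d: "\<And>v. C_n n (\<lambda>x. frechet_derivative f (at x) v)"
  shows "C_n (Suc n) f"
proof -
  have "nderiv f vs differentiable at x" if "length vs < Suc n" for vs x
  proof (cases vs rule: rev_cases)
    case (snoc ws v)
    then show ?thesis using d[of v] that by (simp add: nderiv_append C_n_def)
  qed (simp add: D)
  moreover have "continuous_on UNIV (nderiv f vs)" if "length vs \<le> Suc n" for vs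
  proof (cases vs rule: rev_cases)
    case Nil
    have "f differentiable_on UNIV" using D by (simp add: differentiable_on_def)
    then show ?thesis using Nil by (simp add: differentiable_imp_continuous_on)
  next
    case (snoc ws v)
    then show ?thesis using d[of v] that by (simp add: nderiv_append C_n_def)
  qed
  ultimately show ?thesis by (simp add: C_n_def)
qed

lemma nderiv_sum:
  assumes "finite I" "\<And>i. i \<in> I \<Longrightarrow> C_n n (f i)" "length vs \<le> n"
  shows "nderiv (\<lambda>x. \<Sum>i\<in>I. c i *\<^sub>R f i x) vs = (\<lambda>x. \<Sum>i\<in>I. c i *\<^sub>R nderiv (f i) vs x)"
  using assms(3)
proof (induction vs)
  case (Cons v vs)
  then have D: "nderiv (f i) vs differentiable at x" if "i \<in> I" for i x
    using assms(2)[OF that] by (simp add: C_n_def)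
  have "((\<lambda>x. \<Sum>i\<in>I. c i *\<^sub>R nderiv (f i) vs x) has_derivative
      (\<lambda>v. \<Sum>i\<in>I. c i *\<^sub>R frechet_derivative (nderiv (f i) vs) (at x) v)) (at x)" for x
    using D by (intro has_derivative_sum has_derivative_scaleR_right) (simp add: frechet_derivative_works)
  from frechet_derivative_at[OF this, symmetric] show ?case using Cons by simp
qed simp

text \<open>The supremum in \<^const>\<open>mlin_norm\<close> is only meaningful if it is finite.\<close>

lemma C_n_nderiv_bounded:
  fixes f :: "'a::euclidean_space \<Rightarrow> 'b::euclidean_space"
  assumes "C_n l f"
  shows "\<exists>B. \<forall>vs. length vs = l \<longrightarrow> (\<forall>v\<in>set vs. norm v \<le> 1) \<longrightarrow> norm (nderiv f vs x) \<le> B"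
  using assms
proof (induction l arbitrary: f)
  case (Suc l)
  have "\<exists>B. \<forall>vs. length vs = l \<longrightarrow> (\<forall>v\<in>set vs. norm v \<le> 1) \<longrightarrow>
      norm (nderiv (\<lambda>x. frechet_derivative f (at x) b) vs x) \<le> B" for b
    using Suc C_n_derivative by blast
  then obtain B where B: "\<And>b vs. length vs = l \<Longrightarrow> (\<forall>v\<in>set vs. norm v \<le> 1) \<Longrightarrow>
      norm (nderiv (\<lambda>x. frechet_derivative f (at x) b) vs x) \<le> B b"
    by metis
  \<comment> \<open>The direction taken first is expanded in the basis: this leaves finitely many
    functions of order l, each bounded by the induction hypothesis.\<close>
  have "norm (nderiv f vs x) \<le> (\<Sum>b\<in>Basis. B b)" if vs: "length vs = Suc l" "\<forall>v\<in>set vs. norm v \<le> 1" for vs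
  proof -
    obtain ws w where ws: "vs = ws @ [w]" using vs(1) by (cases vs rule: rev_cases) auto
    have "frechet_derivative f (at x) w = (\<Sum>b\<in>Basis. (w \<bullet> b) *\<^sub>R frechet_derivative f (at x) b)" for x
    proof -
      have lin: "linear (frechet_derivative f (at x))"
        using Suc.prems by (intro linear_frechet_derivative C_n_differentiable)
      have "frechet_derivative f (at x) (\<Sum>b\<in>Basis. (w \<bullet> b) *\<^sub>R b) =
          (\<Sum>b\<in>Basis. (w \<bullet> b) *\<^sub>R frechet_derivative f (at x) b)"
        using lin by (simp add: linear_sum linear_scale)
      then show ?thesis by (simp add: euclidean_representation)
    qed
    then have "nderiv f vs x = (\<Sum>b\<in>Basis. (w \<bullet> b) *\<^sub>R nderiv (\<lambda>x. frechet_derivative f (at x) b) ws x)"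
      using nderiv_sum[of Basis l "\<lambda>b x. frechet_derivative f (at x) b" ws "\<lambda>b. w \<bullet> b"]
        C_n_derivative[OF Suc.prems] ws vs(1) by (simp add: nderiv_append)
    also have "norm \<dots> \<le> (\<Sum>b\<in>Basis. B b)"
    proof (rule sum_norm_le)
      fix b :: 'a assume b: "b \<in> Basis"
      have "\<bar>w \<bullet> b\<bar> \<le> 1" using Basis_le_norm[OF b, of w] vs(2) ws by auto
      moreover have "norm (nderiv (\<lambda>x. frechet_derivative f (at x) b) ws x) \<le> B b"
        using B vs ws by simp
      ultimately show "norm ((w \<bullet> b) *\<^sub>R nderiv (\<lambda>x. frechet_derivative f (at x) b) ws x) \<le> B b"
        using norm_scaleR_le[of "w \<bullet> b" 1] by simp
    qed
    finally show ?thesis .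
  qed
  then show ?case by blast
qed auto

section \<open>Norm bounds and the suprema in the definition of the norm\<close>

lemma norm_le_mlin_norm:
  assumes "\<And>vs. length vs = l \<Longrightarrow> (\<forall>v\<in>set vs. norm v \<le> 1) \<Longrightarrow> norm (T vs) \<le> B"
    and "length vs = l" "\<forall>v\<in>set vs. norm v \<le> 1"
  shows "norm (T vs) \<le> mlin_norm l T"
  unfolding mlin_norm_def using assms by (intro cSUP_upper) (auto simp: bdd_above_def)

lemma mlin_norm_le:
  fixes T :: "'a::real_normed_vector list \<Rightarrow> 'b::real_normed_vector"
  assumes "\<And>vs. length vs = l \<Longrightarrow> (\<forall>v\<in>set vs. norm v \<le> 1) \<Longrightarrow> norm (T vs) \<le> B"
  shows "mlin_norm l T \<le> B"
  unfolding mlin_norm_def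
proof (rule cSUP_least)
  have "replicate l (0 :: 'a) \<in> {vs. length vs = l \<and> (\<forall>v\<in>set vs. norm v \<le> 1)}" by auto
  then show "{vs :: 'a list. length vs = l \<and> (\<forall>v\<in>set vs. norm v \<le> 1)} \<noteq> {}" by blast
qed (use assms in auto)

lemma mlin_norm_nonneg:
  assumes "\<And>vs. length vs = l \<Longrightarrow> (\<forall>v\<in>set vs. norm v \<le> 1) \<Longrightarrow> norm (T vs) \<le> B"
  shows "0 \<le> mlin_norm l T"
  using order_trans[OF norm_ge_zero norm_le_mlin_norm[of l T B "replicate l 0"]] assms by auto

lemma hoelder_leI:
  assumes "C_n n f"
    and "\<And>vs x. length vs \<le> n \<Longrightarrow> (\<forall>v\<in>set vs. norm v \<le> 1) \<Longrightarrow> norm (nderiv f vs x) \<le> K"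
    and "\<And>vs x y. length vs = n \<Longrightarrow> (\<forall>v\<in>set vs. norm v \<le> 1) \<Longrightarrow>
      norm (nderiv f vs x - nderiv f vs y) \<le> K * norm (x - y) powr \<alpha>"
  shows "hoelder_le n \<alpha> K f"
  using assms
proof (induction n arbitrary: f)
  case 0
  then show ?case using "0"(2,3)[of "[]"] by simp
next
  case (Suc n)
  have "hoelder_le n \<alpha> K (\<lambda>x. frechet_derivative f (at x) v)" if "norm v \<le> 1" for v
  proof (rule Suc.IH[OF C_n_derivative[OF Suc.prems(1)]])
    fix vs :: "'a list" and x y assume "\<forall>v\<in>set vs. norm v \<le> 1"
    then have u: "\<forall>v\<in>set (vs @ [v]). norm v \<le> 1" using that by auto
    show "norm (nderiv (\<lambda>x. frechet_derivative f (at x) v) vs x) \<le> K" if "length vs \<le> n"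
      using Suc.prems(2)[OF _ u] that by (simp add: nderiv_append)
    show "norm (nderiv (\<lambda>x. frechet_derivative f (at x) v) vs x -
        nderiv (\<lambda>x. frechet_derivative f (at x) v) vs y) \<le> K * norm (x - y) powr \<alpha>" if "length vs = n"
      using Suc.prems(3)[OF _ u] that by (simp add: nderiv_append)
  qed
  then show ?case using Suc.prems(2)[of "[]"] C_n_differentiable[OF Suc.prems(1)] by simp
qed

lemma hoelder_le_nderiv:
  assumes "hoelder_le n \<alpha> K f" "length vs \<le> n" "\<forall>v\<in>set vs. norm v \<le> 1"
  shows "hoelder_le (n - length vs) \<alpha> K (nderiv f vs)"
  using assms
proof (induction vs arbitrary: n f rule: rev_induct)
  case (snoc v vs)
  then obtain m where "n = Suc m" by (cases n) auto
  then show ?case using snoc.prems snoc.IH[of m "\<lambda>x. frechet_derivative f (at x) v"]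
    by (simp add: nderiv_append)
qed simp

text \<open>By rescaling; needed because \<open>C_n\<close> quantifies over all vectors and not only
  over those in the unit ball.\<close>

lemma hoelder_le_derivative:
  assumes "hoelder_le (Suc n) \<alpha> K f"
  shows "hoelder_le n \<alpha> (norm v * K) (\<lambda>x. frechet_derivative f (at x) v)"
proof (cases "v = 0")
  case True
  have "frechet_derivative f (at x) v = 0" for x
    using True linear_0[OF linear_frechet_derivative, of f "at x"] assms by simp
  then show ?thesis using True hoelder_le_const[of 0 0 n \<alpha>] by simp
next
  case False
  have "hoelder_le n \<alpha> K (\<lambda>x. frechet_derivative f (at x) ((1 / norm v) *\<^sub>R v))"
    using assms False by simp
  then have "hoelder_le n \<alpha> (norm v * K)
      (\<lambda>x. norm v *\<^sub>R frechet_derivative f (at x) ((1 / norm v) *\<^sub>R v))"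
    using hoelder_le_scaleR[of n \<alpha> K _ "norm v"] by simp
  moreover have "norm v *\<^sub>R frechet_derivative f (at x) ((1 / norm v) *\<^sub>R v) = frechet_derivative f (at x) v" for x
    using frechet_derivative_linear(2)[of f x "1 / norm v" v] assms False by simp
  ultimately show ?thesis by simp
qed

lemma hoelder_le_imp_C_n:
  assumes "hoelder_le n \<alpha> K f" "0 < \<alpha>" "\<alpha> \<le> 1"
  shows "C_n n f"
  using assms(1)
proof (induction n arbitrary: f K)
  case 0
  then show ?case using hoelder_le_continuous[OF 0 assms(2,3)] by (simp add: C_n_def)
next
  case (Suc n)
  show ?case
    using Suc.IH[OF hoelder_le_derivative[OF Suc.prems]] Suc.prems by (intro C_n_SucI) simp_all
qed

text \<open>One direction of the dictionary between the norm and its bounds;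
  \<open>hoelder_norm_le\<close> and \<open>C0_hoelderI\<close> form the other. The suprema bound
  their members because the space includes boundedness of both sets, and the inner suprema are
  finite by \<open>C_n_nderiv_bounded\<close>.\<close>

lemma C0_hoelder_imp_hoelder_le:
  assumes "f \<in> C0_hoelder n \<alpha>"
  shows "hoelder_le n \<alpha> (hoelder_norm n \<alpha> f) f"
proof -
  have C: "C_n n f" and b: "bdd_above (deriv_norms n f)" "bdd_above (hoelder_quotients n \<alpha> f)"
    using assms by (auto simp: C0_hoelder_def)
  have bd: "\<exists>B. \<forall>vs. length vs = l \<longrightarrow> (\<forall>v\<in>set vs. norm v \<le> 1) \<longrightarrow> norm (nderiv f vs x) \<le> B"
    if "l \<le> n" for l x using C_n_nderiv_bounded[OF C_n_mono[OF C that]] .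
  show ?thesis
  proof (rule hoelder_leI[OF C])
    fix vs :: "'a list" and x y assume u: "\<forall>v\<in>set vs. norm v \<le> 1"
    show "norm (nderiv f vs x) \<le> hoelder_norm n \<alpha> f" if l: "length vs \<le> n"
    proof -
      obtain B where B: "\<forall>ws. length ws = length vs \<longrightarrow> (\<forall>v\<in>set ws. norm v \<le> 1) \<longrightarrow> norm (nderiv f ws x) \<le> B"
        using bd[OF l] by blast
      have "norm (nderiv f vs x) \<le> mlin_norm (length vs) (\<lambda>vs. nderiv f vs x)"
        by (rule norm_le_mlin_norm[where B = B]) (use B u in auto)
      also have "\<dots> \<le> Sup (deriv_norms n f)"
        using l by (intro cSup_upper b) (auto simp: deriv_norms_def)
      finally show ?thesis by (simp add: hoelder_norm_def)
    qed
    show "norm (nderiv f vs x - nderiv f vs y) \<le> hoelder_norm n \<alpha> f * norm (x - y) powr \<alpha>" if l: "length vs = n"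
    proof (cases "x = y")
      case False
      obtain B where B: "\<forall>ws. length ws = n \<longrightarrow> (\<forall>v\<in>set ws. norm v \<le> 1) \<longrightarrow> norm (nderiv f ws x) \<le> B"
        using bd[OF order_refl] by blast
      obtain B' where B': "\<forall>ws. length ws = n \<longrightarrow> (\<forall>v\<in>set ws. norm v \<le> 1) \<longrightarrow> norm (nderiv f ws y) \<le> B'"
        using bd[OF order_refl] by blast
      have le: "norm (nderiv f vs x - nderiv f vs y) \<le> mlin_norm n (\<lambda>vs. nderiv f vs x - nderiv f vs y)"
      proof (rule norm_le_mlin_norm[where B = "B + B'"])
        fix ws :: "'a list" assume ws: "length ws = n" "\<forall>v\<in>set ws. norm v \<le> 1"
        have "norm (nderiv f ws x) \<le> B" "norm (nderiv f ws y) \<le> B'" using B B' ws by auto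
        then show "norm (nderiv f ws x - nderiv f ws y) \<le> B + B'"
          using norm_triangle_ineq4[of "nderiv f ws x" "nderiv f ws y"] by linarith
      qed (use u l in auto)
      have "mlin_norm n (\<lambda>vs. nderiv f vs x - nderiv f vs y) / norm (x - y) powr \<alpha>
          \<le> Sup (hoelder_quotients n \<alpha> f)"
        using False by (intro cSup_upper b) (auto simp: hoelder_quotients_def)
      also have "\<dots> \<le> hoelder_norm n \<alpha> f" by (simp add: hoelder_norm_def)
      finally have "mlin_norm n (\<lambda>vs. nderiv f vs x - nderiv f vs y) \<le> hoelder_norm n \<alpha> f * norm (x - y) powr \<alpha>"
        using False by (simp add: pos_divide_le_eq)
      with le show ?thesis by (rule order_trans)
    qed simp
  qed
qed

lemma
  fixes f :: "'a::euclidean_space \<Rightarrow> 'b::euclidean_space"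
  assumes f: "hoelder_le n \<alpha> K f" and \<alpha>: "0 < \<alpha>" "\<alpha> \<le> 1"
  shows deriv_norms_le: "r \<in> deriv_norms n f \<Longrightarrow> r \<le> K"
    and hoelder_quotients_le: "r \<in> hoelder_quotients n \<alpha> f \<Longrightarrow> r \<le> K"
    and hoelder_norm_le: "hoelder_norm n \<alpha> f \<le> K"
proof -
  have le: "norm (nderiv f vs x) \<le> K" if "length vs \<le> n" "\<forall>v\<in>set vs. norm v \<le> 1" for vs x
    using hoelder_le_norm[OF hoelder_le_nderiv[OF f that]] .
  show 1: "r \<le> K" if r: "r \<in> deriv_norms n f" for r
  proof -
    obtain l x where "l \<le> n" "r = mlin_norm l (\<lambda>vs. nderiv f vs x)"
      using r by (auto simp: deriv_norms_def)
    then show ?thesis by (auto intro!: mlin_norm_le le)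
  qed
  show 2: "r \<le> K" if r: "r \<in> hoelder_quotients n \<alpha> f" for r
  proof -
    obtain x y where "x \<noteq> y"
      and r: "r = mlin_norm n (\<lambda>vs. nderiv f vs x - nderiv f vs y) / norm (x - y) powr \<alpha>"
      using r by (auto simp: hoelder_quotients_def)
    moreover have "mlin_norm n (\<lambda>vs. nderiv f vs x - nderiv f vs y) \<le> K * norm (x - y) powr \<alpha>"
    proof (rule mlin_norm_le)
      fix vs :: "'a list" assume "length vs = n" "\<forall>v\<in>set vs. norm v \<le> 1"
      then show "norm (nderiv f vs x - nderiv f vs y) \<le> K * norm (x - y) powr \<alpha>"
        using hoelder_le_nderiv[OF f, of vs] by simp
    qed
    ultimately show ?thesis by (simp add: pos_divide_le_eq)
  qed
  have "deriv_norms n f \<noteq> {}" by (auto simp: deriv_norms_def)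
  \<comment> \<open>The supremum of the empty set is unspecified; distinct points exist because a
    Euclidean space has a nonzero basis vector.\<close>
  moreover have "hoelder_quotients n \<alpha> f \<noteq> {}"
  proof -
    obtain b :: 'a where "b \<in> Basis" using nonempty_Basis by blast
    then have "b \<noteq> 0" using nonzero_Basis by blast
    then show ?thesis unfolding hoelder_quotients_def by blast
  qed
  ultimately show "hoelder_norm n \<alpha> f \<le> K"
    unfolding hoelder_norm_def using 1 2 by (simp add: cSup_least)
qed

text \<open>Small values far out and a Hoelder bound force small derivatives, by
  \<open>norm_derivative_le_values\<close> with a step of length at most 1; this enlarges the radius
  by 1 per derivative. The threshold \<delta> precedes f because the induction applies it to
  directional derivatives of f.\<close>

lemma nderiv_small_outside_ball:
  assumes \<alpha>: "0 < \<alpha>" "\<alpha> \<le> 1" and "0 \<le> K" "0 < e" "l \<le> n"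
  shows "\<exists>\<delta>>0. \<forall>(f :: 'a::real_normed_vector \<Rightarrow> 'b::real_normed_vector) r vs x. hoelder_le n \<alpha> K f \<longrightarrow>
    (\<forall>y. r \<le> norm y \<longrightarrow> norm (f y) \<le> \<delta>) \<longrightarrow> r + real l \<le> norm x \<longrightarrow> length vs = l \<longrightarrow>
    (\<forall>v\<in>set vs. norm v \<le> 1) \<longrightarrow> norm (nderiv f vs x) \<le> e"
  using \<open>l \<le> n\<close>
proof (induction l arbitrary: n)
  case 0
  then show ?case using \<open>0 < e\<close> by auto
next
  case (Suc l)
  then obtain m where m: "n = Suc m" "l \<le> m" by (cases n) auto
  from Suc.IH[OF m(2)] obtain \<delta>' where "0 < \<delta>'" and IH:
    "\<And>(f :: 'a \<Rightarrow> 'b) r vs x. hoelder_le m \<alpha> K f \<Longrightarrow>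
      (\<forall>y. r \<le> norm y \<longrightarrow> norm (f y) \<le> \<delta>') \<Longrightarrow> r + real l \<le> norm x \<Longrightarrow> length vs = l \<Longrightarrow>
      (\<forall>v\<in>set vs. norm v \<le> 1) \<Longrightarrow> norm (nderiv f vs x) \<le> e"
    by auto
  \<comment> \<open>Makes the Taylor part \<open>2 * K * h powr \<alpha>\<close> at most \<delta>' /
    2; the 4 added in the denominator covers K = 0. The other half of \<delta>' comes from the
    choice of \<delta> below.\<close>
  define h where "h = min 1 ((\<delta>' / (4 * K + 4)) powr (1 / \<alpha>))"
  have h: "0 < h" "h \<le> 1" using \<open>0 < \<delta>'\<close> \<open>0 \<le> K\<close> by (auto simp: h_def)
  have "h powr \<alpha> \<le> ((\<delta>' / (4 * K + 4)) powr (1 / \<alpha>)) powr \<alpha>"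
    using h \<alpha> by (intro powr_mono2) (auto simp: h_def)
  also have "\<dots> = \<delta>' / (4 * K + 4)" using \<alpha> \<open>0 < \<delta>'\<close> \<open>0 \<le> K\<close> by (simp add: powr_powr)
  finally have "2 * K * h powr \<alpha> \<le> 2 * K * (\<delta>' / (4 * K + 4))"
    using \<open>0 \<le> K\<close> by (intro mult_left_mono) auto
  also have "\<dots> \<le> \<delta>' / 2" using \<open>0 < \<delta>'\<close> \<open>0 \<le> K\<close> by (simp add: field_simps)
  finally have hK: "2 * K * h powr \<alpha> \<le> \<delta>' / 2" .
  define \<delta> where "\<delta> = \<delta>' * h / 4"
  have "norm (nderiv f vs x) \<le> e"
    if f: "hoelder_le n \<alpha> K f" and small: "\<forall>y. r \<le> norm y \<longrightarrow> norm (f y) \<le> \<delta>"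
      and x: "r + real (Suc l) \<le> norm x" and vs: "length vs = Suc l" "\<forall>v\<in>set vs. norm v \<le> 1"
    for f :: "'a \<Rightarrow> 'b" and r vs x
  proof -
    obtain ws v where ws: "vs = ws @ [v]" using vs(1) by (cases vs rule: rev_cases) auto
    then have v: "norm v \<le> 1" using vs by simp
    have "norm (nderiv (\<lambda>x. frechet_derivative f (at x) v) ws x) \<le> e"
    proof (rule IH[where r = "r + 1"])
      show "hoelder_le m \<alpha> K (\<lambda>x. frechet_derivative f (at x) v)" using f m v by simp
      show "\<forall>y. r + 1 \<le> norm y \<longrightarrow> norm (frechet_derivative f (at y) v) \<le> \<delta>'"
      proof (intro allI impI)
        fix y :: 'a assume y: "r + 1 \<le> norm y"
        have "norm (h *\<^sub>R v) \<le> 1" using h v by (simp add: mult_le_one)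
        then have "r \<le> norm (y + h *\<^sub>R v)" using y norm_diff_ineq[of y "h *\<^sub>R v"] by linarith
        then have "norm (f (y + h *\<^sub>R v)) \<le> \<delta>" "norm (f y) \<le> \<delta>" using small y by auto
        with f m have "norm (frechet_derivative f (at y) v) \<le> 2 * \<delta> / h + 2 * K * h powr \<alpha>"
          by (intro norm_derivative_le_values[OF _ \<alpha> v h(1)]) auto
        moreover have "2 * \<delta> / h = \<delta>' / 2" using h by (simp add: \<delta>_def)
        ultimately show "norm (frechet_derivative f (at y) v) \<le> \<delta>'" using hK by simp
      qed
    qed (use x ws vs in auto)
    then show ?thesis by (simp add: ws nderiv_append)
  qed
  moreover have "0 < \<delta>" using \<open>0 < \<delta>'\<close> h by (simp add: \<delta>_def)
  ultimately show ?case by blast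
qed

text \<open>The decay of the derivatives is supplied by \<open>nderiv_small_outside_ball\<close>, so
  that for the flow only the decay of the displacement itself has to be shown.\<close>

lemma C0_hoelderI:
  fixes f :: "'a::euclidean_space \<Rightarrow> 'a"
  assumes f: "hoelder_le n \<alpha> K f" and lim: "(f \<longlongrightarrow> 0) at_infinity" and \<alpha>: "0 < \<alpha>" "\<alpha> \<le> 1"
  shows "f \<in> C0_hoelder n \<alpha>"
proof -
  have K: "0 \<le> K" using f by (rule hoelder_le_nonneg)
  have "((\<lambda>x. mlin_norm l (\<lambda>vs. nderiv f vs x)) \<longlongrightarrow> 0) at_infinity" if l: "l \<le> n" for l
  proof (rule tendstoI)
    fix e :: real assume e: "0 < e"
    obtain \<delta> where "0 < \<delta>" and \<delta>: "\<And>r vs x.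
      (\<forall>y. r \<le> norm y \<longrightarrow> norm (f y) \<le> \<delta>) \<Longrightarrow> r + real l \<le> norm x \<Longrightarrow> length vs = l \<Longrightarrow>
      (\<forall>v\<in>set vs. norm v \<le> 1) \<Longrightarrow> norm (nderiv f vs x) \<le> e / 2"
      using nderiv_small_outside_ball[OF \<alpha> K half_gt_zero[OF e] l, where ?'a = 'a and ?'b = 'a] f by blast
    obtain r where r: "\<forall>y. r \<le> norm y \<longrightarrow> norm (f y) \<le> \<delta>"
      using tendstoD[OF lim \<open>0 < \<delta>\<close>] by (force simp: eventually_at_infinity)
    have "dist (mlin_norm l (\<lambda>vs. nderiv f vs x)) 0 < e" if x: "r + real l \<le> norm x" for x
    proof -
      have "mlin_norm l (\<lambda>vs. nderiv f vs x) \<le> e / 2" using \<delta>[OF r x] by (rule mlin_norm_le)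
      moreover have "0 \<le> mlin_norm l (\<lambda>vs. nderiv f vs x)" using \<delta>[OF r x] by (rule mlin_norm_nonneg)
      ultimately show ?thesis using e by simp
    qed
    then show "\<forall>\<^sub>F x in at_infinity. dist (mlin_norm l (\<lambda>vs. nderiv f vs x)) 0 < e"
      by (auto simp: eventually_at_infinity)
  qed
  then show ?thesis
    using hoelder_le_imp_C_n[OF f \<alpha>] deriv_norms_le[OF f \<alpha>] hoelder_quotients_le[OF f \<alpha>]
    by (auto simp: C0_hoelder_def bdd_above_def)
qed

lemma C0_hoelder_tendsto:
  assumes "f \<in> C0_hoelder n \<alpha>"
  shows "(f \<longlongrightarrow> 0) at_infinity"
proof -
  have "((\<lambda>x. mlin_norm 0 (\<lambda>vs. nderiv f vs x)) \<longlongrightarrow> 0) at_infinity"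
    using assms by (simp add: C0_hoelder_def)
  moreover have "mlin_norm 0 (\<lambda>vs. nderiv f vs x) = norm (f x)" for x
    by (simp add: mlin_norm_def)
  ultimately show ?thesis by (simp add: tendsto_norm_zero_iff)
qed

lemma
  fixes f :: "'a::euclidean_space \<Rightarrow> 'a"
  assumes f: "f \<in> C0_hoelder n \<alpha>" and \<alpha>: "0 < \<alpha>" "\<alpha> \<le> 1"
  shows C0_hoelder_scaleR: "c *\<^sub>R f \<in> C0_hoelder n \<alpha>"
    and hoelder_norm_scaleR_le: "hoelder_norm n \<alpha> (c *\<^sub>R f) \<le> \<bar>c\<bar> * hoelder_norm n \<alpha> f"
proof -
  have "hoelder_le n \<alpha> (\<bar>c\<bar> * hoelder_norm n \<alpha> f) (\<lambda>x. c *\<^sub>R f x)"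
    using f by (intro hoelder_le_scaleR C0_hoelder_imp_hoelder_le)
  then have *: "hoelder_le n \<alpha> (\<bar>c\<bar> * hoelder_norm n \<alpha> f) (c *\<^sub>R f)" by (simp add: scaleR_fun_def)
  then show "hoelder_norm n \<alpha> (c *\<^sub>R f) \<le> \<bar>c\<bar> * hoelder_norm n \<alpha> f"
    using \<alpha> by (rule hoelder_norm_le)
  have "((\<lambda>x. c *\<^sub>R f x) \<longlongrightarrow> c *\<^sub>R 0) at_infinity"
    using C0_hoelder_tendsto[OF f] by (intro tendsto_intros)
  then show "c *\<^sub>R f \<in> C0_hoelder n \<alpha>"
    using * \<alpha> by (intro C0_hoelderI) (auto simp: scaleR_fun_def)
qed

lemma
  fixes f g :: "'a::euclidean_space \<Rightarrow> 'a"
  assumes f: "f \<in> C0_hoelder n \<alpha>" and g: "g \<in> C0_hoelder n \<alpha>" and \<alpha>: "0 < \<alpha>" "\<alpha> \<le> 1"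
  shows C0_hoelder_add: "f + g \<in> C0_hoelder n \<alpha>"
    and hoelder_norm_triangle: "hoelder_norm n \<alpha> (f + g) \<le> hoelder_norm n \<alpha> f + hoelder_norm n \<alpha> g"
proof -
  have "hoelder_le n \<alpha> (hoelder_norm n \<alpha> f + hoelder_norm n \<alpha> g) (\<lambda>x. f x + g x)"
    using f g by (intro hoelder_le_add C0_hoelder_imp_hoelder_le)
  then have *: "hoelder_le n \<alpha> (hoelder_norm n \<alpha> f + hoelder_norm n \<alpha> g) (f + g)"
    by (simp add: plus_fun_def)
  then show "hoelder_norm n \<alpha> (f + g) \<le> hoelder_norm n \<alpha> f + hoelder_norm n \<alpha> g"
    using \<alpha> by (rule hoelder_norm_le)
  have "((\<lambda>x. f x + g x) \<longlongrightarrow> 0 + 0) at_infinity"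
    using C0_hoelder_tendsto[OF f] C0_hoelder_tendsto[OF g] by (intro tendsto_intros)
  then show "f + g \<in> C0_hoelder n \<alpha>"
    using * \<alpha> by (intro C0_hoelderI) (auto simp: plus_fun_def)
qed

lemma hoelder_norm_nonneg: "f \<in> C0_hoelder n \<alpha> \<Longrightarrow> 0 \<le> hoelder_norm n \<alpha> f"
  using C0_hoelder_imp_hoelder_le hoelder_le_nonneg by blast

lemma zero_C0_hoelder:
  "0 < \<alpha> \<Longrightarrow> \<alpha> \<le> 1 \<Longrightarrow> (0 :: 'a::euclidean_space \<Rightarrow> 'a) \<in> C0_hoelder n \<alpha>"
  by (rule C0_hoelderI[where K = 0]) (auto simp: zero_fun_def intro: hoelder_le_const)

section \<open>Time integrals and the Gronwall inequality\<close>

lemma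
  fixes f :: "'a::euclidean_space \<Rightarrow> 'b::euclidean_space"
  assumes "f \<in> borel_measurable (lebesgue_on S)" "S \<in> sets lebesgue" "g integrable_on S"
    and le: "\<And>x. x \<in> S \<Longrightarrow> norm (f x) \<le> g x"
  shows integrable_on_bounded: "f integrable_on S"
    and norm_integral_le: "norm (integral S f) \<le> integral S g"
proof -
  have "f absolutely_integrable_on S"
    using assms by (rule measurable_bounded_by_integrable_imp_absolutely_integrable)
  then show "f integrable_on S" by (simp add: absolutely_integrable_on_def)
  then show "norm (integral S f) \<le> integral S g"
    using \<open>g integrable_on S\<close> le by (rule Henstock_Kurzweil_Integration.integral_norm_bound_integral)
qed

text \<open>Differentiation under the integral sign. The integral is taken pointwise in x, so
  directional derivatives must be shown measurable in s before the induction can go on. The Taylor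
  remainder of \<open>g s\<close> is bounded by k s times a function of the increment alone, which
  yields the derivative of the integral directly.\<close>

lemma hoelder_le_integral:
  fixes g :: "'c::euclidean_space \<Rightarrow> 'a::euclidean_space \<Rightarrow> 'b::euclidean_space"
  assumes S: "S \<in> sets lebesgue" and k: "k integrable_on S"
    and "\<And>s. s \<in> S \<Longrightarrow> hoelder_le n \<alpha> (k s) (g s)"
    and "\<And>x. (\<lambda>s. g s x) \<in> borel_measurable (lebesgue_on S)"
    and \<alpha>: "0 < \<alpha>" "\<alpha> \<le> 1"
  shows "hoelder_le n \<alpha> (integral S k) (\<lambda>x. integral S (\<lambda>s. g s x))"
  using assms(3,4)
proof (induction n arbitrary: g)
  case 0
  have int: "(\<lambda>s. g s x) integrable_on S" for x
    using 0(2) S k by (rule integrable_on_bounded) (rule hoelder_le_norm[OF 0(1)])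
  have "norm (integral S (\<lambda>s. g s x)) \<le> integral S k" for x
    using 0(2) S k by (rule norm_integral_le) (rule hoelder_le_norm[OF 0(1)])
  moreover have "norm (integral S (\<lambda>s. g s x) - integral S (\<lambda>s. g s y)) \<le> integral S k * norm (x - y) powr \<alpha>" for x y
  proof -
    have "norm (integral S (\<lambda>s. g s x - g s y)) \<le> integral S (\<lambda>s. k s * norm (x - y) powr \<alpha>)"
    proof (rule norm_integral_le[OF _ S])
      show "(\<lambda>s. g s x - g s y) \<in> borel_measurable (lebesgue_on S)"
        using 0(2) by (intro borel_measurable_diff)
      show "(\<lambda>s. k s * norm (x - y) powr \<alpha>) integrable_on S"
        using k by (rule integrable_on_mult_left)
      show "norm (g s x - g s y) \<le> k s * norm (x - y) powr \<alpha>" if "s \<in> S" for s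
        using 0(1)[OF that] by simp
    qed
    then show ?thesis
      by (simp add: Henstock_Kurzweil_Integration.integral_diff[OF int int])
  qed
  ultimately show ?case by simp
next
  case (Suc n)
  have D: "g s differentiable at x" if "s \<in> S" for s x using Suc.prems(1)[OF that] by simp
  have k0: "0 \<le> k s" if "s \<in> S" for s using hoelder_le_nonneg[OF Suc.prems(1)[OF that]] .
  have k0': "0 \<le> integral S k" using k k0 by (rule Henstock_Kurzweil_Integration.integral_nonneg)
  let ?d = "\<lambda>s x v. frechet_derivative (g s) (at x) v"
  \<comment> \<open>The directional derivative is the limit of difference quotients with steps 1 /
    Suc j, by the Taylor estimate, and measurability passes to the limit.\<close>
  have meas: "(\<lambda>s. ?d s x v) \<in> borel_measurable (lebesgue_on S)" for x v
  proof (rule borel_measurable_LIMSEQ_metric)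
    fix j
    show "(\<lambda>s. real (Suc j) *\<^sub>R (g s (x + (1 / real (Suc j)) *\<^sub>R v) - g s x)) \<in> borel_measurable (lebesgue_on S)"
      using Suc.prems(2) by (intro borel_measurable_scaleR borel_measurable_diff) auto
  next
    fix s assume "s \<in> space (lebesgue_on S)"
    then have s: "s \<in> S" by simp
    let ?h = "\<lambda>j. 1 / real (Suc j)"
    have "(\<lambda>j. norm (?h j *\<^sub>R v)) \<longlonglongrightarrow> norm ((0 :: real) *\<^sub>R v)"
      by (intro tendsto_intros LIMSEQ_Suc lim_1_over_n)
    then have "(\<lambda>j. norm (?h j *\<^sub>R v) powr \<alpha>) \<longlonglongrightarrow> 0"
      using \<alpha> by (intro tendsto_zero_powrI[where b = \<alpha>]) auto
    then have "(\<lambda>j. norm v * (2 * k s) * norm (?h j *\<^sub>R v) powr \<alpha>) \<longlonglongrightarrow> 0"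
      by (rule tendsto_mult_right_zero)
    then have "(\<lambda>j. real (Suc j) *\<^sub>R (g s (x + ?h j *\<^sub>R v) - g s x) - ?d s x v) \<longlonglongrightarrow> 0"
    proof (rule Lim_null_comparison[rotated], intro always_eventually allI)
      fix j
      have "real (Suc j) *\<^sub>R (g s (x + ?h j *\<^sub>R v) - g s x) - ?d s x v =
          real (Suc j) *\<^sub>R (g s (x + ?h j *\<^sub>R v) - g s x - ?d s x (?h j *\<^sub>R v))"
        unfolding frechet_derivative_linear(2)[OF D[OF s]] by (simp add: scaleR_diff_right)
      then have "norm (real (Suc j) *\<^sub>R (g s (x + ?h j *\<^sub>R v) - g s x) - ?d s x v) =
          real (Suc j) * norm (g s (x + ?h j *\<^sub>R v) - g s x - ?d s x (?h j *\<^sub>R v))" by simp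
      also have "\<dots> \<le> real (Suc j) * (norm (?h j *\<^sub>R v) * (2 * k s * norm (?h j *\<^sub>R v) powr \<alpha>))"
        by (intro mult_left_mono hoelder_le_Taylor[OF Suc.prems(1)[OF s] \<alpha>]) simp
      also have "\<dots> = norm v * (2 * k s) * norm (?h j *\<^sub>R v) powr \<alpha>"
        by (simp only: norm_scaleR) simp
      finally show "norm (real (Suc j) *\<^sub>R (g s (x + ?h j *\<^sub>R v) - g s x) - ?d s x v)
          \<le> norm v * (2 * k s) * norm (?h j *\<^sub>R v) powr \<alpha>" .
    qed
    then show "(\<lambda>j. real (Suc j) *\<^sub>R (g s (x + ?h j *\<^sub>R v) - g s x)) \<longlonglongrightarrow> ?d s x v"
      by (rule LIM_zero_cancel)
  qed
  have int: "(\<lambda>s. g s x) integrable_on S" for x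
    using Suc.prems(2) S k by (rule integrable_on_bounded) (rule hoelder_le_norm[OF Suc.prems(1)])
  have intd: "(\<lambda>s. ?d s x v) integrable_on S" for x v
    using meas S integrable_on_mult_left[OF k, of "norm v"]
    by (rule integrable_on_bounded) (rule hoelder_le_norm_derivative[OF Suc.prems(1)])
  have der: "((\<lambda>x. integral S (\<lambda>s. g s x)) has_derivative (\<lambda>v. integral S (\<lambda>s. ?d s x v))) (at x)" for x
    unfolding has_derivative_at'
  proof (intro conjI allI impI)
    show "bounded_linear (\<lambda>v. integral S (\<lambda>s. ?d s x v))"
    proof (rule bounded_linear_intro)
      fix v w :: 'a and c :: real
      have "integral S (\<lambda>s. ?d s x (v + w)) = integral S (\<lambda>s. ?d s x v + ?d s x w)"
        by (intro Henstock_Kurzweil_Integration.integral_cong frechet_derivative_linear D)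
      then show "integral S (\<lambda>s. ?d s x (v + w)) = integral S (\<lambda>s. ?d s x v) + integral S (\<lambda>s. ?d s x w)"
        by (simp add: Henstock_Kurzweil_Integration.integral_add intd)
      have "integral S (\<lambda>s. ?d s x (c *\<^sub>R v)) = integral S (\<lambda>s. c *\<^sub>R ?d s x v)"
        by (intro Henstock_Kurzweil_Integration.integral_cong frechet_derivative_linear D)
      then show "integral S (\<lambda>s. ?d s x (c *\<^sub>R v)) = c *\<^sub>R integral S (\<lambda>s. ?d s x v)"
        by simp
      have "norm (integral S (\<lambda>s. ?d s x v)) \<le> integral S (\<lambda>s. k s * norm v)"
        using meas S integrable_on_mult_left[OF k] by (rule norm_integral_le)
          (rule hoelder_le_norm_derivative[OF Suc.prems(1)])
      then show "norm (integral S (\<lambda>s. ?d s x v)) \<le> norm v * integral S k" by (simp add: mult.commute)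
    qed
    fix e :: real assume e: "0 < e"
    \<comment> \<open>For increments shorter than \<delta> the integrated remainder, divided by
      their length, is at most 2 * integral S k times \<delta> powr \<alpha>, hence less than e. The
      added 1 covers a vanishing integral.\<close>
    define \<delta> where "\<delta> = (e / (2 * integral S k + 1)) powr (1 / \<alpha>)"
    have \<delta>: "0 < \<delta>" using e k0' by (simp add: \<delta>_def)
    have "norm (integral S (\<lambda>s. g s y) - integral S (\<lambda>s. g s x) - integral S (\<lambda>s. ?d s x (y - x))) / norm (y - x) < e"
      if y: "0 < norm (y - x)" "norm (y - x) < \<delta>" for y
    proof -
      let ?w = "norm (y - x)"
      have "norm (integral S (\<lambda>s. g s y - g s x - ?d s x (y - x))) \<le> integral S (\<lambda>s. k s * (?w * (2 * ?w powr \<alpha>)))"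
      proof (rule norm_integral_le[OF _ S])
        show "(\<lambda>s. g s y - g s x - ?d s x (y - x)) \<in> borel_measurable (lebesgue_on S)"
          using Suc.prems(2) meas by (intro borel_measurable_diff)
        show "(\<lambda>s. k s * (?w * (2 * ?w powr \<alpha>))) integrable_on S"
          using k by (rule integrable_on_mult_left)
        show "norm (g s y - g s x - ?d s x (y - x)) \<le> k s * (?w * (2 * ?w powr \<alpha>))" if "s \<in> S" for s
          using hoelder_le_Taylor[OF Suc.prems(1)[OF that] \<alpha>, of x "y - x"] by (simp add: mult_ac)
      qed
      also have "\<dots> = ?w * (2 * integral S k * ?w powr \<alpha>)" by simp
      finally have "norm (integral S (\<lambda>s. g s y - g s x - ?d s x (y - x))) / ?w \<le> 2 * integral S k * ?w powr \<alpha>"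
        using y by (simp add: pos_divide_le_eq mult.commute)
      also have "\<dots> < e"
      proof -
        have "?w powr \<alpha> \<le> \<delta> powr \<alpha>" using y \<alpha> by (intro powr_mono2) auto
        also have "\<delta> powr \<alpha> = e / (2 * integral S k + 1)"
          using \<alpha> e k0' by (simp add: \<delta>_def powr_powr)
        finally have "2 * integral S k * ?w powr \<alpha> \<le> 2 * integral S k * (e / (2 * integral S k + 1))"
          using k0' by (intro mult_left_mono) auto
        also have "\<dots> < e" using e k0' by (simp add: field_simps)
        finally show ?thesis .
      qed
      also have "integral S (\<lambda>s. g s y - g s x - ?d s x (y - x)) =
          integral S (\<lambda>s. g s y) - integral S (\<lambda>s. g s x) - integral S (\<lambda>s. ?d s x (y - x))"
        by (simp add: Henstock_Kurzweil_Integration.integral_diff int intd integrable_diff)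
      finally show ?thesis .
    qed
    then show "\<exists>d>0. \<forall>y. 0 < norm (y - x) \<and> norm (y - x) < d \<longrightarrow>
        norm (integral S (\<lambda>s. g s y) - integral S (\<lambda>s. g s x) - integral S (\<lambda>s. ?d s x (y - x))) / norm (y - x) < e"
      using \<delta> by blast
  qed
  have "norm (integral S (\<lambda>s. g s x)) \<le> integral S k" for x
    using Suc.prems(2) S k by (rule norm_integral_le) (rule hoelder_le_norm[OF Suc.prems(1)])
  moreover have "(\<lambda>x. integral S (\<lambda>s. g s x)) differentiable at x" for x using der by (rule differentiableI)
  moreover have "hoelder_le n \<alpha> (integral S k) (\<lambda>x. integral S (\<lambda>s. ?d s x v))" if "norm v \<le> 1" for v
    using Suc.prems(1) that meas by (intro Suc.IH) auto
  ultimately show ?case by (simp add: frechet_derivative_at[OF der, symmetric])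
qed

section \<open>The Gronwall inequality by an exponential weight\<close>

lemma exp_step:
  fixes x :: real
  assumes "0 \<le> x" "x \<le> 1 / 2"
  shows "x * exp x \<le> 2 * (exp x - 1)"
proof -
  have "exp x \<le> 1 + x + x\<^sup>2" using assms by (intro exp_bound) auto
  also have "x\<^sup>2 \<le> x" using assms by (simp add: power2_eq_square mult_left_le)
  finally have "exp x \<le> 2" using assms by simp
  then have "x * exp x \<le> x * 2" using assms by (intro mult_left_mono)
  also have "\<dots> \<le> (exp x - 1) * 2"
  proof (rule mult_right_mono)
    show "x \<le> exp x - 1"
      unfolding le_diff_eq by (subst add.commute) (rule exp_ge_add_one_self)
  qed simp
  finally show ?thesis by (simp add: mult.commute)
qed

text \<open>In place of \<open>\<integral> k exp (4 \<integral> k) = (exp (4 \<integral> k) - 1) / 4\<close>, which would need the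
  chain rule for absolutely continuous functions, we use an estimate that only has to be checked
  on short intervals.\<close>

lemma exp_integral_weight:
  fixes k :: "real \<Rightarrow> real"
  assumes k: "k integrable_on {a..b}" and k0: "\<forall>t\<in>{a..b}. 0 \<le> k t"
    and W_def: "\<And>t. W t = exp (4 * integral {a..t} k)"
  shows "continuous_on {a..b} W"
    and "t \<in> {a..b} \<Longrightarrow> 1 \<le> W t" and "t \<in> {a..b} \<Longrightarrow> W t \<le> exp (4 * integral {a..b} k)"
    and "(\<lambda>t. k t * W t) integrable_on {a..b}"
    and "t \<in> {a..b} \<Longrightarrow> integral {a..t} (\<lambda>t. k t * W t) \<le> W t / 2"
proof -
  define M where "M = (\<lambda>t. integral {a..t} k)"
  have kI: "k integrable_on {s..t}" if "a \<le> s" "t \<le> b" for s t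
    using that by (intro integrable_subinterval_real[OF k]) auto
  have M_diff: "M t - M s = integral {s..t} k" if "a \<le> s" "s \<le> t" "t \<le> b" for s t
    unfolding M_def using Henstock_Kurzweil_Integration.integral_combine[of a s t k] kI that by force
  have M_mono: "M s \<le> M t" if "a \<le> s" "s \<le> t" "t \<le> b" for s t
    using M_diff[OF that] Henstock_Kurzweil_Integration.integral_nonneg[OF kI] k0 that by force
  have W: "W t = exp (4 * M t)" for t by (simp add: W_def M_def)
  have "M a = 0" by (simp add: M_def)
  have M_cont: "continuous_on {a..b} M" unfolding M_def using k by (rule indefinite_integral_continuous_1)
  then have "continuous_on {a..b} (\<lambda>t. exp (4 * M t))" by (intro continuous_intros)
  then show W_cont: "continuous_on {a..b} W" by (simp add: W)
  show W1: "1 \<le> W t" if "t \<in> {a..b}" for t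
    using M_mono[of a t] \<open>M a = 0\<close> that by (auto simp: W)
  show "W t \<le> exp (4 * integral {a..b} k)" if "t \<in> {a..b}" for t
    using M_mono[of t b] that by (auto simp: W M_def)
  have "(\<lambda>t. W t * k t) absolutely_integrable_on {a..b}"
    using W_cont k k0 by (intro absolutely_integrable_bounded_measurable_product_real
        continuous_imp_measurable_on_sets_lebesgue compact_imp_bounded compact_continuous_image
        nonnegative_absolutely_integrable_1) auto
  then show kW: "(\<lambda>t. k t * W t) integrable_on {a..b}"
    by (simp add: absolutely_integrable_on_def mult.commute)
  have kWI: "(\<lambda>t. k t * W t) integrable_on {s..t}" if "a \<le> s" "t \<le> b" for s t
    using that by (intro integrable_subinterval_real[OF kW]) auto
  \<comment> \<open>With x = 4 * (M t - M s), the integral is at most W s * (x * exp x) / 4, and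
    \<open>exp_step\<close> bounds x * exp x by twice exp x - 1. So the 4 in the exponent becomes
    the 1 / 2 of the claim, and 1 / 8 is the mass for which x is at most 1 / 2.\<close>
  have step: "integral {s..t} (\<lambda>t. k t * W t) \<le> (W t - W s) / 2"
    if st: "a \<le> s" "s \<le> t" "t \<le> b" and small: "M t - M s \<le> 1 / 8" for s t
  proof -
    have "integral {s..t} (\<lambda>t. k t * W t) \<le> integral {s..t} (\<lambda>r. k r * W t)"
      using st kI kWI k0 M_mono by (intro integral_le integrable_on_mult_left)
        (auto simp: W intro!: mult_left_mono)
    also have "\<dots> = (M t - M s) * W t" using M_diff[OF st] by simp
    also have "\<dots> = W s * ((4 * (M t - M s)) * exp (4 * (M t - M s))) / 4"
      by (simp add: W algebra_simps flip: exp_add)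
    also have "\<dots> \<le> W s * (2 * (exp (4 * (M t - M s)) - 1)) / 4"
      using small M_mono[OF st] by (intro divide_right_mono mult_left_mono exp_step) (auto simp: W)
    also have "\<dots> = (W t - W s) / 2"
      by (simp add: W field_simps flip: exp_add)
    finally show ?thesis .
  qed
  show "integral {a..t} (\<lambda>t. k t * W t) \<le> W t / 2" if t: "t \<in> {a..b}" for t
  proof -
    \<comment> \<open>The claim is additive over adjacent intervals, so by \<open>Bolzano\<close> it
      need only be proved on short intervals around each point; the implications confine it to
      subintervals of \<open>{a..b}\<close>.\<close>
    have "a \<le> a \<longrightarrow> t \<le> b \<longrightarrow> a \<le> t \<longrightarrow> integral {a..t} (\<lambda>t. k t * W t) \<le> (W t - W a) / 2"
    proof (rule Bolzano[where P = "\<lambda>s t. a \<le> s \<longrightarrow> t \<le> b \<longrightarrow> s \<le> t \<longrightarrow>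
          integral {s..t} (\<lambda>t. k t * W t) \<le> (W t - W s) / 2"])
      show "a \<le> t" using t by simp
    next
      fix r s q :: real
      assume *: "a \<le> r \<longrightarrow> s \<le> b \<longrightarrow> r \<le> s \<longrightarrow> integral {r..s} (\<lambda>t. k t * W t) \<le> (W s - W r) / 2"
        "a \<le> s \<longrightarrow> q \<le> b \<longrightarrow> s \<le> q \<longrightarrow> integral {s..q} (\<lambda>t. k t * W t) \<le> (W q - W s) / 2"
        "r \<le> s" "s \<le> q"
      show "a \<le> r \<longrightarrow> q \<le> b \<longrightarrow> r \<le> q \<longrightarrow> integral {r..q} (\<lambda>t. k t * W t) \<le> (W q - W r) / 2"
      proof (intro impI)
        assume "a \<le> r" "q \<le> b" "r \<le> q"
        then show "integral {r..q} (\<lambda>t. k t * W t) \<le> (W q - W r) / 2"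
          using * Henstock_Kurzweil_Integration.integral_combine[of r s q "\<lambda>t. k t * W t"] kWI[of r q] by auto
      qed
    next
      fix x assume x: "a \<le> x" "x \<le> t"
      then have "x \<in> {a..b}" using t by simp
      then obtain d where "0 < d" and d: "\<And>y. y \<in> {a..b} \<Longrightarrow> dist y x < d \<Longrightarrow> dist (M y) (M x) < 1 / 16"
        using M_cont unfolding continuous_on_iff by (metis zero_less_divide_1_iff zero_less_numeral)
      have "integral {r..q} (\<lambda>t. k t * W t) \<le> (W q - W r) / 2"
        if "r \<le> x" "x \<le> q" "q - r < d" "a \<le> r" "q \<le> b" for r q
      proof (rule step)
        have "dist (M r) (M x) < 1 / 16" "dist (M q) (M x) < 1 / 16"
          using that by (intro d; simp add: dist_real_def)+
        then show "M q - M r \<le> 1 / 8" unfolding dist_real_def by linarith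
      qed (use that in auto)
      then show "\<exists>d>0. \<forall>r q. r \<le> x \<and> x \<le> q \<and> q - r < d \<longrightarrow> a \<le> r \<longrightarrow> q \<le> b \<longrightarrow> r \<le> q \<longrightarrow>
          integral {r..q} (\<lambda>t. k t * W t) \<le> (W q - W r) / 2"
        using \<open>0 < d\<close> by blast
    qed
    then have "integral {a..t} (\<lambda>t. k t * W t) \<le> (W t - W a) / 2" using t by simp
    moreover have "1 \<le> W a" using W1[of a] t by simp
    ultimately show ?thesis by simp
  qed
qed

text \<open>Let Q be the maximum of f / W, attained at r. If Q is nonnegative, the hypothesis and
  \<open>exp_integral_weight\<close> bound f r by A + Q * W r / 2, which is A + f r / 2, and half of
  f r can be absorbed. This is the origin of the factors 2 and 4.\<close>

lemma Gronwall:
  fixes k f :: "real \<Rightarrow> real"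
  assumes k: "k integrable_on {a..b}" and k0: "\<And>t. t \<in> {a..b} \<Longrightarrow> 0 \<le> k t"
    and f: "continuous_on {a..b} f" and "0 \<le> A"
    and le: "\<And>t. t \<in> {a..b} \<Longrightarrow> f t \<le> A + integral {a..t} (\<lambda>s. k s * f s)"
    and t: "t \<in> {a..b}"
  shows "f t \<le> 2 * A * exp (4 * integral {a..b} k)"
proof -
  define W where "W t = exp (4 * integral {a..t} k)" for t
  have "\<forall>t\<in>{a..b}. 0 \<le> k t" using k0 by blast
  note W = exp_integral_weight[OF k this W_def]
  have "continuous_on {a..b} (\<lambda>t. f t / W t)" using f W(1) by (intro continuous_intros) (auto simp: W_def)
  then obtain r where r: "r \<in> {a..b}" and "\<forall>t\<in>{a..b}. f t / W t \<le> f r / W r"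
    using t continuous_attains_sup[of "{a..b}" "\<lambda>t. f t / W t"] by auto
  then have fW: "f t \<le> f r / W r * W t" if "t \<in> {a..b}" for t
    using that by (simp add: W_def pos_divide_le_eq)
  define Q where "Q = f r / W r"
  have "Q \<le> 2 * A"
  proof (cases "0 \<le> Q")
    case True
    have cont: "continuous_on {a..r} f" using f r by (auto intro: continuous_on_subset)
    have kr: "k integrable_on {a..r}" using r by (intro integrable_subinterval_real[OF k]) auto
    have kW: "(\<lambda>s. k s * W s) integrable_on {a..r}"
      using r by (intro integrable_subinterval_real[OF W(4)]) auto
    have "(\<lambda>s. f s * k s) absolutely_integrable_on {a..r}"
      using cont kr k0 r by (intro absolutely_integrable_bounded_measurable_product_real
          continuous_imp_measurable_on_sets_lebesgue compact_imp_bounded compact_continuous_image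
          nonnegative_absolutely_integrable_1) auto
    then have kf: "(\<lambda>s. k s * f s) integrable_on {a..r}"
      by (simp add: absolutely_integrable_on_def mult.commute)
    have "integral {a..r} (\<lambda>s. k s * f s) \<le> integral {a..r} (\<lambda>s. Q * (k s * W s))"
    proof (rule integral_le[OF kf])
      show "(\<lambda>s. Q * (k s * W s)) integrable_on {a..r}" using kW by (rule integrable_on_mult_right)
      show "k s * f s \<le> Q * (k s * W s)" if "s \<in> {a..r}" for s
        using mult_left_mono[OF fW[of s] k0[of s]] that r by (simp add: Q_def mult_ac)
    qed
    also have "\<dots> = Q * integral {a..r} (\<lambda>s. k s * W s)" by simp
    also have "\<dots> \<le> Q * (W r / 2)" using W(5)[OF r] True by (intro mult_left_mono)
    finally have "f r \<le> A + Q * (W r / 2)" using le[OF r] by simp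
    moreover have "f r = Q * W r" by (simp add: Q_def W_def)
    ultimately have "Q * W r \<le> 2 * A" by simp
    moreover have "Q * 1 \<le> Q * W r" using W(2)[OF r] True by (intro mult_left_mono)
    ultimately show ?thesis by simp
  qed (use \<open>0 \<le> A\<close> in simp)
  have "f t \<le> Q * W t" using fW[OF t] by (simp add: Q_def)
  also have "\<dots> \<le> 2 * A * W t" using \<open>Q \<le> 2 * A\<close> by (intro mult_right_mono) (auto simp: W_def)
  also have "\<dots> \<le> 2 * A * exp (4 * integral {a..b} k)"
    using W(3)[OF t] \<open>0 \<le> A\<close> by (intro mult_left_mono) auto
  finally show ?thesis .
qed

text \<open>Time reversal turns this into \<open>Gronwall\<close>. It serves to bound the distance
  of initial points by the distance of the trajectories at a later time.\<close>

lemma Gronwall_backward: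
  fixes k f :: "real \<Rightarrow> real"
  assumes k: "k integrable_on {a..b}" and k0: "\<And>t. t \<in> {a..b} \<Longrightarrow> 0 \<le> k t"
    and f: "continuous_on {a..b} f" and "0 \<le> A"
    and le: "\<And>t. t \<in> {a..b} \<Longrightarrow> f t \<le> A + integral {t..b} (\<lambda>s. k s * f s)"
    and t: "t \<in> {a..b}"
  shows "f t \<le> 2 * A * exp (4 * integral {a..b} k)"
proof -
  have "f (- (- t)) \<le> 2 * A * exp (4 * integral {-b..-a} (\<lambda>s. k (- s)))"
  proof (rule Gronwall[where f = "\<lambda>s. f (- s)"])
    show "(\<lambda>s. k (- s)) integrable_on {-b..-a}"
      using k by (simp only: Henstock_Kurzweil_Integration.integrable_reflect_real)
    show "continuous_on {-b..-a} (\<lambda>s. f (- s))"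
      by (rule continuous_on_compose2[OF f]) (auto intro: continuous_intros)
    fix s assume s: "s \<in> {-b..-a}"
    show "f (- s) \<le> A + integral {-b..s} (\<lambda>s. k (- s) * f (- s))"
      using le[of "- s"] s Henstock_Kurzweil_Integration.integral_reflect_real[of b "- s" "\<lambda>s. k s * f s"]
      by auto
  qed (use k0 t \<open>0 \<le> A\<close> in auto)
  then show ?thesis by (simp only: Henstock_Kurzweil_Integration.integral_reflect_real minus_minus)
qed

section \<open>Flows of Lipschitz fields\<close>

text \<open>One function k bounds both the supremum and the Lipschitz constant. Measurability is
  required along continuous curves, a Caratheodory condition that makes the integrands of Picard
  iteration and of trajectories integrable.\<close>

locale Lipschitz_field =
  fixes u :: "real \<Rightarrow> 'a::euclidean_space \<Rightarrow> 'a" and k :: "real \<Rightarrow> real"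
  assumes k_int: "k integrable_on {0..1}"
    and norm_u: "t \<in> {0..1} \<Longrightarrow> norm (u t x) \<le> k t"
    and u_lip: "t \<in> {0..1} \<Longrightarrow> norm (u t x - u t y) \<le> k t * norm (x - y)"
    and u_meas: "0 \<le> a \<Longrightarrow> b \<le> 1 \<Longrightarrow> continuous_on {a..b} z \<Longrightarrow>
      (\<lambda>s. u s (z s)) \<in> borel_measurable (lebesgue_on {a..b})"
begin

lemma k_nonneg: "t \<in> {0..1} \<Longrightarrow> 0 \<le> k t"
  using order_trans[OF norm_ge_zero norm_u] .

lemma k_int_sub: "0 \<le> a \<Longrightarrow> b \<le> 1 \<Longrightarrow> k integrable_on {a..b}"
  by (rule integrable_subinterval_real[OF k_int]) auto

lemma k_integral_nonneg: "0 \<le> a \<Longrightarrow> b \<le> 1 \<Longrightarrow> 0 \<le> integral {a..b} k"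
  using k_int_sub k_nonneg by (intro Henstock_Kurzweil_Integration.integral_nonneg) auto

lemma k_integral_mono:
  assumes "0 \<le> a" "a \<le> a'" "b' \<le> b" "b \<le> 1"
  shows "integral {a'..b'} k \<le> integral {a..b} k"
  using assms k_int_sub k_nonneg by (intro integral_subset_le) auto

lemma u_int:
  assumes "0 \<le> a" "b \<le> 1" "continuous_on {a..b} y"
  shows "(\<lambda>s. u s (y s)) absolutely_integrable_on {a..b}"
  by (rule measurable_bounded_by_integrable_imp_absolutely_integrable[OF u_meas[OF assms] _ k_int_sub[OF assms(1,2)]])
    (use assms norm_u in auto)

lemma u_int': "0 \<le> a \<Longrightarrow> b \<le> 1 \<Longrightarrow> continuous_on {a..b} y \<Longrightarrow> (\<lambda>s. u s (y s)) integrable_on {a..b}"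
  using u_int by (simp add: absolutely_integrable_on_def)

lemma norm_u_integral_le:
  assumes "0 \<le> a" "b \<le> 1" "continuous_on {a..b} y"
  shows "norm (integral {a..b} (\<lambda>s. u s (y s))) \<le> integral {a..b} k"
  by (rule norm_integral_le[OF u_meas[OF assms] _ k_int_sub[OF assms(1,2)]])
    (use assms norm_u in auto)

lemma k_mult_int:
  fixes g :: "real \<Rightarrow> real"
  assumes "0 \<le> a" "b \<le> 1" "continuous_on {a..b} g"
  shows "(\<lambda>s. k s * g s) integrable_on {a..b}"
proof -
  have "(\<lambda>s. g s * k s) absolutely_integrable_on {a..b}"
    using assms k_int_sub[OF assms(1,2)] k_nonneg
    by (intro absolutely_integrable_bounded_measurable_product_real
        continuous_imp_measurable_on_sets_lebesgue compact_imp_bounded compact_continuous_image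
        nonnegative_absolutely_integrable_1) auto
  then show ?thesis by (simp add: absolutely_integrable_on_def mult.commute)
qed

lemma norm_u_integral_diff_le:
  assumes "0 \<le> a" "b \<le> 1" "continuous_on {a..b} y" "continuous_on {a..b} z"
    and "continuous_on {a..b} g" and g: "\<And>s. s \<in> {a..b} \<Longrightarrow> norm (y s - z s) \<le> g s"
  shows "norm (integral {a..b} (\<lambda>s. u s (y s)) - integral {a..b} (\<lambda>s. u s (z s))) \<le> integral {a..b} (\<lambda>s. k s * g s)"
proof -
  have "norm (integral {a..b} (\<lambda>s. u s (y s) - u s (z s))) \<le> integral {a..b} (\<lambda>s. k s * g s)"
  proof (rule norm_integral_le)
    show "(\<lambda>s. u s (y s) - u s (z s)) \<in> borel_measurable (lebesgue_on {a..b})"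
      using assms by (intro borel_measurable_diff u_meas)
    show "(\<lambda>s. k s * g s) integrable_on {a..b}" using assms by (intro k_mult_int)
    show "norm (u s (y s) - u s (z s)) \<le> k s * g s" if "s \<in> {a..b}" for s
    proof -
      have s: "s \<in> {0..1}" using that assms by auto
      have "norm (u s (y s) - u s (z s)) \<le> k s * norm (y s - z s)" by (rule u_lip[OF s])
      also have "\<dots> \<le> k s * g s" using g[OF that] k_nonneg[OF s] by (rule mult_left_mono)
      finally show ?thesis .
    qed
  qed simp
  then show ?thesis
    using assms by (simp add: Henstock_Kurzweil_Integration.integral_diff[OF u_int' u_int'])
qed

lemma continuous_u_integral:
  assumes "0 \<le> a" "b \<le> 1" "continuous_on {a..b} y"
  shows "continuous_on {a..b} (\<lambda>t. x + integral {a..t} (\<lambda>s. u s (y s)))"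
  by (intro continuous_intros indefinite_integral_continuous_1 u_int' assms)

definition solves :: "'a \<Rightarrow> (real \<Rightarrow> 'a) \<Rightarrow> bool" where
  "solves x y \<longleftrightarrow> continuous_on {0..1} y \<and> (\<forall>t\<in>{0..1}. y t = x + integral {0..t} (\<lambda>s. u s (y s)))"

text \<open>Picard iteration on all of \<open>{0..1}\<close> at once: in the supremum norm weighted
  by 1 / W it contracts by the factor 1 / 2, because the integral of k * W up to t is at most W t /
  2.\<close>

lemma solution_exists: "\<exists>y. solves x y"
proof -
  define Y where "Y = rec_nat (\<lambda>_. x) (\<lambda>_ y t. x + integral {0..t} (\<lambda>s. u s (y s)))"
  have Y0: "Y 0 t = x" and YS: "Y (Suc j) t = x + integral {0..t} (\<lambda>s. u s (Y j s))" for j t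
    by (simp_all add: Y_def)
  have cont: "continuous_on {0..1} (Y j)" for j
  proof (induction j)
    case 0
    then show ?case by (simp add: Y_def)
  next
    case (Suc j)
    have "continuous_on {0..1} (\<lambda>t. x + integral {0..t} (\<lambda>s. u s (Y j s)))"
      using Suc by (intro continuous_u_integral) auto
    then show ?case by (simp add: YS[abs_def])
  qed
  have cont': "continuous_on {0..t} (Y j)" if "t \<in> {0..1}" for j t
    using that by (intro continuous_on_subset[OF cont]) auto
  define W where "W t = exp (4 * integral {0..t} k)" for t
  have "\<forall>t\<in>{0..1}. 0 \<le> k t" using k_nonneg by blast
  note W = exp_integral_weight[OF k_int this W_def]
  define C where "C = integral {0..1} k"
  have C: "0 \<le> C" using k_integral_nonneg by (simp add: C_def)
  have diff: "norm (Y (Suc j) t - Y j t) \<le> C / 2 ^ j * W t" if "t \<in> {0..1}" for j t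
    using that
  proof (induction j arbitrary: t)
    case 0
    have "norm (integral {0..t} (\<lambda>s. u s (Y 0 s))) \<le> integral {0..t} k"
      using 0 cont' by (intro norm_u_integral_le) auto
    also have "\<dots> \<le> C" unfolding C_def using 0 by (intro k_integral_mono) auto
    also have "\<dots> \<le> C * W t" using W(2)[OF 0] C mult_left_mono[of 1 "W t" C] by simp
    finally show ?case by (simp add: YS[of 0] Y0[of t])
  next
    case (Suc j)
    have "continuous_on {0..t} W" using Suc.prems by (intro continuous_on_subset[OF W(1)]) auto
    then have "norm (integral {0..t} (\<lambda>s. u s (Y (Suc j) s)) - integral {0..t} (\<lambda>s. u s (Y j s)))
        \<le> integral {0..t} (\<lambda>s. k s * (C / 2 ^ j * W s))"
      using Suc cont' by (intro norm_u_integral_diff_le continuous_intros) auto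
    also have "\<dots> = C / 2 ^ j * integral {0..t} (\<lambda>s. k s * W s)"
      unfolding integral_mult_right[symmetric]
      by (rule Henstock_Kurzweil_Integration.integral_cong) simp
    also have "\<dots> \<le> C / 2 ^ j * (W t / 2)" using W(5)[OF Suc.prems] C by (intro mult_left_mono) auto
    finally show ?case by (simp add: YS[of "Suc j"] YS[of j] mult.commute)
  qed
  define E where "E = C * exp (4 * integral {0..1} k)"
  have E: "0 \<le> E" using C by (simp add: E_def)
  have diffE: "norm (Y (Suc j) t - Y j t) \<le> E * (1 / 2) ^ j" if "t \<in> {0..1}" for j t
  proof -
    have "C / 2 ^ j * W t \<le> C / 2 ^ j * exp (4 * integral {0..1} k)"
      using W(3)[OF that] C by (intro mult_left_mono) auto
    then show ?thesis using diff[OF that, of j] by (simp add: E_def power_divide)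
  qed
  \<comment> \<open>The limit is written as a telescoping series of increments, dominated by a
    geometric series with ratio 1 / 2.\<close>
  define y where "y t = x + (\<Sum>j. Y (Suc j) t - Y j t)" for t
  have "uniform_limit {0..1} (\<lambda>m t. \<Sum>j<m. Y (Suc j) t - Y j t) (\<lambda>t. \<Sum>j. Y (Suc j) t - Y j t) sequentially"
    using diffE by (intro Weierstrass_m_test[where M = "\<lambda>j. E * (1 / 2) ^ j"])
      (auto intro!: summable_mult summable_geometric)
  then have "uniform_limit {0..1} (\<lambda>m t. x + (\<Sum>j<m. Y (Suc j) t - Y j t)) y sequentially"
    unfolding y_def[abs_def] by (intro uniform_limit_intros)
  moreover have "(\<lambda>m t. x + (\<Sum>j<m. Y (Suc j) t - Y j t)) = Y"
  proof (intro ext)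
    show "x + (\<Sum>j<m. Y (Suc j) t - Y j t) = Y m t" for m t
      using sum_lessThan_telescope[of "\<lambda>j. Y j t" m] by (simp add: Y0)
  qed
  ultimately have lim: "uniform_limit {0..1} Y y sequentially" by simp
  have y_cont: "continuous_on {0..1} y"
    using lim by (rule uniform_limit_theorem[rotated]) (auto simp: cont)
  have "y t = x + integral {0..t} (\<lambda>s. u s (y s))" if t: "t \<in> {0..1}" for t
  proof -
    have ycont': "continuous_on {0..t} y" using t by (intro continuous_on_subset[OF y_cont]) auto
    have "(\<lambda>j. Y (Suc j) t) \<longlonglongrightarrow> x + integral {0..t} (\<lambda>s. u s (y s))"
    proof (rule LIMSEQ_I)
      fix e :: real assume e: "0 < e"
      define d where "d = e / (C + 1)"
      have "0 < d" using e C by (simp add: d_def)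
      then obtain N where N: "\<And>j s. j \<ge> N \<Longrightarrow> s \<in> {0..1} \<Longrightarrow> dist (Y j s) (y s) < d"
        using uniform_limitD[OF lim] unfolding eventually_sequentially by blast
      have "norm (Y (Suc j) t - (x + integral {0..t} (\<lambda>s. u s (y s)))) < e" if "j \<ge> N" for j
      proof -
        have "norm (integral {0..t} (\<lambda>s. u s (Y j s)) - integral {0..t} (\<lambda>s. u s (y s))) \<le> integral {0..t} (\<lambda>s. k s * d)"
        proof (rule norm_u_integral_diff_le)
          show "norm (Y j s - y s) \<le> d" if "s \<in> {0..t}" for s
            using N[OF \<open>j \<ge> N\<close>, of s] that t by (simp add: dist_norm)
        qed (use t cont' ycont' in auto)
        also have "\<dots> = integral {0..t} k * d" by simp
        also have "\<dots> \<le> C * d"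
          unfolding C_def using t \<open>0 < d\<close> by (intro mult_right_mono k_integral_mono) auto
        also have "\<dots> < e" using e C by (simp add: d_def field_simps)
        finally show ?thesis by (simp add: YS)
      qed
      then show "\<exists>N. \<forall>j\<ge>N. norm (Y (Suc j) t - (x + integral {0..t} (\<lambda>s. u s (y s)))) < e" by blast
    qed
    moreover have "(\<lambda>j. Y (Suc j) t) \<longlonglongrightarrow> y t"
      using tendsto_uniform_limitI[OF lim t] by (rule LIMSEQ_Suc)
    ultimately show ?thesis by (rule LIMSEQ_unique[symmetric])
  qed
  then show ?thesis using y_cont unfolding solves_def by blast
qed

text \<open>\<open>is_flow\<close> does not ask for continuity in time; it follows since the
  trajectory is an indefinite integral. In the converse direction continuity provides the
  integrability.\<close>

lemma is_flow_iff: "is_flow u \<Phi> \<longleftrightarrow> (\<forall>x. solves x (\<lambda>t. \<Phi> t x))"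
proof
  assume L: "is_flow u \<Phi>"
  show "\<forall>x. solves x (\<lambda>t. \<Phi> t x)"
  proof
    fix x
    have hb: "has_bochner_integral (lebesgue_on {0..t}) (\<lambda>s. u s (\<Phi> s x)) (\<Phi> t x - x)" if "t \<in> {0..1}" for t
      using L that by (simp add: is_flow_def)
    have eq: "\<Phi> t x = x + integral {0..t} (\<lambda>s. u s (\<Phi> s x))" if "t \<in> {0..1}" for t
      using hb[OF that] lebesgue_integral_eq_integral[of "{0..t}" "\<lambda>s. u s (\<Phi> s x)"]
      by (simp add: has_bochner_integral_iff diff_eq_eq add.commute)
    have "(\<lambda>s. u s (\<Phi> s x)) integrable_on {0..1}"
      using hb[of 1] by (intro integrable_on_lebesgue_on) (auto simp: has_bochner_integral_iff)
    then have "continuous_on {0..1} (\<lambda>t. x + integral {0..t} (\<lambda>s. u s (\<Phi> s x)))"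
      by (intro continuous_intros indefinite_integral_continuous_1)
    then have "continuous_on {0..1} (\<lambda>t. \<Phi> t x)"
      using eq by (subst continuous_on_cong[OF refl]) auto
    then show "solves x (\<lambda>t. \<Phi> t x)" using eq unfolding solves_def by blast
  qed
next
  assume R: "\<forall>x. solves x (\<lambda>t. \<Phi> t x)"
  show "is_flow u \<Phi>"
    unfolding is_flow_def
  proof (intro ballI allI)
    fix t :: real and x assume t: "t \<in> {0..1}"
    have cont: "continuous_on {0..t} (\<lambda>s. \<Phi> s x)"
      using R t by (auto simp: solves_def intro: continuous_on_subset)
    have "\<Phi> t x = x + integral {0..t} (\<lambda>s. u s (\<Phi> s x))"
      using R t unfolding solves_def by blast
    moreover have "integrable (lebesgue_on {0..t}) (\<lambda>s. u s (\<Phi> s x))"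
      using t cont by (intro absolutely_integrable_imp_integrable u_int) auto
    ultimately show "has_bochner_integral (lebesgue_on {0..t}) (\<lambda>s. u s (\<Phi> s x)) (\<Phi> t x - x)"
      by (simp add: has_bochner_integral_iff lebesgue_integral_eq_integral)
  qed
qed

text \<open>A pointwise flow involves no regularity in x, so solutions may be chosen for each x
  separately, and the choice operator in \<open>flow\<close> selects an actual flow.\<close>

lemma solves_flow: "solves x (\<lambda>t. flow u t x)"
proof -
  obtain y where "\<And>x. solves x (y x)" using solution_exists by metis
  then have "is_flow u (\<lambda>t x. y x t)" by (simp add: is_flow_iff)
  then have "is_flow u (flow u)" unfolding flow_def by (rule someI[where P = "is_flow u"])
  then show ?thesis by (simp add: is_flow_iff)
qed

lemma solves_continuous: "solves x y \<Longrightarrow> 0 \<le> a \<Longrightarrow> b \<le> 1 \<Longrightarrow> continuous_on {a..b} y"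
  unfolding solves_def by (auto intro: continuous_on_subset)

lemma solves_diff:
  assumes "solves x y" "0 \<le> s" "s \<le> t" "t \<le> 1"
  shows "y t - y s = integral {s..t} (\<lambda>r. u r (y r))"
proof -
  have "integral {0..s} (\<lambda>r. u r (y r)) + integral {s..t} (\<lambda>r. u r (y r)) = integral {0..t} (\<lambda>r. u r (y r))"
    using assms solves_continuous[OF assms(1)]
    by (intro Henstock_Kurzweil_Integration.integral_combine u_int') auto
  moreover have "y t = x + integral {0..t} (\<lambda>r. u r (y r))" "y s = x + integral {0..s} (\<lambda>r. u r (y r))"
    using assms unfolding solves_def by auto
  ultimately show ?thesis by (simp add: algebra_simps)
qed

lemma norm_solves_diff_le:
  assumes "solves x y" "0 \<le> s" "s \<le> t" "t \<le> 1"
  shows "norm (y t - y s) \<le> integral {s..t} k"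
  unfolding solves_diff[OF assms]
  using assms solves_continuous[OF assms(1)] by (intro norm_u_integral_le) auto

lemma solves_0: "solves x y \<Longrightarrow> y 0 = x"
  unfolding solves_def by force

text \<open>A lower Lipschitz bound for the flow map, from the backward Gronwall inequality applied
  to two trajectories. It will show that the derivative of the flow is injective.\<close>

lemma solves_expanding:
  assumes y: "solves x y" and z: "solves x' z" and t: "t \<in> {0..1}"
  shows "norm (x - x') \<le> 2 * norm (y t - z t) * exp (4 * integral {0..1} k)"
proof -
  have "norm (y 0 - z 0) \<le> 2 * norm (y t - z t) * exp (4 * integral {0..t} k)"
  proof (rule Gronwall_backward[where f = "\<lambda>s. norm (y s - z s)"])
    show "continuous_on {0..t} (\<lambda>s. norm (y s - z s))"
      using t solves_continuous[OF y] solves_continuous[OF z] by (intro continuous_intros) auto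
    fix s assume s: "s \<in> {0..t}"
    have "norm (integral {s..t} (\<lambda>r. u r (y r)) - integral {s..t} (\<lambda>r. u r (z r)))
        \<le> integral {s..t} (\<lambda>r. k r * norm (y r - z r))"
      using s t solves_continuous[OF y] solves_continuous[OF z]
      by (intro norm_u_integral_diff_le continuous_intros) auto
    then have "norm ((y t - y s) - (z t - z s)) \<le> integral {s..t} (\<lambda>r. k r * norm (y r - z r))"
      using s t by (simp add: solves_diff[OF y] solves_diff[OF z])
    then show "norm (y s - z s) \<le> norm (y t - z t) + integral {s..t} (\<lambda>r. k r * norm (y r - z r))"
      using norm_triangle_ineq4[of "y t - z t" "(y t - y s) - (z t - z s)"] by (simp add: algebra_simps)
  qed (use t k_int_sub k_nonneg in auto)
  moreover have "2 * norm (y t - z t) * exp (4 * integral {0..t} k) \<le> 2 * norm (y t - z t) * exp (4 * integral {0..1} k)"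
    using t k_integral_mono by (intro mult_left_mono) auto
  ultimately show ?thesis using solves_0[OF y] solves_0[OF z] by simp
qed

end

text \<open>The integrands are compared by splitting \<open>u s (y s) - v s (z s)\<close> into
  \<open>u s (z s) - v s (z s)\<close> and \<open>u s (y s) - u s (z s)\<close>: d bounds the first
  part, and the Lipschitz bound k of u prepares the Gronwall inequality for the second.\<close>

lemma flow_stability:
  assumes u: "Lipschitz_field u k" and v: "Lipschitz_field v l"
    and d: "d integrable_on {0..1}" and uv: "\<And>s x. s \<in> {0..1} \<Longrightarrow> norm (u s x - v s x) \<le> d s"
    and y: "Lipschitz_field.solves u x y" and z: "Lipschitz_field.solves v x z" and t: "t \<in> {0..1}"
  shows "norm (y t - z t) \<le> 2 * integral {0..1} d * exp (4 * integral {0..1} k)"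
proof -
  interpret u: Lipschitz_field u k by fact
  interpret v: Lipschitz_field v l by fact
  have d0: "0 \<le> d s" if "s \<in> {0..1}" for s using order_trans[OF norm_ge_zero uv[OF that]] .
  note cont = u.solves_continuous[OF y] v.solves_continuous[OF z]
  show ?thesis
  proof (rule Gronwall[where f = "\<lambda>s. norm (y s - z s)"])
    show "continuous_on {0..1} (\<lambda>s. norm (y s - z s))"
      using cont by (intro continuous_intros) auto
    show "0 \<le> integral {0..1} d"
      using d d0 by (rule Henstock_Kurzweil_Integration.integral_nonneg)
    fix t :: real assume t: "t \<in> {0..1}"
    have contt: "continuous_on {0..t} y" "continuous_on {0..t} z" using cont t by auto
    have dt: "d integrable_on {0..t}" using t by (intro integrable_subinterval_real[OF d]) auto
    have kt: "(\<lambda>s. k s * norm (y s - z s)) integrable_on {0..t}"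
      using t contt by (intro u.k_mult_int continuous_intros) auto
    have "norm (integral {0..t} (\<lambda>s. u s (y s) - v s (z s))) \<le> integral {0..t} (\<lambda>s. d s + k s * norm (y s - z s))"
    proof (rule norm_integral_le)
      show "(\<lambda>s. u s (y s) - v s (z s)) \<in> borel_measurable (lebesgue_on {0..t})"
        using t contt by (intro borel_measurable_diff u.u_meas v.u_meas) auto
      show "(\<lambda>s. d s + k s * norm (y s - z s)) integrable_on {0..t}"
        using dt kt by (rule Henstock_Kurzweil_Integration.integrable_add)
      fix s assume "s \<in> {0..t}"
      then have s: "s \<in> {0..1}" using t by auto
      have "norm ((u s (z s) - v s (z s)) + (u s (y s) - u s (z s))) \<le> d s + k s * norm (y s - z s)"
        using uv[OF s] u.u_lip[OF s] by (intro norm_triangle_mono)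
      then show "norm (u s (y s) - v s (z s)) \<le> d s + k s * norm (y s - z s)" by simp
    qed simp
    also have "\<dots> = integral {0..t} d + integral {0..t} (\<lambda>s. k s * norm (y s - z s))"
      using dt kt by (rule Henstock_Kurzweil_Integration.integral_add)
    also have "integral {0..t} d \<le> integral {0..1} d"
      using t d dt d0 by (intro integral_subset_le) auto
    also have "integral {0..t} (\<lambda>s. u s (y s) - v s (z s)) = y t - z t"
    proof -
      have "integral {0..t} (\<lambda>s. u s (y s) - v s (z s)) =
          integral {0..t} (\<lambda>s. u s (y s)) - integral {0..t} (\<lambda>s. v s (z s))"
        using t contt by (intro Henstock_Kurzweil_Integration.integral_diff u.u_int' v.u_int') auto
      also have "\<dots> = (y t - y 0) - (z t - z 0)"
        using t by (simp add: u.solves_diff[OF y] v.solves_diff[OF z])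
      finally show ?thesis by (simp add: u.solves_0[OF y] v.solves_0[OF z])
    qed
    finally show "norm (y t - z t) \<le> integral {0..1} d + integral {0..t} (\<lambda>s. k s * norm (y s - z s))" by simp
  qed (use t u.k_int u.k_nonneg in auto)
qed

section \<open>Hoelder bounds for the flow\<close>

locale hoelder_field =
  fixes n :: nat and \<alpha> :: real
    and u :: "real \<Rightarrow> 'a::euclidean_space \<Rightarrow> 'a" and k :: "real \<Rightarrow> real"
  assumes n: "1 \<le> n" and \<alpha>: "0 < \<alpha>" "\<alpha> \<le> 1"
    and k_integrable: "k integrable_on {0..1}"
    and u_hoelder: "t \<in> {0..1} \<Longrightarrow> hoelder_le n \<alpha> (k t) (u t)"
    and u_measurable: "0 \<le> a \<Longrightarrow> b \<le> 1 \<Longrightarrow> continuous_on {a..b} z \<Longrightarrow>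
      (\<lambda>s. u s (z s)) \<in> borel_measurable (lebesgue_on {a..b})"

lemma hoelder_le_Lipschitz':
  fixes f :: "'a::real_normed_vector \<Rightarrow> 'b::real_normed_vector"
  assumes "hoelder_le n \<alpha> K f" "1 \<le> n"
  shows "norm (f x - f y) \<le> K * norm (x - y)"
  using assms hoelder_le_Lipschitz[of "n - 1" \<alpha> K f] by simp

text \<open>As n is at least 1, the Lipschitz hypothesis of \<open>hoelder_le_compose\<close>
  follows from the bound on \<phi>. The object-level quantifiers let the property of the constant be
  handed to \<open>flow_short_time\<close> as an assumption.\<close>

lemma hoelder_le_compose':
  fixes L :: real
  assumes n: "1 \<le> n" and \<alpha>: "0 < \<alpha>" "\<alpha> \<le> 1" and "0 \<le> L"
  obtains C where "0 < C"
    "\<forall>\<kappa> (f :: 'a::euclidean_space \<Rightarrow> 'b::real_normed_vector) (\<phi> :: 'a \<Rightarrow> 'a). hoelder_le n \<alpha> \<kappa> f \<longrightarrow>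
       hoelder_le n \<alpha> L \<phi> \<longrightarrow> hoelder_le n \<alpha> (C * \<kappa>) (\<lambda>x. f (x + \<phi> x))"
proof -
  obtain C where "0 < C" and C: "\<And>\<kappa> (f :: 'a \<Rightarrow> 'b) (\<phi> :: 'a \<Rightarrow> 'a).
       hoelder_le n \<alpha> \<kappa> f \<Longrightarrow> hoelder_le n \<alpha> L \<phi> \<Longrightarrow>
       (\<And>x y. norm (\<phi> x - \<phi> y) \<le> L * norm (x - y)) \<Longrightarrow> hoelder_le n \<alpha> (C * \<kappa>) (\<lambda>x. f (x + \<phi> x))"
    using hoelder_le_compose[OF \<alpha> \<open>0 \<le> L\<close>, of n, where ?'a = 'a and ?'b = 'b] by auto
  show ?thesis
  proof (rule that[OF \<open>0 < C\<close>], intro allI impI)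
    fix \<kappa> and f :: "'a \<Rightarrow> 'b" and \<phi> :: "'a \<Rightarrow> 'a"
    assume f: "hoelder_le n \<alpha> \<kappa> f" and \<phi>: "hoelder_le n \<alpha> L \<phi>"
    show "hoelder_le n \<alpha> (C * \<kappa>) (\<lambda>x. f (x + \<phi> x))"
      by (rule C[OF f \<phi> hoelder_le_Lipschitz'[OF \<phi> n]])
  qed
qed

sublocale hoelder_field \<subseteq> Lipschitz_field u k
proof
  show "norm (u t x) \<le> k t" if "t \<in> {0..1}" for t x
    using u_hoelder[OF that] by (rule hoelder_le_norm)
  show "norm (u t x - u t y) \<le> k t * norm (x - y)" if "t \<in> {0..1}" for t x y
    using u_hoelder[OF that] n by (rule hoelder_le_Lipschitz')
qed (use k_integrable u_measurable in auto)

context hoelder_field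
begin

text \<open>The Picard iterates \<open>\<psi>\<close> for the flow started at time \<open>s\<close> stay in the unit ball as long
  as the mass of \<open>k\<close> is small, and \<open>\<Phi> t\<close> is the uniform limit of \<open>(id + \<psi> j t) \<circ> \<Phi> s\<close>.\<close>

lemma flow_short_time:
  assumes C: "\<forall>\<kappa> (f :: 'a \<Rightarrow> 'a) (\<phi> :: 'a \<Rightarrow> 'a). hoelder_le n \<alpha> \<kappa> f \<longrightarrow> hoelder_le n \<alpha> 1 \<phi> \<longrightarrow>
      hoelder_le n \<alpha> (C * \<kappa>) (\<lambda>x. f (x + \<phi> x))"
    and L: "\<forall>\<kappa> (f :: 'a \<Rightarrow> 'a) (\<phi> :: 'a \<Rightarrow> 'a). hoelder_le n \<alpha> \<kappa> f \<longrightarrow> hoelder_le n \<alpha> K \<phi> \<longrightarrow>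
      hoelder_le n \<alpha> (L * \<kappa>) (\<lambda>x. f (x + \<phi> x))"
    and "0 < C" "C * \<delta> \<le> 1" "\<delta> \<le> 1 / 2"
    and \<Phi>: "\<And>x. solves x (\<lambda>t. \<Phi> t x)"
    and st: "0 \<le> s" "s \<le> t" "t \<le> 1" and mass: "integral {s..t} k \<le> \<delta>"
    and K: "hoelder_le n \<alpha> K (\<lambda>x. \<Phi> s x - x)"
  shows "hoelder_le n \<alpha> (L + K) (\<lambda>x. \<Phi> t x - x)"
proof -
  define \<psi> where "\<psi> = rec_nat (\<lambda>_ _. 0) (\<lambda>_ \<psi> r z. integral {s..r} (\<lambda>q. u q (z + \<psi> q z)))"
  have \<psi>0: "\<psi> 0 r z = 0" and \<psi>S: "\<psi> (Suc j) r z = integral {s..r} (\<lambda>q. u q (z + \<psi> j q z))" for j r z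
    by (simp_all add: \<psi>_def)
  have cont: "continuous_on {s..t} (\<lambda>r. \<psi> j r z)" for j z
  proof (induction j)
    case (Suc j)
    have "continuous_on {s..t} (\<lambda>r. 0 + integral {s..r} (\<lambda>q. u q (z + \<psi> j q z)))"
      using st Suc by (intro continuous_u_integral continuous_intros) auto
    then show ?case by (simp add: \<psi>S)
  qed (simp add: \<psi>0)
  have cont': "continuous_on {s..r} (\<lambda>q. z + \<psi> j q z)" if "r \<in> {s..t}" for j z r
    using that by (intro continuous_intros continuous_on_subset[OF cont]) auto
  \<comment> \<open>Self-map property: composing with a displacement in the unit ball multiplies the
    bound of \<open>u q\<close> by C, and C times the mass is at most 1.\<close>
  have ball: "hoelder_le n \<alpha> 1 (\<psi> j r)" if "r \<in> {s..t}" for j r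
    using that
  proof (induction j arbitrary: r)
    case 0
    have "\<psi> 0 r = (\<lambda>_. 0)" by (rule ext) (rule \<psi>0)
    then show ?case using hoelder_le_const[of "0 :: 'a" 1 n \<alpha>] by simp
  next
    case (Suc j)
    have kr: "k integrable_on {s..r}" using st Suc.prems by (intro k_int_sub) auto
    have "hoelder_le n \<alpha> (integral {s..r} (\<lambda>q. C * k q)) (\<lambda>z. integral {s..r} (\<lambda>q. u q (z + \<psi> j q z)))"
    proof (rule hoelder_le_integral[OF _ _ _ _ \<alpha>])
      show "(\<lambda>q. C * k q) integrable_on {s..r}" using kr by (rule integrable_on_mult_right)
      fix q assume q: "q \<in> {s..r}"
      then have IH: "hoelder_le n \<alpha> 1 (\<psi> j q)" using Suc by auto
      show "hoelder_le n \<alpha> (C * k q) (\<lambda>z. u q (z + \<psi> j q z))"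
        using q st Suc.prems IH by (intro C[rule_format] u_hoelder) auto
    next
      show "(\<lambda>q. u q (z + \<psi> j q z)) \<in> borel_measurable (lebesgue_on {s..r})" for z
        using st Suc.prems by (intro u_meas cont') auto
    qed simp
    moreover have "integral {s..r} (\<lambda>q. C * k q) \<le> 1"
    proof -
      have "integral {s..r} (\<lambda>q. C * k q) = C * integral {s..r} k" by simp
      also have "integral {s..r} k \<le> integral {s..t} k"
        using st Suc.prems by (intro k_integral_mono) auto
      also have "\<dots> \<le> \<delta>" by fact
      also have "C * \<delta> \<le> 1" by fact
      finally show ?thesis using \<open>0 < C\<close> by simp
    qed
    moreover have "(\<lambda>z. integral {s..r} (\<lambda>q. u q (z + \<psi> j q z))) = \<psi> (Suc j) r"
      by (rule ext) (simp add: \<psi>S)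
    ultimately show ?case by (auto intro: hoelder_le_mono)
  qed
  \<comment> \<open>Contraction: the initial distance is at most the mass, hence at most 1, and
    every iteration halves it since the mass is at most 1 / 2.\<close>
  have close: "norm (\<Phi> s x + \<psi> j r (\<Phi> s x) - \<Phi> r x) \<le> (1 / 2) ^ j" if "r \<in> {s..t}" for j r x
    using that
  proof (induction j arbitrary: r)
    case 0
    have "norm (\<Phi> r x - \<Phi> s x) \<le> integral {s..r} k"
      using st 0 by (intro norm_solves_diff_le[OF \<Phi>]) auto
    also have "\<dots> \<le> integral {s..t} k" using st 0 by (intro k_integral_mono) auto
    also have "\<dots> \<le> 1" using mass \<open>\<delta> \<le> 1 / 2\<close> by simp
    finally show ?case by (simp add: \<psi>0 norm_minus_commute)
  next
    case (Suc j)
    have contr: "continuous_on {s..r} (\<lambda>q. \<Phi> q x)"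
      using st Suc.prems by (intro solves_continuous[OF \<Phi>]) auto
    have "norm (integral {s..r} (\<lambda>q. u q (\<Phi> s x + \<psi> j q (\<Phi> s x))) - integral {s..r} (\<lambda>q. u q (\<Phi> q x)))
        \<le> integral {s..r} (\<lambda>q. k q * (1 / 2) ^ j)"
      using st Suc contr by (intro norm_u_integral_diff_le cont' continuous_intros) auto
    also have "\<dots> = integral {s..r} k * (1 / 2) ^ j" by simp
    also have "\<dots> \<le> 1 / 2 * (1 / 2) ^ j"
    proof (rule mult_right_mono)
      have "integral {s..r} k \<le> integral {s..t} k"
        using st Suc.prems by (intro k_integral_mono) auto
      then show "integral {s..r} k \<le> 1 / 2" using mass \<open>\<delta> \<le> 1 / 2\<close> by simp
    qed simp
    also have "integral {s..r} (\<lambda>q. u q (\<Phi> q x)) = \<Phi> r x - \<Phi> s x"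
      using st Suc.prems by (intro solves_diff[OF \<Phi>, symmetric]) auto
    finally show ?case by (simp add: \<psi>S algebra_simps)
  qed
  \<comment> \<open>Since \<open>\<Phi> s\<close> is the identity plus a displacement with bound K,
    composing \<open>\<psi> j t\<close>, which has bound 1, with \<open>\<Phi> s\<close> gives the
    bound L; adding the displacement gives L + K, uniformly in j.\<close>
  have *: "hoelder_le n \<alpha> (L + K) (\<lambda>x. \<psi> j t (\<Phi> s x) + (\<Phi> s x - x))" for j
  proof -
    have "hoelder_le n \<alpha> (L * 1) (\<lambda>x. \<psi> j t (x + (\<Phi> s x - x)))"
      using L[rule_format, OF ball K] st by simp
    then show ?thesis using hoelder_le_add[OF _ K] by simp
  qed
  show ?thesis
  proof (rule hoelder_le_uniform_limit[where g = "\<lambda>j x. \<psi> j t (\<Phi> s x) + (\<Phi> s x - x)"])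
    show "uniform_limit UNIV (\<lambda>j x. \<psi> j t (\<Phi> s x) + (\<Phi> s x - x)) (\<lambda>x. \<Phi> t x - x) sequentially"
    proof (rule uniform_limitI)
      fix e :: real assume "0 < e"
      then have "\<forall>\<^sub>F j in sequentially. (1 / 2 :: real) ^ j < e"
        by (intro order_tendstoD(2)[OF LIMSEQ_power_zero]) auto
      then show "\<forall>\<^sub>F j in sequentially. \<forall>x\<in>UNIV. dist (\<psi> j t (\<Phi> s x) + (\<Phi> s x - x)) (\<Phi> t x - x) < e"
      proof eventually_elim
        case (elim j)
        have "dist (\<psi> j t (\<Phi> s x) + (\<Phi> s x - x)) (\<Phi> t x - x) \<le> (1 / 2) ^ j" for x
          using close[of t x j] st by (simp add: dist_norm algebra_simps)
        then show ?case using elim by (auto intro: le_less_trans)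
      qed
    qed
  qed (use * \<alpha> in auto)
qed

end

text \<open>K depends only on n, \<alpha> and R. The induction is on the number N of pieces of mass
  \<delta>: one more piece changes K to L + K, where L is the composition constant for displacements
  with bound K.\<close>

lemma flow_hoelder_bound:
  assumes n: "1 \<le> n" and \<alpha>: "0 < \<alpha>" "\<alpha> \<le> 1"
  obtains K where "0 \<le> K"
    "\<And>(u :: real \<Rightarrow> 'a::euclidean_space \<Rightarrow> 'a) k \<Phi> t. hoelder_field n \<alpha> u k \<Longrightarrow>
      integral {0..1} k \<le> R \<Longrightarrow> (\<forall>x. Lipschitz_field.solves u x (\<lambda>t. \<Phi> t x)) \<Longrightarrow> t \<in> {0..1} \<Longrightarrow>
      hoelder_le n \<alpha> K (\<lambda>x. \<Phi> t x - x)"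
proof -
  obtain C where "0 < C" and C: "\<forall>\<kappa> (f :: 'a \<Rightarrow> 'a) (\<phi> :: 'a \<Rightarrow> 'a). hoelder_le n \<alpha> \<kappa> f \<longrightarrow> hoelder_le n \<alpha> 1 \<phi> \<longrightarrow>
      hoelder_le n \<alpha> (C * \<kappa>) (\<lambda>x. f (x + \<phi> x))"
    using hoelder_le_compose'[OF n \<alpha>, of 1, where ?'a = 'a and ?'b = 'a] by auto
  \<comment> \<open>Small enough for both properties of the short-time iteration: 1 / C for the
    self-map property and 1 / 2 for the contraction.\<close>
  define \<delta> where "\<delta> = min (1 / C) (1 / 2)"
  have \<delta>: "0 < \<delta>" "\<delta> \<le> 1 / 2" "C * \<delta> \<le> 1"
    using \<open>0 < C\<close> mult_left_mono[of \<delta> "1 / C" C] by (auto simp: \<delta>_def)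
  have ex: "\<exists>K\<ge>0. \<forall>(u :: real \<Rightarrow> 'a \<Rightarrow> 'a) k \<Phi> t. hoelder_field n \<alpha> u k \<longrightarrow> 
      (\<forall>x. Lipschitz_field.solves u x (\<lambda>t. \<Phi> t x)) \<longrightarrow> t \<in> {0..1} \<longrightarrow>
      integral {0..t} k \<le> real N * \<delta> \<longrightarrow> hoelder_le n \<alpha> K (\<lambda>x. \<Phi> t x - x)" for N
  proof (induction N)
    case 0
    have "hoelder_le n \<alpha> 0 (\<lambda>x. \<Phi> t x - x)"
      if "hoelder_field n \<alpha> u k" and \<Phi>: "\<forall>x. Lipschitz_field.solves u x (\<lambda>t. \<Phi> t x)"
        and t: "t \<in> {0..1}" "integral {0..t} k \<le> 0" for u :: "real \<Rightarrow> 'a \<Rightarrow> 'a" and k \<Phi> t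
    proof -
      interpret hoelder_field n \<alpha> u k by fact
      have "norm (\<Phi> t x - \<Phi> 0 x) \<le> integral {0..t} k" for x
        using t \<Phi> by (intro norm_solves_diff_le) auto
      then have "\<Phi> t x - x = 0" for x
        using t(2) solves_0[OF \<Phi>[rule_format]] by (metis norm_le_zero_iff order_trans)
      then have "(\<lambda>x. \<Phi> t x - x) = (\<lambda>_. 0)" by blast
      then show ?thesis by (simp add: hoelder_le_const)
    qed
    then show ?case by (intro exI[of _ 0]) simp
  next
    case (Suc N)
    then obtain K where "0 \<le> K" and K: "\<And>(u :: real \<Rightarrow> 'a \<Rightarrow> 'a) k \<Phi> t. hoelder_field n \<alpha> u k \<Longrightarrow>
      (\<forall>x. Lipschitz_field.solves u x (\<lambda>t. \<Phi> t x)) \<Longrightarrow> t \<in> {0..1} \<Longrightarrow>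
      integral {0..t} k \<le> real N * \<delta> \<Longrightarrow> hoelder_le n \<alpha> K (\<lambda>x. \<Phi> t x - x)"
      by blast
    obtain L where "0 < L" and L: "\<forall>\<kappa> (f :: 'a \<Rightarrow> 'a) (\<phi> :: 'a \<Rightarrow> 'a). hoelder_le n \<alpha> \<kappa> f \<longrightarrow> hoelder_le n \<alpha> K \<phi> \<longrightarrow>
      hoelder_le n \<alpha> (L * \<kappa>) (\<lambda>x. f (x + \<phi> x))"
      using hoelder_le_compose'[OF n \<alpha> \<open>0 \<le> K\<close>, where ?'a = 'a and ?'b = 'a] by auto
    have "hoelder_le n \<alpha> (L + K) (\<lambda>x. \<Phi> t x - x)"
      if u: "hoelder_field n \<alpha> u k" and \<Phi>: "\<forall>x. Lipschitz_field.solves u x (\<lambda>t. \<Phi> t x)"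
        and t: "t \<in> {0..1}" "integral {0..t} k \<le> real (Suc N) * \<delta>" for u :: "real \<Rightarrow> 'a \<Rightarrow> 'a" and k \<Phi> t
    proof (cases "integral {0..t} k \<le> real N * \<delta>")
      case True
      then show ?thesis using K[OF u \<Phi> t(1)] \<open>0 < L\<close> by (auto intro: hoelder_le_mono)
    next
      case False
      interpret hoelder_field n \<alpha> u k by fact
      have kt: "k integrable_on {0..t}" using t by (intro k_int_sub) auto
      \<comment> \<open>At time s the mass of N pieces is used up, so that the remaining mass is at
        most \<delta>; s exists because the indefinite integral is continuous.\<close>
      have "\<exists>s\<ge>0. s \<le> t \<and> integral {0..s} k = real N * \<delta>"
        using False t \<delta> by (intro IVT' indefinite_integral_continuous_1[OF kt]) auto
      then obtain s where s: "0 \<le> s" "s \<le> t" "integral {0..s} k = real N * \<delta>" by blast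
      have "integral {0..s} k + integral {s..t} k = integral {0..t} k"
        using s kt by (intro Henstock_Kurzweil_Integration.integral_combine) auto
      then have mass: "integral {s..t} k \<le> \<delta>" using s t by (simp add: algebra_simps)
      have Ks: "hoelder_le n \<alpha> K (\<lambda>x. \<Phi> s x - x)"
        using s t by (intro K[OF u \<Phi>]) auto
      show ?thesis
      proof (rule flow_short_time[where s = s])
        show "t \<le> 1" using t by simp
        show "solves x (\<lambda>t. \<Phi> t x)" for x using \<Phi> by simp
      qed fact+
    qed
    then show ?case using \<open>0 \<le> K\<close> \<open>0 < L\<close> by (intro exI[of _ "L + K"]) auto
  qed
  obtain N where "R \<le> real N * \<delta>"
    using ex_less_of_nat_mult[OF \<delta>(1), of R] by (auto intro: less_imp_le)
  from ex[of N] obtain K where "0 \<le> K" and K: "\<And>(u :: real \<Rightarrow> 'a \<Rightarrow> 'a) k \<Phi> t. hoelder_field n \<alpha> u k \<Longrightarrow>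
      (\<forall>x. Lipschitz_field.solves u x (\<lambda>t. \<Phi> t x)) \<Longrightarrow> t \<in> {0..1} \<Longrightarrow>
      integral {0..t} k \<le> real N * \<delta> \<Longrightarrow> hoelder_le n \<alpha> K (\<lambda>x. \<Phi> t x - x)"
    by blast
  show ?thesis
  proof (rule that[OF \<open>0 \<le> K\<close>])
    fix u :: "real \<Rightarrow> 'a \<Rightarrow> 'a" and k \<Phi> and t :: real
    assume u: "hoelder_field n \<alpha> u k" and R: "integral {0..1} k \<le> R"
      and \<Phi>: "\<forall>x. Lipschitz_field.solves u x (\<lambda>t. \<Phi> t x)" and t: "t \<in> {0..1}"
    interpret hoelder_field n \<alpha> u k by fact
    have "integral {0..t} k \<le> integral {0..1} k" using t by (intro k_integral_mono) auto
    then show "hoelder_le n \<alpha> K (\<lambda>x. \<Phi> t x - x)"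
      using R \<open>R \<le> real N * \<delta>\<close> by (intro K[OF u \<Phi> t]) simp
  qed
qed

context Lipschitz_field
begin

text \<open>Trajectories that start far away stay far away, since the displacement is at most the
  integral of k. Along starting points tending to infinity the integrands therefore tend to 0
  pointwise in time, and k dominates them.\<close>

lemma flow_vanishes_at_infinity:
  assumes u0: "\<And>s. s \<in> {0..1} \<Longrightarrow> (u s \<longlongrightarrow> 0) at_infinity"
    and \<Phi>: "\<And>x. solves x (\<lambda>t. \<Phi> t x)" and t: "t \<in> {0..1}"
  shows "((\<lambda>x. \<Phi> t x - x) \<longlongrightarrow> 0) at_infinity"
proof (rule ccontr)
  assume "\<not> ?thesis"
  then obtain e where "0 < e" and "\<not> (\<forall>\<^sub>F x in at_infinity. norm (\<Phi> t x - x) < e)"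
    unfolding tendsto_iff by (auto simp: dist_norm)
  then have "\<forall>j. \<exists>x. real j \<le> norm x \<and> e \<le> norm (\<Phi> t x - x)"
    unfolding eventually_at_infinity by (metis not_le)
  then obtain X where X: "\<And>j. real j \<le> norm (X j)" "\<And>j. e \<le> norm (\<Phi> t (X j) - X j)"
    by metis
  have cont: "continuous_on {0..t} (\<lambda>s. \<Phi> s x)" for x
    using t by (intro solves_continuous[OF \<Phi>]) auto
  have "(\<lambda>j. integral {0..t} (\<lambda>s. u s (\<Phi> s (X j)))) \<longlonglongrightarrow> integral {0..t} (\<lambda>s. 0)"
  proof (rule dominated_convergence)
    show "(\<lambda>s. u s (\<Phi> s (X j))) integrable_on {0..t}" for j using t cont by (intro u_int') auto
    show "k integrable_on {0..t}" using t by (intro k_int_sub) auto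
    fix s assume "s \<in> {0..t}"
    then have s: "s \<in> {0..1}" using t by auto
    show "norm (u s (\<Phi> s (X j))) \<le> k s" for j using norm_u[OF s] .
    have far: "real j - integral {0..1} k \<le> norm (\<Phi> s (X j))" for j
    proof -
      have "norm (\<Phi> s (X j) - \<Phi> 0 (X j)) \<le> integral {0..s} k"
        using s by (intro norm_solves_diff_le[OF \<Phi>]) auto
      also have "\<dots> \<le> integral {0..1} k" using s by (intro k_integral_mono) auto
      finally show ?thesis
        using X(1)[of j] norm_triangle_ineq4[of "\<Phi> s (X j)" "\<Phi> s (X j) - \<Phi> 0 (X j)"] solves_0[OF \<Phi>] by simp
    qed
    have "filterlim (\<lambda>j. real j - integral {0..1} k) at_top sequentially"
      using filterlim_tendsto_add_at_top[OF tendsto_const[of "- integral {0..1} k"] filterlim_real_sequentially]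
      by simp
    then have "filterlim (\<lambda>j. norm (\<Phi> s (X j))) at_top sequentially"
      by (rule filterlim_at_top_mono) (simp add: far)
    then have "filterlim (\<lambda>j. \<Phi> s (X j)) at_infinity sequentially"
      by (rule filterlim_norm_at_top_imp_at_infinity)
    then show "(\<lambda>j. u s (\<Phi> s (X j))) \<longlonglongrightarrow> 0" by (rule filterlim_compose[OF u0[OF s]])
  qed
  moreover have "integral {0..t} (\<lambda>s. u s (\<Phi> s (X j))) = \<Phi> t (X j) - X j" for j
    using t solves_diff[OF \<Phi>, of 0 t] solves_0[OF \<Phi>] by simp
  ultimately have "(\<lambda>j. \<Phi> t (X j) - X j) \<longlonglongrightarrow> 0" by simp
  then have "\<forall>\<^sub>F j in sequentially. norm (\<Phi> t (X j) - X j) < e"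
    using \<open>0 < e\<close> by (auto simp: tendsto_iff)
  then show False using X(2) by (auto simp: eventually_sequentially not_le[symmetric])
qed

end

section \<open>Locally convex spaces\<close>

text \<open>Homogeneity is stated as an inequality; scaling back by 1 / c yields equality for
  nonzero c. Nonemptiness of P makes V the whole space of \<open>lcs_topology V P\<close>, which is
  generated by balls and would otherwise have no points.\<close>

definition seminorm_family :: "'v::real_vector set \<Rightarrow> ('v \<Rightarrow> real) set \<Rightarrow> bool" where
  "seminorm_family V P \<longleftrightarrow> subspace V \<and> P \<noteq> {} \<and>
     (\<forall>p\<in>P. (\<forall>x\<in>V. 0 \<le> p x) \<and> (\<forall>x\<in>V. \<forall>y\<in>V. p (x + y) \<le> p x + p y) \<and>
        (\<forall>c. \<forall>x\<in>V. p (c *\<^sub>R x) \<le> \<bar>c\<bar> * p x))"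

context
  fixes V :: "'v::real_vector set" and P :: "('v \<Rightarrow> real) set"
  assumes VP: "seminorm_family V P"
begin

lemma seminorm_subspace: "subspace V"
  using VP by (simp add: seminorm_family_def)

lemma seminorm_nonneg: "p \<in> P \<Longrightarrow> x \<in> V \<Longrightarrow> 0 \<le> p x"
  using VP by (simp add: seminorm_family_def)

lemma seminorm_triangle: "p \<in> P \<Longrightarrow> x \<in> V \<Longrightarrow> y \<in> V \<Longrightarrow> p (x + y) \<le> p x + p y"
  using VP by (simp add: seminorm_family_def)

lemma seminorm_scaleR_le: "p \<in> P \<Longrightarrow> x \<in> V \<Longrightarrow> p (c *\<^sub>R x) \<le> \<bar>c\<bar> * p x"
  using VP by (simp add: seminorm_family_def)

lemma seminorm_zero: "p \<in> P \<Longrightarrow> p 0 = 0"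
  using seminorm_scaleR_le[of p 0 0] seminorm_nonneg[of p 0] subspace_0[OF seminorm_subspace] by simp

lemma seminorm_minus_commute:
  assumes "p \<in> P" "x \<in> V" "y \<in> V"
  shows "p (x - y) = p (y - x)"
  using seminorm_scaleR_le[OF assms(1), of "x - y" "-1"] seminorm_scaleR_le[OF assms(1), of "y - x" "-1"]
    subspace_diff[OF seminorm_subspace] assms by simp

lemma seminorm_triangle_diff:
  assumes "p \<in> P" "x \<in> V" "y \<in> V" "z \<in> V"
  shows "p (x - z) \<le> p (x - y) + p (y - z)"
  using seminorm_triangle[OF assms(1), of "x - y" "y - z"] subspace_diff[OF seminorm_subspace] assms by simp

lemma seminorm_diff_le:
  assumes "p \<in> P" "x \<in> V" "y \<in> V"
  shows "p x \<le> p (x - y) + p y"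
  using seminorm_triangle[OF assms(1), of "x - y" y] subspace_diff[OF seminorm_subspace] assms by simp

lemma openin_lcs_ball: "p \<in> P \<Longrightarrow> u \<in> V \<Longrightarrow> 0 < e \<Longrightarrow> openin (lcs_topology V P) {v \<in> V. p (v - u) < e}"
  unfolding lcs_topology_def by (rule topology_generated_by_Basis) blast

lemma topspace_lcs: "topspace (lcs_topology V P) = V"
proof
  show "topspace (lcs_topology V P) \<subseteq> V"
    unfolding lcs_topology_def topology_generated_by_topspace by blast
  obtain p where p: "p \<in> P" using VP by (auto simp: seminorm_family_def)
  show "V \<subseteq> topspace (lcs_topology V P)"
  proof
    fix u assume u: "u \<in> V"
    then have "u \<in> {v \<in> V. p (v - u) < 1}" using seminorm_zero[OF p] by simp
    then show "u \<in> topspace (lcs_topology V P)"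
      using openin_subset[OF openin_lcs_ball[OF p u zero_less_one]] by blast
  qed
qed

text \<open>The generating balls have arbitrary centres in V; the triangle inequality reduces them
  to balls around the image point \<open>f x\<close>.\<close>

lemma continuous_map_lcsI:
  assumes f: "\<And>x. x \<in> topspace X \<Longrightarrow> f x \<in> V"
    and near: "\<And>x p e. x \<in> topspace X \<Longrightarrow> p \<in> P \<Longrightarrow> 0 < e \<Longrightarrow>
      \<exists>U. openin X U \<and> x \<in> U \<and> (\<forall>y\<in>U. p (f y - f x) < e)"
  shows "continuous_map X (lcs_topology V P) f"
  unfolding lcs_topology_def
proof (rule continuous_on_generated_topo)
  show "f ` topspace X \<subseteq> \<Union> {{v \<in> V. p (v - u) < e} |u p e. u \<in> V \<and> p \<in> P \<and> 0 < e}"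
    using f topspace_lcs unfolding lcs_topology_def topology_generated_by_topspace by blast
  fix B assume "B \<in> {{v \<in> V. p (v - u) < e} |u p e. u \<in> V \<and> p \<in> P \<and> 0 < e}"
  then obtain u p e where B: "B = {v \<in> V. p (v - u) < e}" and u: "u \<in> V" and p: "p \<in> P" by blast
  show "openin X (f -` B \<inter> topspace X)"
    unfolding openin_subopen[of X "f -` B \<inter> topspace X"]
  proof
    fix x assume x: "x \<in> f -` B \<inter> topspace X"
    then have "0 < e - p (f x - u)" using B by simp
    then obtain U where U: "openin X U" "x \<in> U" "\<And>y. y \<in> U \<Longrightarrow> p (f y - f x) < e - p (f x - u)"
      using near[of x p "e - p (f x - u)"] x p by blast
    have "y \<in> f -` B \<inter> topspace X" if "y \<in> U" for y
    proof -
      have y: "y \<in> topspace X" using openin_subset[OF U(1)] that by blast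
      have "p (f y - u) \<le> p (f y - f x) + p (f x - u)"
        using p f[OF y] f[of x] x u by (intro seminorm_triangle_diff) auto
      then show ?thesis using U(3)[OF that] y f[OF y] B by simp
    qed
    then show "\<exists>T. openin X T \<and> x \<in> T \<and> T \<subseteq> f -` B \<inter> topspace X" using U by blast
  qed
qed

lemma continuous_map_lcsD:
  assumes f: "continuous_map X (lcs_topology V P) f" and x: "x \<in> topspace X"
  shows "f x \<in> V"
    and "p \<in> P \<Longrightarrow> 0 < e \<Longrightarrow> \<exists>U. openin X U \<and> x \<in> U \<and> (\<forall>y\<in>U. p (f y - f x) < e)"
proof -
  show fx: "f x \<in> V" using continuous_map_image_subset_topspace[OF f] x topspace_lcs by blast
  assume p: "p \<in> P" and e: "0 < e"
  have "openin X {y \<in> topspace X. f y \<in> {v \<in> V. p (v - f x) < e}}"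
    using f openin_lcs_ball[OF p fx e] by (rule openin_continuous_map_preimage)
  moreover have "x \<in> {y \<in> topspace X. f y \<in> {v \<in> V. p (v - f x) < e}}"
    using x fx seminorm_zero[OF p] e by simp
  ultimately show "\<exists>U. openin X U \<and> x \<in> U \<and> (\<forall>y\<in>U. p (f y - f x) < e)" by blast
qed

lemma continuous_map_top_of_set_lcs_iff:
  fixes g :: "'m::metric_space \<Rightarrow> 'v"
  shows "continuous_map (top_of_set S) (lcs_topology V P) g \<longleftrightarrow> (\<forall>t\<in>S. g t \<in> V) \<and>
    (\<forall>t\<in>S. \<forall>p\<in>P. \<forall>e>0. \<exists>d>0. \<forall>s\<in>S. dist s t < d \<longrightarrow> p (g s - g t) < e)"
proof safe
  assume g: "continuous_map (top_of_set S) (lcs_topology V P) g"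
  fix t assume t: "t \<in> S"
  then show "g t \<in> V" using continuous_map_lcsD(1)[OF g] by simp
  fix p and e :: real assume "p \<in> P" "0 < e"
  then obtain U where U: "openin (top_of_set S) U" "t \<in> U" "\<forall>y\<in>U. p (g y - g t) < e"
    using continuous_map_lcsD(2)[OF g, of t p e] t by auto
  then show "\<exists>d>0. \<forall>s\<in>S. dist s t < d \<longrightarrow> p (g s - g t) < e"
    unfolding openin_euclidean_subtopology_iff by meson
next
  assume V: "\<forall>t\<in>S. g t \<in> V"
    and near: "\<forall>t\<in>S. \<forall>p\<in>P. \<forall>e>0. \<exists>d>0. \<forall>s\<in>S. dist s t < d \<longrightarrow> p (g s - g t) < e"
  show "continuous_map (top_of_set S) (lcs_topology V P) g"
  proof (rule continuous_map_lcsI)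
    fix t p and e :: real assume *: "t \<in> topspace (top_of_set S)" "p \<in> P" "0 < e"
    then have t: "t \<in> S" by simp
    obtain d where d: "0 < d" "\<forall>s\<in>S. dist s t < d \<longrightarrow> p (g s - g t) < e"
      using near[rule_format, OF t *(2,3)] by blast
    then show "\<exists>U. openin (top_of_set S) U \<and> t \<in> U \<and> (\<forall>y\<in>U. p (g y - g t) < e)"
      using * by (intro exI[of _ "S \<inter> ball t d"]) (auto simp: dist_commute openin_open_Int)
  qed (use V in auto)
qed

lemma limitin_lcsD:
  assumes "limitin (lcs_topology V P) f l F" and p: "p \<in> P" and e: "0 < e"
  shows "\<forall>\<^sub>F x in F. f x \<in> V \<and> p (f x - l) < e"
proof -
  have l: "l \<in> V" using limitin_topspace[OF assms(1)] topspace_lcs by simp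
  have "\<forall>\<^sub>F x in F. f x \<in> {v \<in> V. p (v - l) < e}"
    using assms(1) openin_lcs_ball[OF p l e] l seminorm_zero[OF p] e unfolding limitin_def by auto
  then show ?thesis by simp
qed

text \<open>A Lipschitz estimate at the single point t, the local ingredient of
  \<open>smooth_curve_Lipschitz\<close>.\<close>

lemma lcs_derivative_local_bound:
  assumes c: "\<And>t. c t \<in> V" and d: "d \<in> V" and p: "p \<in> P" and e: "0 < e"
    and lim: "limitin (lcs_topology V P) (\<lambda>h. (1 / h) *\<^sub>R (c (t + h) - c t)) d (at 0)"
  shows "\<exists>\<delta>>0. \<forall>s. \<bar>s - t\<bar> < \<delta> \<longrightarrow> p (c s - c t) \<le> (p d + e) * \<bar>s - t\<bar>"
proof -
  obtain \<delta> where "0 < \<delta>" and \<delta>: "\<And>h. h \<noteq> 0 \<Longrightarrow> \<bar>h\<bar> < \<delta> \<Longrightarrow> p ((1 / h) *\<^sub>R (c (t + h) - c t) - d) < e"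
    using limitin_lcsD[OF lim p e] unfolding eventually_at by (auto simp: dist_real_def)
  have "p (c s - c t) \<le> (p d + e) * \<bar>s - t\<bar>" if s: "\<bar>s - t\<bar> < \<delta>" for s
  proof (cases "s = t")
    case True
    then show ?thesis using seminorm_zero[OF p] by simp
  next
    case False
    define h where "h = s - t"
    have h: "h \<noteq> 0" "\<bar>h\<bar> < \<delta>" using False s by (auto simp: h_def)
    have V: "(1 / h) *\<^sub>R (c (t + h) - c t) \<in> V"
      using c by (intro subspace_scale subspace_diff seminorm_subspace)
    have "p ((1 / h) *\<^sub>R (c (t + h) - c t)) \<le> e + p d"
      using seminorm_diff_le[OF p V d] \<delta>[OF h] by simp
    then have "\<bar>h\<bar> * p ((1 / h) *\<^sub>R (c (t + h) - c t)) \<le> \<bar>h\<bar> * (e + p d)"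
      by (intro mult_left_mono) auto
    moreover have "p (h *\<^sub>R ((1 / h) *\<^sub>R (c (t + h) - c t))) \<le> \<bar>h\<bar> * p ((1 / h) *\<^sub>R (c (t + h) - c t))"
      using p V by (rule seminorm_scaleR_le)
    ultimately show ?thesis using h by (simp add: h_def algebra_simps)
  qed
  then show ?thesis using \<open>0 < \<delta>\<close> by blast
qed

text \<open>A mean value inequality for a seminorm. The seminorm of the derivative is continuous,
  because the derivative is itself differentiable, and hence bounded by some B on the compact
  interval; local estimates with constant B + 1 are then glued together.\<close>

lemma smooth_curve_Lipschitz:
  assumes "smooth_curve V P c" and p: "p \<in> P"
  shows "\<exists>B\<ge>0. \<forall>s\<in>{a..b}. \<forall>t\<in>{a..b}. p (c t - c s) \<le> B * \<bar>t - s\<bar>"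
proof -
  obtain cs where cs0: "cs 0 = c" and cs: "\<And>k t. cs k t \<in> V" and
    lim: "\<And>k t. limitin (lcs_topology V P) (\<lambda>h. (1 / h) *\<^sub>R (cs k (t + h) - cs k t)) (cs (Suc k) t) (at 0)"
    using assms(1) unfolding smooth_curve_def by blast
  define q where "q t = p (cs 1 t)" for t
  have "isCont q t" for t
  proof -
    obtain \<delta> where "0 < \<delta>" and \<delta>: "\<And>s. \<bar>s - t\<bar> < \<delta> \<Longrightarrow> p (cs 1 s - cs 1 t) \<le> (p (cs (Suc 1) t) + 1) * \<bar>s - t\<bar>"
      using lcs_derivative_local_bound[OF cs cs p zero_less_one lim] by blast
    have qd: "\<bar>q s - q t\<bar> \<le> p (cs 1 s - cs 1 t)" for s
      using seminorm_diff_le[OF p cs cs, of 1 s 1 t] seminorm_diff_le[OF p cs cs, of 1 t 1 s]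
        seminorm_minus_commute[OF p cs cs, of 1 s 1 t] by (simp add: q_def abs_le_iff)
    have "((\<lambda>s. (p (cs (Suc 1) t) + 1) * \<bar>s - t\<bar>) \<longlongrightarrow> (p (cs (Suc 1) t) + 1) * \<bar>t - t\<bar>) (at t)"
      by (intro tendsto_intros)
    then have "((\<lambda>s. (p (cs (Suc 1) t) + 1) * \<bar>s - t\<bar>) \<longlongrightarrow> 0) (at t)" by simp
    moreover have "\<forall>\<^sub>F s in at t. norm (q s - q t) \<le> (p (cs (Suc 1) t) + 1) * \<bar>s - t\<bar>"
      unfolding eventually_at using \<open>0 < \<delta>\<close> order_trans[OF qd \<delta>] by (auto simp: dist_real_def)
    ultimately have "((\<lambda>s. q s - q t) \<longlongrightarrow> 0) (at t)"
      by (rule Lim_null_comparison[rotated])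
    then show ?thesis unfolding isCont_def by (rule LIM_zero_cancel)
  qed
  then have "continuous_on {a..b} q" by (simp add: continuous_at_imp_continuous_on)
  then have "bounded (q ` {a..b})" by (intro compact_imp_bounded compact_continuous_image) auto
  then obtain B where B: "\<And>t. t \<in> {a..b} \<Longrightarrow> q t \<le> B" "0 < B"
    unfolding bounded_pos by (metis abs_le_D1 imageI real_norm_def)
  have mono: "p (c t - c s) \<le> (B + 1) * (t - s)" if st: "a \<le> s" "s \<le> t" "t \<le> b" for s t
    using \<open>s \<le> t\<close>
  \<comment> \<open>The estimate is additive over adjacent intervals, so it suffices to treat short
    intervals around a point x; there it is split at x, and
    \<open>lcs_derivative_local_bound\<close> applies on both sides.\<close>
  proof (rule Bolzano[where P = "\<lambda>s t. p (c t - c s) \<le> (B + 1) * (t - s)"])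
    fix x y z :: real
    assume "p (c y - c x) \<le> (B + 1) * (y - x)" "p (c z - c y) \<le> (B + 1) * (z - y)"
    moreover have "p (c z - c x) \<le> p (c z - c y) + p (c y - c x)"
      using cs[of 0] p by (intro seminorm_triangle_diff) (auto simp: cs0)
    ultimately show "p (c z - c x) \<le> (B + 1) * (z - x)" by (simp add: algebra_simps)
  next
    fix x assume x: "s \<le> x" "x \<le> t"
    then have "q x \<le> B" using B st by auto
    obtain \<delta> where "0 < \<delta>" and \<delta>: "\<And>y. \<bar>y - x\<bar> < \<delta> \<Longrightarrow> p (c y - c x) \<le> (p (cs (Suc 0) x) + 1) * \<bar>y - x\<bar>"
      using lcs_derivative_local_bound[OF cs cs p zero_less_one lim[of 0]] unfolding cs0 by blast
    have *: "p (c y - c x) \<le> (B + 1) * \<bar>y - x\<bar>" if "\<bar>y - x\<bar> < \<delta>" for y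
      using \<delta>[OF that] \<open>q x \<le> B\<close> mult_right_mono[of "p (cs (Suc 0) x) + 1" "B + 1" "\<bar>y - x\<bar>"]
      by (simp add: q_def)
    have "p (c v - c w) \<le> (B + 1) * (v - w)" if "w \<le> x" "x \<le> v" "v - w < \<delta>" for v w
    proof -
      have "p (c v - c w) \<le> p (c v - c x) + p (c x - c w)"
        using cs[of 0] p by (intro seminorm_triangle_diff) (auto simp: cs0)
      moreover have "p (c x - c w) = p (c w - c x)"
        using cs[of 0] p by (intro seminorm_minus_commute) (auto simp: cs0)
      ultimately show ?thesis using *[of v] *[of w] that by (simp add: algebra_simps)
    qed
    then show "\<exists>d>0. \<forall>w v. w \<le> x \<and> x \<le> v \<and> v - w < d \<longrightarrow> p (c v - c w) \<le> (B + 1) * (v - w)"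
      using \<open>0 < \<delta>\<close> by blast
  qed
  have "p (c t - c s) \<le> (B + 1) * \<bar>t - s\<bar>" if "s \<in> {a..b}" "t \<in> {a..b}" for s t
  proof (cases "s \<le> t")
    case True
    then show ?thesis using mono[of s t] that by simp
  next
    case False
    then show ?thesis
      using mono[of t s] that seminorm_minus_commute[OF p cs[of 0] cs[of 0], of t s] by (simp add: cs0)
  qed
  then show ?thesis using B(2) by (intro exI[of _ "B + 1"]) auto
qed

end

lemma seminorm_diff_le_add:
  assumes "seminorm_family V P" "p \<in> P" "x \<in> V" "y \<in> V"
  shows "p (x - y) \<le> p x + p y"
  using seminorm_triangle_diff[OF assms(1-3) subspace_0[OF seminorm_subspace[OF assms(1)]] assms(4)]
    seminorm_minus_commute[OF assms(1,2,4) subspace_0[OF seminorm_subspace[OF assms(1)]]] by simp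

lemma smooth_curve_in: "smooth_curve V P c \<Longrightarrow> c t \<in> V"
  unfolding smooth_curve_def by metis

text \<open>The limes inferior gives such a bound on some interval (0, b), and monotonicity extends
  it to every bounded interval with a smaller constant.\<close>

lemma slowly_vanishing_lower_bound:
  assumes \<omega>: "slowly_vanishing \<omega>" and "0 < \<gamma>"
  shows "\<exists>c>0. \<forall>r. 0 < r \<longrightarrow> r \<le> D \<longrightarrow> c * r powr \<gamma> \<le> \<omega> r"
proof -
  have "0 < Liminf (at_right 0) (\<lambda>t. ereal (\<omega> t / t powr \<gamma>))"
    using \<omega> \<open>0 < \<gamma>\<close> by (simp add: slowly_vanishing_def)
  then obtain c where "0 < ereal c" "ereal c < Liminf (at_right 0) (\<lambda>t. ereal (\<omega> t / t powr \<gamma>))"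
    using ereal_dense2 by blast
  then have "0 < c" and ev: "\<forall>\<^sub>F t in at_right 0. c < \<omega> t / t powr \<gamma>"
    by (auto dest!: less_LiminfD)
  obtain b where "0 < b" and b: "\<And>t. 0 < t \<Longrightarrow> t < b \<Longrightarrow> c < \<omega> t / t powr \<gamma>"
    using ev unfolding eventually_at_right_field by auto
  have small: "c * t powr \<gamma> \<le> \<omega> t" if "0 < t" "t < b" for t
    using b[OF that] that by (simp add: pos_less_divide_eq less_imp_le)
  define D' where "D' = max D (b / 2)"
  \<comment> \<open>For r between b and D, \<omega> r is at least \<omega> (b / 2), hence at least c
    * (b / 2) powr \<gamma>, while r powr \<gamma> is at most D' powr \<gamma>. The point b / 2 lies
    inside the strict range t < b.\<close>
  define c' where "c' = min c (c * (b / 2) powr \<gamma> / D' powr \<gamma>)"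
  have D': "0 < D'" "D \<le> D'" using \<open>0 < b\<close> by (auto simp: D'_def)
  have "c' * r powr \<gamma> \<le> \<omega> r" if r: "0 < r" "r \<le> D" for r
  proof (cases "r < b")
    case True
    have "c' * r powr \<gamma> \<le> c * r powr \<gamma>" by (intro mult_right_mono) (auto simp: c'_def)
    then show ?thesis using small[OF r(1) True] by simp
  next
    case False
    have "r powr \<gamma> \<le> D' powr \<gamma>" using r D' \<open>0 < \<gamma>\<close> by (intro powr_mono2) auto
    then have "c' * r powr \<gamma> \<le> (c * (b / 2) powr \<gamma> / D' powr \<gamma>) * D' powr \<gamma>"
      using \<open>0 < c\<close> by (intro mult_mono) (auto simp: c'_def)
    also have "\<dots> = c * (b / 2) powr \<gamma>" using D' by simp
    also have "\<dots> \<le> \<omega> (b / 2)" using \<open>0 < b\<close> by (intro small) auto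
    also have "\<dots> \<le> \<omega> r"
      using \<omega> False \<open>0 < b\<close> unfolding slowly_vanishing_def by (intro mono_onD[of "{0..}" \<omega>]) auto
    finally show ?thesis .
  qed
  moreover have "0 < c'" using \<open>0 < c\<close> \<open>0 < b\<close> D' by (simp add: c'_def)
  ultimately show ?thesis by blast
qed

section \<open>Spaces of Bochner integrable functions\<close>

text \<open>The limit operator applied to the sequence is measurable and agrees with f almost
  everywhere; completeness of Lebesgue measure transfers measurability to f. Extension by 0 passes
  between S and the whole space.\<close>

lemma borel_measurable_AE_limit:
  fixes g :: "nat \<Rightarrow> 'a::euclidean_space \<Rightarrow> 'b::euclidean_space"
  assumes S: "S \<in> sets lebesgue" and g: "\<And>k. g k \<in> borel_measurable (lebesgue_on S)"
    and lim: "AE x in lebesgue_on S. (\<lambda>k. g k x) \<longlonglongrightarrow> f x"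
  shows "f \<in> borel_measurable (lebesgue_on S)"
proof -
  define f' where "f' x = lim (\<lambda>k. g k x)" for x
  have "f' \<in> borel_measurable (lebesgue_on S)"
    unfolding f'_def[abs_def] using g by (rule borel_measurable_lim_metric)
  then have "(\<lambda>x. if x \<in> S then f' x else 0) \<in> borel_measurable lebesgue"
    using S by (simp add: borel_measurable_if)
  moreover have "AE x in lebesgue. (if x \<in> S then f' x else 0) = (if x \<in> S then f x else 0)"
  proof -
    have "AE x in lebesgue_on S. f' x = f x"
      using lim by eventually_elim (auto simp: f'_def limI)
    then show ?thesis using S by (auto simp: AE_restrict_space_iff)
  qed
  ultimately have "(\<lambda>x. if x \<in> S then f x else 0) \<in> borel_measurable lebesgue"
    by (rule borel_measurable_AE)
  then show ?thesis using S by (simp add: borel_measurable_if)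
qed

context
  fixes V :: "'v::real_vector set" and N :: "'v \<Rightarrow> real" and S :: "real set"
  assumes VN: "seminorm_family V {N}" and S: "S \<in> lmeasurable"
begin

private lemma S_sets: "S \<in> sets lebesgue"
  using S by (simp add: fmeasurable_def)

private lemma finite_measure_S: "finite_measure (lebesgue_on S)"
  using S by (rule finite_measure_lebesgue_on)

private lemma V_diff: "x \<in> V \<Longrightarrow> y \<in> V \<Longrightarrow> x - y \<in> V"
  using subspace_diff[OF seminorm_subspace[OF VN]] .

private lemma N_simple:
  assumes "simple_function (lebesgue_on S) r" "simple_function (lebesgue_on S) s"
  shows "(\<lambda>t. N (r t - s t)) \<in> borel_measurable (lebesgue_on S)"
  using simple_function_compose2[OF assms, of "\<lambda>x y. N (x - y)"] by (rule borel_measurable_simple_function)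

text \<open>No sigma-algebra is given on V, so u is accessible only through its simple
  approximations: the functions N (s k t - r t) of t are simple and converge almost everywhere to N
  (u t - r t).\<close>

lemma seminorm_diff_measurable:
  assumes u: "u \<in> space (lebesgue_on S) \<rightarrow> V" and s: "\<And>k. simple_function (lebesgue_on S) (s k)" "\<And>k. s k \<in> space (lebesgue_on S) \<rightarrow> V"
    and lim: "AE t in lebesgue_on S. (\<lambda>k. N (u t - s k t)) \<longlonglongrightarrow> 0"
    and r: "simple_function (lebesgue_on S) r" "r \<in> space (lebesgue_on S) \<rightarrow> V"
  shows "(\<lambda>t. N (u t - r t)) \<in> borel_measurable (lebesgue_on S)"
proof (rule borel_measurable_AE_limit[OF S_sets])
  show "(\<lambda>t. N (s k t - r t)) \<in> borel_measurable (lebesgue_on S)" for k using s r by (intro N_simple)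
  show "AE t in lebesgue_on S. (\<lambda>k. N (s k t - r t)) \<longlonglongrightarrow> N (u t - r t)"
    using lim AE_space
  proof eventually_elim
    case (elim t)
    have V: "u t \<in> V" "r t \<in> V" "s k t \<in> V" for k using u r(2) s(2)[of k] elim by auto
    have "norm (N (s k t - r t) - N (u t - r t)) \<le> N (u t - s k t)" for k
      using seminorm_triangle_diff[OF VN _ V(1) V(3) V(2), of N k] seminorm_triangle_diff[OF VN _ V(3) V(1) V(2), of N k]
        seminorm_minus_commute[OF VN _ V(1) V(3), of N k] by (simp add: abs_le_iff)
    then have "(\<lambda>k. N (s k t - r t) - N (u t - r t)) \<longlonglongrightarrow> 0"
      by (intro Lim_null_comparison[OF _ elim(1)] always_eventually allI)
    then show ?case by (rule LIM_zero_cancel)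
  qed
qed

text \<open>The distance of u from one of its simple approximations has finite integral, and N of
  that approximation is bounded, having finitely many values, on a space of finite measure.\<close>

lemma bochner_integrable_in_seminorm:
  assumes "bochner_integrable_in (lebesgue_on S) V N u"
  shows "integrable (lebesgue_on S) (\<lambda>t. N (u t))"
proof -
  interpret finite_measure "lebesgue_on S" by (rule finite_measure_S)
  from assms obtain s where u: "u \<in> space (lebesgue_on S) \<rightarrow> V"
    and s: "\<And>k. simple_function (lebesgue_on S) (s k)" "\<And>k. s k \<in> space (lebesgue_on S) \<rightarrow> V"
    and lim: "AE t in lebesgue_on S. (\<lambda>k. N (u t - s k t)) \<longlonglongrightarrow> 0"
    and nn: "(\<lambda>k. \<integral>\<^sup>+t. ennreal (N (u t - s k t)) \<partial>lebesgue_on S) \<longlonglongrightarrow> 0"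
    unfolding bochner_integrable_in_def by blast
  have N0: "0 \<le> N x" if "x \<in> V" for x using seminorm_nonneg[OF VN _ that] by simp
  have 0: "(0 :: 'v) \<in> V" using subspace_0[OF seminorm_subspace[OF VN]] .
  obtain k where k: "(\<integral>\<^sup>+t. ennreal (N (u t - s k t)) \<partial>lebesgue_on S) < 1"
    using order_tendstoD(2)[OF nn, of 1] by (auto simp: eventually_sequentially)
  have d: "integrable (lebesgue_on S) (\<lambda>t. N (u t - s k t))"
  proof (rule integrableI_nonneg)
    show "(\<lambda>t. N (u t - s k t)) \<in> borel_measurable (lebesgue_on S)"
      using u s lim s(1)[of k] s(2)[of k] by (rule seminorm_diff_measurable)
    show "AE t in lebesgue_on S. 0 \<le> N (u t - s k t)"
      using u s(2)[of k] by (intro AE_I2 N0 V_diff) auto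
    show "(\<integral>\<^sup>+t. ennreal (N (u t - s k t)) \<partial>lebesgue_on S) < \<infinity>"
      using k by (rule less_trans) simp
  qed
  have sN: "integrable (lebesgue_on S) (\<lambda>t. N (s k t))"
  proof -
    have fin: "finite (s k ` space (lebesgue_on S))" using s(1)[of k] by (rule simple_functionD)
    have "simple_function (lebesgue_on S) (\<lambda>t. N (s k t))" using simple_function_compose1[OF s(1)] .
    then have "(\<lambda>t. N (s k t)) \<in> borel_measurable (lebesgue_on S)" by (rule borel_measurable_simple_function)
    moreover have "norm (N (s k t)) \<le> Max (N ` s k ` space (lebesgue_on S))" if "t \<in> space (lebesgue_on S)" for t
    proof -
      have "s k t \<in> V" using s(2)[of k] that by auto
      then show ?thesis using N0 fin that by simp
    qed
    ultimately show ?thesis by (intro integrable_const_bound[of _ "Max (N ` s k ` space (lebesgue_on S))"] AE_I2)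
  qed
  have "simple_function (lebesgue_on S) (\<lambda>_. 0 :: 'v)" by simp
  from seminorm_diff_measurable[OF u s lim this] 0 have "(\<lambda>t. N (u t)) \<in> borel_measurable (lebesgue_on S)" by simp
  then show ?thesis
  proof (rule Bochner_Integration.integrable_bound[OF Bochner_Integration.integrable_add[OF d sN]])
    show "AE t in lebesgue_on S. norm (N (u t)) \<le> norm (N (u t - s k t) + N (s k t))"
    proof (rule AE_I2)
      fix t assume t: "t \<in> space (lebesgue_on S)"
      then have V: "u t \<in> V" "s k t \<in> V" using u s(2)[of k] by auto
      show "norm (N (u t)) \<le> norm (N (u t - s k t) + N (s k t))"
        using seminorm_diff_le[OF VN _ V] N0[OF V(1)] by simp
    qed
  qed
qed

section \<open>Linear operations on Bochner integrable functions\<close>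

lemma bochner_integrable_in_zero: "bochner_integrable_in (lebesgue_on S) V N 0"
proof -
  have N0: "N 0 = 0" using seminorm_zero[OF VN] by simp
  have 0: "(0 :: 'v) \<in> V" using subspace_0[OF seminorm_subspace[OF VN]] .
  have "bochner_integrable_in (lebesgue_on S) V N (\<lambda>_. 0)"
    unfolding bochner_integrable_in_def using N0 0
    by (intro conjI exI[of _ "\<lambda>k t. 0"]) simp_all
  then show ?thesis by (simp only: zero_fun_def)
qed

lemma bochner_integrable_in_add:
  assumes "bochner_integrable_in (lebesgue_on S) V N u" "bochner_integrable_in (lebesgue_on S) V N v"
  shows "bochner_integrable_in (lebesgue_on S) V N (u + v)"
proof -
  interpret finite_measure "lebesgue_on S" by (rule finite_measure_S)
  from assms(1) obtain s where u: "u \<in> space (lebesgue_on S) \<rightarrow> V"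
    and s: "\<And>k. simple_function (lebesgue_on S) (s k)" "\<And>k. s k \<in> space (lebesgue_on S) \<rightarrow> V"
    and lim: "AE t in lebesgue_on S. (\<lambda>k. N (u t - s k t)) \<longlonglongrightarrow> 0"
    and nn: "(\<lambda>k. \<integral>\<^sup>+t. ennreal (N (u t - s k t)) \<partial>lebesgue_on S) \<longlonglongrightarrow> 0"
    unfolding bochner_integrable_in_def by blast
  from assms(2) obtain s' where v: "v \<in> space (lebesgue_on S) \<rightarrow> V"
    and s': "\<And>k. simple_function (lebesgue_on S) (s' k)" "\<And>k. s' k \<in> space (lebesgue_on S) \<rightarrow> V"
    and lim': "AE t in lebesgue_on S. (\<lambda>k. N (v t - s' k t)) \<longlonglongrightarrow> 0"
    and nn': "(\<lambda>k. \<integral>\<^sup>+t. ennreal (N (v t - s' k t)) \<partial>lebesgue_on S) \<longlonglongrightarrow> 0"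
    unfolding bochner_integrable_in_def by blast
  have N0: "0 \<le> N x" if "x \<in> V" for x using seminorm_nonneg[OF VN _ that] by simp
  have add: "x + y \<in> V" if "x \<in> V" "y \<in> V" for x y
    using subspace_add[OF seminorm_subspace[OF VN] that] .
  have le: "N ((u + v) t - (s k + s' k) t) \<le> N (u t - s k t) + N (v t - s' k t)"
    and nonneg: "0 \<le> N ((u + v) t - (s k + s' k) t)" "0 \<le> N (u t - s k t)" "0 \<le> N (v t - s' k t)"
    if "t \<in> space (lebesgue_on S)" for t k
  proof -
    have V: "u t \<in> V" "v t \<in> V" "s k t \<in> V" "s' k t \<in> V" using that u v s(2)[of k] s'(2)[of k] by auto
    then have "N ((u t - s k t) + (v t - s' k t)) \<le> N (u t - s k t) + N (v t - s' k t)"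
      by (intro seminorm_triangle[OF VN] V_diff) auto
    then show "N ((u + v) t - (s k + s' k) t) \<le> N (u t - s k t) + N (v t - s' k t)"
      by (simp add: algebra_simps)
    show "0 \<le> N ((u + v) t - (s k + s' k) t)" "0 \<le> N (u t - s k t)" "0 \<le> N (v t - s' k t)"
      using V by (auto intro!: N0 V_diff add)
  qed
  have "AE t in lebesgue_on S. (\<lambda>k. N ((u + v) t - (s k + s' k) t)) \<longlonglongrightarrow> 0"
    using lim lim' AE_space
  proof eventually_elim
    case (elim t)
    have "norm (N ((u + v) t - (s k + s' k) t)) \<le> N (u t - s k t) + N (v t - s' k t)" for k
      using le[OF elim(3)] nonneg(1)[OF elim(3)] by simp
    moreover have "(\<lambda>k. N (u t - s k t) + N (v t - s' k t)) \<longlonglongrightarrow> 0"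
      using tendsto_add[OF elim(1,2)] by simp
    ultimately show ?case by (rule Lim_null_comparison[OF always_eventually[OF allI]])
  qed
  moreover have "(\<lambda>k. \<integral>\<^sup>+t. ennreal (N ((u + v) t - (s k + s' k) t)) \<partial>lebesgue_on S) \<longlonglongrightarrow> 0"
  proof (rule tendsto_sandwich[OF always_eventually always_eventually tendsto_const])
    have "(\<integral>\<^sup>+t. ennreal (N ((u + v) t - (s k + s' k) t)) \<partial>lebesgue_on S) \<le>
        (\<integral>\<^sup>+t. ennreal (N (u t - s k t)) + ennreal (N (v t - s' k t)) \<partial>lebesgue_on S)" for k
      using le nonneg by (intro nn_integral_mono) (simp flip: ennreal_plus)
    also have "(\<integral>\<^sup>+t. ennreal (N (u t - s k t)) + ennreal (N (v t - s' k t)) \<partial>lebesgue_on S) =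
        (\<integral>\<^sup>+t. ennreal (N (u t - s k t)) \<partial>lebesgue_on S) + (\<integral>\<^sup>+t. ennreal (N (v t - s' k t)) \<partial>lebesgue_on S)" for k
      using seminorm_diff_measurable[OF u s lim s(1)[of k] s(2)[of k]]
        seminorm_diff_measurable[OF v s' lim' s'(1)[of k] s'(2)[of k]]
      by (intro nn_integral_add) auto
    finally show "\<forall>k. (\<integral>\<^sup>+t. ennreal (N ((u + v) t - (s k + s' k) t)) \<partial>lebesgue_on S) \<le>
        (\<integral>\<^sup>+t. ennreal (N (u t - s k t)) \<partial>lebesgue_on S) + (\<integral>\<^sup>+t. ennreal (N (v t - s' k t)) \<partial>lebesgue_on S)" by blast
    show "(\<lambda>k. (\<integral>\<^sup>+t. ennreal (N (u t - s k t)) \<partial>lebesgue_on S) + (\<integral>\<^sup>+t. ennreal (N (v t - s' k t)) \<partial>lebesgue_on S)) \<longlonglongrightarrow> 0"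
      using tendsto_add[OF nn nn'] by simp
  qed simp
  moreover have "simple_function (lebesgue_on S) (s k + s' k)" for k
    using simple_function_compose2[OF s(1) s'(1), of "(+)" k k] by (simp add: plus_fun_def)
  moreover have "u + v \<in> space (lebesgue_on S) \<rightarrow> V" using u v by (auto intro!: add)
  moreover have "s k + s' k \<in> space (lebesgue_on S) \<rightarrow> V" for k using s(2)[of k] s'(2)[of k] by (auto intro!: add)
  ultimately show ?thesis
    unfolding bochner_integrable_in_def by (intro conjI exI[of _ "\<lambda>k. s k + s' k"] allI) auto
qed

lemma bochner_integrable_in_scaleR:
  assumes "bochner_integrable_in (lebesgue_on S) V N u"
  shows "bochner_integrable_in (lebesgue_on S) V N (c *\<^sub>R u)"
proof -
  interpret finite_measure "lebesgue_on S" by (rule finite_measure_S)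
  from assms obtain s where u: "u \<in> space (lebesgue_on S) \<rightarrow> V"
    and s: "\<And>k. simple_function (lebesgue_on S) (s k)" "\<And>k. s k \<in> space (lebesgue_on S) \<rightarrow> V"
    and lim: "AE t in lebesgue_on S. (\<lambda>k. N (u t - s k t)) \<longlonglongrightarrow> 0"
    and nn: "(\<lambda>k. \<integral>\<^sup>+t. ennreal (N (u t - s k t)) \<partial>lebesgue_on S) \<longlonglongrightarrow> 0"
    unfolding bochner_integrable_in_def by blast
  have N0: "0 \<le> N x" if "x \<in> V" for x using seminorm_nonneg[OF VN _ that] by simp
  have scale: "a *\<^sub>R x \<in> V" if "x \<in> V" for a x
    using subspace_scale[OF seminorm_subspace[OF VN] that] .
  have le: "N ((c *\<^sub>R u) t - (c *\<^sub>R s k) t) \<le> \<bar>c\<bar> * N (u t - s k t)"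
    and nonneg: "0 \<le> N ((c *\<^sub>R u) t - (c *\<^sub>R s k) t)" "0 \<le> N (u t - s k t)"
    if "t \<in> space (lebesgue_on S)" for t k
  proof -
    have V: "u t - s k t \<in> V" using that u s(2)[of k] by (intro V_diff) auto
    have "N (c *\<^sub>R (u t - s k t)) \<le> \<bar>c\<bar> * N (u t - s k t)" "0 \<le> N (c *\<^sub>R (u t - s k t))"
      using V by (auto intro!: seminorm_scaleR_le[OF VN] N0 scale)
    then show "N ((c *\<^sub>R u) t - (c *\<^sub>R s k) t) \<le> \<bar>c\<bar> * N (u t - s k t)"
      "0 \<le> N ((c *\<^sub>R u) t - (c *\<^sub>R s k) t)"
      by (simp_all add: scaleR_diff_right)
    show "0 \<le> N (u t - s k t)" using V by (rule N0)
  qed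
  have "AE t in lebesgue_on S. (\<lambda>k. N ((c *\<^sub>R u) t - (c *\<^sub>R s k) t)) \<longlonglongrightarrow> 0"
    using lim AE_space
  proof eventually_elim
    case (elim t)
    have "norm (N ((c *\<^sub>R u) t - (c *\<^sub>R s k) t)) \<le> \<bar>c\<bar> * N (u t - s k t)" for k
      using le[OF elim(2)] nonneg(1)[OF elim(2)] by simp
    then show ?case
      using tendsto_mult_right_zero[OF elim(1)] by (rule Lim_null_comparison[OF always_eventually[OF allI]])
  qed
  moreover have "(\<lambda>k. \<integral>\<^sup>+t. ennreal (N ((c *\<^sub>R u) t - (c *\<^sub>R s k) t)) \<partial>lebesgue_on S) \<longlonglongrightarrow> 0"
  proof (rule tendsto_sandwich[OF always_eventually always_eventually tendsto_const])
    have "(\<integral>\<^sup>+t. ennreal (N ((c *\<^sub>R u) t - (c *\<^sub>R s k) t)) \<partial>lebesgue_on S) \<le>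
        (\<integral>\<^sup>+t. ennreal \<bar>c\<bar> * ennreal (N (u t - s k t)) \<partial>lebesgue_on S)" for k
      using le nonneg by (intro nn_integral_mono) (simp flip: ennreal_mult)
    also have "(\<integral>\<^sup>+t. ennreal \<bar>c\<bar> * ennreal (N (u t - s k t)) \<partial>lebesgue_on S) =
        ennreal \<bar>c\<bar> * (\<integral>\<^sup>+t. ennreal (N (u t - s k t)) \<partial>lebesgue_on S)" for k
      using seminorm_diff_measurable[OF u s lim s(1)[of k] s(2)[of k]]
      by (intro nn_integral_cmult) auto
    finally show "\<forall>k. (\<integral>\<^sup>+t. ennreal (N ((c *\<^sub>R u) t - (c *\<^sub>R s k) t)) \<partial>lebesgue_on S) \<le>
        ennreal \<bar>c\<bar> * (\<integral>\<^sup>+t. ennreal (N (u t - s k t)) \<partial>lebesgue_on S)" by blast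
    show "(\<lambda>k. ennreal \<bar>c\<bar> * (\<integral>\<^sup>+t. ennreal (N (u t - s k t)) \<partial>lebesgue_on S)) \<longlonglongrightarrow> 0"
      using ennreal_tendsto_cmult[OF _ nn, of "ennreal \<bar>c\<bar>"] by simp
  qed simp
  moreover have "simple_function (lebesgue_on S) (c *\<^sub>R s k)" for k
    using simple_function_compose1[OF s(1), of "\<lambda>x. c *\<^sub>R x" k] by (simp add: scaleR_fun_def)
  moreover have "c *\<^sub>R u \<in> space (lebesgue_on S) \<rightarrow> V" using u by (auto intro!: scale)
  moreover have "c *\<^sub>R s k \<in> space (lebesgue_on S) \<rightarrow> V" for k using s(2)[of k] by (auto intro!: scale)
  ultimately show ?thesis
    unfolding bochner_integrable_in_def by (intro conjI exI[of _ "\<lambda>k. c *\<^sub>R s k"] allI) auto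
qed

end

section \<open>The spaces of time-dependent maps\<close>

lemma seminorm_family_C0_hoelder:
  assumes "0 < \<alpha>" "\<alpha> \<le> 1"
  shows "seminorm_family (C0_hoelder n \<alpha>) {hoelder_norm n \<alpha>}"
  using assms unfolding seminorm_family_def
  by (auto simp: hoelder_norm_nonneg hoelder_norm_triangle hoelder_norm_scaleR_le
      intro!: subspaceI zero_C0_hoelder C0_hoelder_add C0_hoelder_scaleR)

lemma C0_minus_D: "f \<in> C0_minus n \<beta> \<Longrightarrow> \<alpha> \<in> {0<..<\<beta>} \<Longrightarrow> f \<in> C0_hoelder n \<alpha>"
  by (auto simp: C0_minus_def)

lemma seminorm_family_C0_minus:
  assumes "0 < \<beta>" "\<beta> \<le> 1"
  shows "seminorm_family (C0_minus n \<beta>) (C0_minus_seminorms n \<beta>)"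
proof -
  have "subspace (C0_minus n \<beta>)"
    unfolding C0_minus_def
  proof (rule subspace_Inter, safe)
    fix \<alpha> assume "\<alpha> \<in> {0<..<\<beta>}"
    then show "subspace (C0_hoelder n \<alpha>)"
      using assms seminorm_subspace[OF seminorm_family_C0_hoelder[of \<alpha> n]] by auto
  qed
  moreover have "{0<..<\<beta>} \<noteq> {}" using assms dense by auto
  ultimately show ?thesis
    unfolding seminorm_family_def C0_minus_seminorms_def using assms
    by (auto simp: hoelder_norm_triangle hoelder_norm_scaleR_le
        dest!: C0_minus_D intro!: hoelder_norm_nonneg)
qed

section \<open>Seminorms on integrable and on continuous time-dependent maps\<close>

definition L1_seminorm :: "nat \<Rightarrow> real \<Rightarrow> (real \<Rightarrow> 'a::euclidean_space \<Rightarrow> 'a) \<Rightarrow> real" where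
  "L1_seminorm n \<alpha> u = (\<integral>t. hoelder_norm n \<alpha> (u t) \<partial>(lebesgue_on {0..1}))"

lemma L1_C0_seminorms_eq: "L1_C0_seminorms n \<beta> = L1_seminorm n ` {0<..<\<beta>}"
  by (simp add: L1_C0_seminorms_def L1_seminorm_def[abs_def])

lemma L1_C0_D:
  assumes "u \<in> L1_C0 n \<beta>" "\<alpha> \<in> {0<..<\<beta>}"
  shows "t \<in> {0..1} \<Longrightarrow> u t \<in> C0_hoelder n \<alpha>"
    and "bochner_integrable_in (lebesgue_on {0..1}) (C0_hoelder n \<alpha>) (hoelder_norm n \<alpha>) u"
  using assms C0_minus_D unfolding L1_C0_def by blast+

lemma L1_C0_integrable:
  assumes "u \<in> L1_C0 n \<beta>" "\<alpha> \<in> {0<..<\<beta>}" "\<beta> \<le> 1"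
  shows "integrable (lebesgue_on {0..1}) (\<lambda>t. hoelder_norm n \<alpha> (u t))"
  using assms by (intro bochner_integrable_in_seminorm[OF seminorm_family_C0_hoelder]) (auto intro: L1_C0_D(2))

lemma L1_seminorm_eq_integral:
  assumes "u \<in> L1_C0 n \<beta>" "\<alpha> \<in> {0<..<\<beta>}" "\<beta> \<le> 1"
  shows "L1_seminorm n \<alpha> u = integral {0..1} (\<lambda>t. hoelder_norm n \<alpha> (u t))"
  unfolding L1_seminorm_def by (intro lebesgue_integral_eq_integral L1_C0_integrable[OF assms]) simp

lemma seminorm_family_L1_C0:
  assumes \<beta>: "0 < \<beta>" "\<beta> \<le> 1"
  shows "seminorm_family (L1_C0 n \<beta> :: (real \<Rightarrow> 'a::euclidean_space \<Rightarrow> 'a) set) (L1_C0_seminorms n \<beta>)"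
proof -
  let ?V = "L1_C0 n \<beta> :: (real \<Rightarrow> 'a \<Rightarrow> 'a) set"
  have sub: "subspace (C0_minus n \<beta> :: ('a \<Rightarrow> 'a) set)"
    using seminorm_family_C0_minus[OF \<beta>] by (rule seminorm_subspace)
  have fam: "seminorm_family (C0_hoelder n \<alpha> :: ('a \<Rightarrow> 'a) set) {hoelder_norm n \<alpha>}" if "\<alpha> \<in> {0<..<\<beta>}" for \<alpha>
    using that \<beta> by (intro seminorm_family_C0_hoelder) auto
  have S: "{0..1::real} \<in> lmeasurable" by simp
  have "subspace ?V"
  proof (rule subspaceI)
    show "0 \<in> ?V"
      using subspace_0[OF sub] bochner_integrable_in_zero[OF fam S] by (simp add: L1_C0_def)
    show "u + v \<in> ?V" if "u \<in> ?V" "v \<in> ?V" for u v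
      using that subspace_add[OF sub] bochner_integrable_in_add[OF fam S] by (simp add: L1_C0_def)
    show "c *\<^sub>R u \<in> ?V" if "u \<in> ?V" for c u
      using that subspace_scale[OF sub] bochner_integrable_in_scaleR[OF fam S] by (simp add: L1_C0_def)
  qed
  note add = subspace_add[OF this] and scale = subspace_scale[OF this]
  have "{0<..<\<beta>} \<noteq> {}" using \<beta> dense by auto
  moreover have "0 \<le> L1_seminorm n \<alpha> u" if "u \<in> ?V" "\<alpha> \<in> {0<..<\<beta>}" for u \<alpha>
    unfolding L1_seminorm_def using that
    by (intro Bochner_Integration.integral_nonneg hoelder_norm_nonneg) (auto intro: L1_C0_D(1))
  moreover have "L1_seminorm n \<alpha> (u + v) \<le> L1_seminorm n \<alpha> u + L1_seminorm n \<alpha> v"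
    if "u \<in> ?V" "v \<in> ?V" "\<alpha> \<in> {0<..<\<beta>}" for u v \<alpha>
  proof -
    note int = L1_C0_integrable[OF _ that(3) \<beta>(2)]
    have "L1_seminorm n \<alpha> (u + v) \<le>
        (\<integral>t. hoelder_norm n \<alpha> (u t) + hoelder_norm n \<alpha> (v t) \<partial>(lebesgue_on {0..1}))"
      unfolding L1_seminorm_def
    proof (rule integral_mono)
      show "integrable (lebesgue_on {0..1}) (\<lambda>t. hoelder_norm n \<alpha> ((u + v) t))"
        using that by (intro int add)
      show "integrable (lebesgue_on {0..1}) (\<lambda>t. hoelder_norm n \<alpha> (u t) + hoelder_norm n \<alpha> (v t))"
        using that by (intro Bochner_Integration.integrable_add int)
      fix t :: real assume "t \<in> space (lebesgue_on {0..1})"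
      then show "hoelder_norm n \<alpha> ((u + v) t) \<le> hoelder_norm n \<alpha> (u t) + hoelder_norm n \<alpha> (v t)"
        using L1_C0_D(1)[OF that(1,3), of t] L1_C0_D(1)[OF that(2,3), of t] that(3) \<beta>
        by (simp add: hoelder_norm_triangle)
    qed
    also have "\<dots> = L1_seminorm n \<alpha> u + L1_seminorm n \<alpha> v"
      unfolding L1_seminorm_def using that by (intro Bochner_Integration.integral_add int)
    finally show ?thesis .
  qed
  moreover have "L1_seminorm n \<alpha> (c *\<^sub>R u) \<le> \<bar>c\<bar> * L1_seminorm n \<alpha> u"
    if "u \<in> ?V" "\<alpha> \<in> {0<..<\<beta>}" for c u \<alpha>
  proof -
    note int = L1_C0_integrable[OF _ that(2) \<beta>(2)]
    have "L1_seminorm n \<alpha> (c *\<^sub>R u) \<le> (\<integral>t. \<bar>c\<bar> * hoelder_norm n \<alpha> (u t) \<partial>(lebesgue_on {0..1}))"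
      unfolding L1_seminorm_def
    proof (rule integral_mono)
      show "integrable (lebesgue_on {0..1}) (\<lambda>t. hoelder_norm n \<alpha> ((c *\<^sub>R u) t))"
        using that by (intro int scale)
      show "integrable (lebesgue_on {0..1}) (\<lambda>t. \<bar>c\<bar> * hoelder_norm n \<alpha> (u t))"
        using int[OF that(1)] by simp
      fix t :: real assume "t \<in> space (lebesgue_on {0..1})"
      then show "hoelder_norm n \<alpha> ((c *\<^sub>R u) t) \<le> \<bar>c\<bar> * hoelder_norm n \<alpha> (u t)"
        using L1_C0_D(1)[OF that, of t] that(2) \<beta> by (simp add: hoelder_norm_scaleR_le)
    qed
    also have "\<dots> = \<bar>c\<bar> * L1_seminorm n \<alpha> u" by (simp add: L1_seminorm_def)
    finally show ?thesis .
  qed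
  ultimately show ?thesis
    using \<open>subspace ?V\<close> unfolding seminorm_family_def L1_C0_seminorms_eq by auto
qed

definition CI_seminorm :: "nat \<Rightarrow> real \<Rightarrow> (real \<Rightarrow> 'a::euclidean_space \<Rightarrow> 'a) \<Rightarrow> real" where
  "CI_seminorm n \<alpha> g = (SUP t\<in>{0..1}. hoelder_norm n \<alpha> (g t))"

lemma CI_C0_seminorms_eq: "CI_C0_seminorms n \<beta> = CI_seminorm n ` {0<..<\<beta>}"
  by (simp add: CI_C0_seminorms_def CI_seminorm_def[abs_def])

lemma CI_C0_iff:
  assumes "0 < \<beta>" "\<beta> \<le> 1"
  shows "g \<in> CI_C0 n \<beta> \<longleftrightarrow> (\<forall>t\<in>{0..1}. g t \<in> C0_minus n \<beta>) \<and>
    (\<forall>t\<in>{0..1}. \<forall>\<alpha>\<in>{0<..<\<beta>}. \<forall>e>0. \<exists>d>0. \<forall>s\<in>{0..1}. dist s t < d \<longrightarrow> hoelder_norm n \<alpha> (g s - g t) < e)"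
  unfolding CI_C0_def mem_Collect_eq continuous_map_top_of_set_lcs_iff[OF seminorm_family_C0_minus[OF assms]]
  by (simp add: C0_minus_seminorms_def)

text \<open>Makes the supremum in \<open>CI_seminorm\<close> meaningful: by the reverse triangle
  inequality the norm is a continuous function of time on a compact interval.\<close>

lemma CI_C0_bdd:
  assumes \<beta>: "0 < \<beta>" "\<beta> \<le> 1" and g: "g \<in> CI_C0 n \<beta>" and \<alpha>: "\<alpha> \<in> {0<..<\<beta>}"
  shows "bdd_above ((\<lambda>t. hoelder_norm n \<alpha> (g t)) ` {0..1})"
proof -
  have V: "g t \<in> C0_hoelder n \<alpha>" if "t \<in> {0..1}" for t
    using g that \<alpha> CI_C0_iff[OF \<beta>] C0_minus_D by blast
  have fam: "seminorm_family (C0_hoelder n \<alpha> :: ('a \<Rightarrow> 'a) set) {hoelder_norm n \<alpha>}"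
    using \<alpha> \<beta> by (intro seminorm_family_C0_hoelder) auto
  have "continuous_on {0..1} (\<lambda>t. hoelder_norm n \<alpha> (g t))"
    unfolding continuous_on_iff
  proof (intro ballI allI impI)
    fix t e :: real assume t: "t \<in> {0..1}" and "0 < e"
    then obtain d where d: "0 < d" "\<forall>s\<in>{0..1}. dist s t < d \<longrightarrow> hoelder_norm n \<alpha> (g s - g t) < e"
      using g \<alpha> unfolding CI_C0_iff[OF \<beta>] by blast
    have "dist (hoelder_norm n \<alpha> (g s)) (hoelder_norm n \<alpha> (g t)) \<le> hoelder_norm n \<alpha> (g s - g t)"
      if s: "s \<in> {0..1}" for s
      using seminorm_diff_le[OF fam _ V[OF s] V[OF t]] seminorm_diff_le[OF fam _ V[OF t] V[OF s]]
        seminorm_minus_commute[OF fam _ V[OF t] V[OF s]] by (simp add: dist_real_def abs_le_iff)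
    then show "\<exists>d>0. \<forall>s\<in>{0..1}. dist s t < d \<longrightarrow> dist (hoelder_norm n \<alpha> (g s)) (hoelder_norm n \<alpha> (g t)) < e"
      using d by (meson le_less_trans)
  qed
  then show ?thesis
    by (intro bounded_imp_bdd_above compact_imp_bounded compact_continuous_image) auto
qed

lemma hoelder_norm_le_CI_seminorm:
  assumes "0 < \<beta>" "\<beta> \<le> 1" "g \<in> CI_C0 n \<beta>" "\<alpha> \<in> {0<..<\<beta>}" "t \<in> {0..1}"
  shows "hoelder_norm n \<alpha> (g t) \<le> CI_seminorm n \<alpha> g"
  unfolding CI_seminorm_def using assms by (intro cSUP_upper CI_C0_bdd) auto

lemma CI_seminorm_le:
  assumes "\<And>t. t \<in> {0..1} \<Longrightarrow> hoelder_norm n \<alpha> (g t) \<le> B"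
  shows "CI_seminorm n \<alpha> g \<le> B"
  unfolding CI_seminorm_def using assms by (intro cSUP_least) auto

lemma seminorm_family_CI_C0:
  assumes \<beta>: "0 < \<beta>" "\<beta> \<le> 1"
  shows "seminorm_family (CI_C0 n \<beta> :: (real \<Rightarrow> 'a::euclidean_space \<Rightarrow> 'a) set) (CI_C0_seminorms n \<beta>)"
proof -
  let ?V = "CI_C0 n \<beta> :: (real \<Rightarrow> 'a \<Rightarrow> 'a) set"
  note iff = CI_C0_iff[OF \<beta>]
  have fam: "seminorm_family (C0_minus n \<beta> :: ('a \<Rightarrow> 'a) set) (C0_minus_seminorms n \<beta>)"
    using \<beta> by (rule seminorm_family_C0_minus)
  note sub = seminorm_subspace[OF fam]
  have P: "hoelder_norm n \<alpha> \<in> C0_minus_seminorms n \<beta>" if "\<alpha> \<in> {0<..<\<beta>}" for \<alpha>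
    using that by (simp add: C0_minus_seminorms_def)
  have mem: "g t \<in> C0_minus n \<beta>" if "g \<in> ?V" "t \<in> {0..1}" for g t using that iff by blast
  have 0: "0 \<in> ?V"
    unfolding iff using subspace_0[OF sub] seminorm_zero[OF fam P] by (auto intro!: exI[of _ 1])
  have add: "g + h \<in> ?V" if g: "g \<in> ?V" and h: "h \<in> ?V" for g h
    unfolding iff
  proof (intro conjI ballI allI impI)
    show "(g + h) t \<in> C0_minus n \<beta>" if "t \<in> {0..1}" for t
      using subspace_add[OF sub mem[OF g that] mem[OF h that]] by simp
    fix t \<alpha> e :: real assume t: "t \<in> {0..1}" and \<alpha>: "\<alpha> \<in> {0<..<\<beta>}" and e: "0 < e"
    obtain d where d: "0 < d" "\<forall>s\<in>{0..1}. dist s t < d \<longrightarrow> hoelder_norm n \<alpha> (g s - g t) < e / 2"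
      using g[unfolded iff] t \<alpha> half_gt_zero[OF e] by blast
    obtain d' where d': "0 < d'" "\<forall>s\<in>{0..1}. dist s t < d' \<longrightarrow> hoelder_norm n \<alpha> (h s - h t) < e / 2"
      using h[unfolded iff] t \<alpha> half_gt_zero[OF e] by blast
    have "hoelder_norm n \<alpha> ((g + h) s - (g + h) t) < e" if s: "s \<in> {0..1}" "dist s t < min d d'" for s
    proof -
      have "hoelder_norm n \<alpha> ((g s - g t) + (h s - h t)) \<le> hoelder_norm n \<alpha> (g s - g t) + hoelder_norm n \<alpha> (h s - h t)"
        using g h s t by (intro seminorm_triangle[OF fam P[OF \<alpha>]] subspace_diff[OF sub] mem)
      moreover have "(g s - g t) + (h s - h t) = (g + h) s - (g + h) t" by simp
      ultimately show ?thesis using d(2) d'(2) s by fastforce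
    qed
    then show "\<exists>d>0. \<forall>s\<in>{0..1}. dist s t < d \<longrightarrow> hoelder_norm n \<alpha> ((g + h) s - (g + h) t) < e"
      using d(1) d'(1) by (intro exI[of _ "min d d'"]) auto
  qed
  have scale: "c *\<^sub>R g \<in> ?V" if g: "g \<in> ?V" for c g
    unfolding iff
  proof (intro conjI ballI allI impI)
    show "(c *\<^sub>R g) t \<in> C0_minus n \<beta>" if "t \<in> {0..1}" for t
      using subspace_scale[OF sub mem[OF g that]] by simp
    fix t \<alpha> e :: real assume t: "t \<in> {0..1}" and \<alpha>: "\<alpha> \<in> {0<..<\<beta>}" and e: "0 < e"
    have "0 < e / (\<bar>c\<bar> + 1)" using e by (simp add: add_nonneg_pos)
    then obtain d where d: "0 < d" "\<forall>s\<in>{0..1}. dist s t < d \<longrightarrow> hoelder_norm n \<alpha> (g s - g t) < e / (\<bar>c\<bar> + 1)"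
      using g[unfolded iff] t \<alpha> by blast
    have "hoelder_norm n \<alpha> ((c *\<^sub>R g) s - (c *\<^sub>R g) t) < e" if s: "s \<in> {0..1}" "dist s t < d" for s
    proof -
      have "hoelder_norm n \<alpha> (c *\<^sub>R (g s - g t)) \<le> \<bar>c\<bar> * hoelder_norm n \<alpha> (g s - g t)"
        using g s t by (intro seminorm_scaleR_le[OF fam P[OF \<alpha>]] subspace_diff[OF sub] mem)
      also have "\<dots> \<le> \<bar>c\<bar> * (e / (\<bar>c\<bar> + 1))"
        using d s by (intro mult_left_mono) auto
      also have "\<dots> < e" using e by (simp add: field_simps)
      finally show ?thesis by (simp add: scaleR_diff_right)
    qed
    then show "\<exists>d>0. \<forall>s\<in>{0..1}. dist s t < d \<longrightarrow> hoelder_norm n \<alpha> ((c *\<^sub>R g) s - (c *\<^sub>R g) t) < e"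
      using d(1) by blast
  qed
  have "subspace ?V" using 0 add scale by (rule subspaceI)
  moreover have "{0<..<\<beta>} \<noteq> {}" using \<beta> dense by auto
  moreover have "0 \<le> CI_seminorm n \<alpha> g" if "g \<in> ?V" "\<alpha> \<in> {0<..<\<beta>}" for g \<alpha>
    using seminorm_nonneg[OF fam P[OF that(2)] mem[OF that(1), of 0]]
      hoelder_norm_le_CI_seminorm[OF \<beta> that, of 0] by simp
  moreover have "CI_seminorm n \<alpha> (g + h) \<le> CI_seminorm n \<alpha> g + CI_seminorm n \<alpha> h"
    if "g \<in> ?V" "h \<in> ?V" "\<alpha> \<in> {0<..<\<beta>}" for g h \<alpha>
  proof (rule CI_seminorm_le)
    fix t :: real assume t: "t \<in> {0..1}"
    have "hoelder_norm n \<alpha> (g t + h t) \<le> hoelder_norm n \<alpha> (g t) + hoelder_norm n \<alpha> (h t)"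
      using that t by (intro seminorm_triangle[OF fam P] mem)
    also have "\<dots> \<le> CI_seminorm n \<alpha> g + CI_seminorm n \<alpha> h"
      using that t by (intro add_mono hoelder_norm_le_CI_seminorm[OF \<beta>])
    finally show "hoelder_norm n \<alpha> ((g + h) t) \<le> CI_seminorm n \<alpha> g + CI_seminorm n \<alpha> h" by simp
  qed
  moreover have "CI_seminorm n \<alpha> (c *\<^sub>R g) \<le> \<bar>c\<bar> * CI_seminorm n \<alpha> g"
    if "g \<in> ?V" "\<alpha> \<in> {0<..<\<beta>}" for c g \<alpha>
  proof (rule CI_seminorm_le)
    fix t :: real assume t: "t \<in> {0..1}"
    have "hoelder_norm n \<alpha> (c *\<^sub>R g t) \<le> \<bar>c\<bar> * hoelder_norm n \<alpha> (g t)"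
      using that t by (intro seminorm_scaleR_le[OF fam P] mem)
    also have "\<dots> \<le> \<bar>c\<bar> * CI_seminorm n \<alpha> g"
      using that t by (intro mult_left_mono hoelder_norm_le_CI_seminorm[OF \<beta>]) auto
    finally show "hoelder_norm n \<alpha> ((c *\<^sub>R g) t) \<le> \<bar>c\<bar> * CI_seminorm n \<alpha> g" by simp
  qed
  ultimately show ?thesis
    unfolding seminorm_family_def CI_C0_seminorms_eq by auto
qed

text \<open>Supplies the measurability hypothesis of \<open>hoelder_field\<close>. A simple
  approximation takes finitely many values, each a continuous function, so its evaluation along y is
  measurable; convergence in the Hoelder norm implies convergence of the evaluations.\<close>

lemma L1_C0_measurable:
  assumes u: "u \<in> L1_C0 n \<beta>" and \<alpha>: "\<alpha> \<in> {0<..<\<beta>}" and \<beta>: "\<beta> \<le> 1"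
    and ab: "0 \<le> a" "b \<le> 1" and y: "continuous_on {a..b} y"
  shows "(\<lambda>s. u s (y s)) \<in> borel_measurable (lebesgue_on {a..b})"
proof -
  have \<alpha>1: "0 < \<alpha>" "\<alpha> \<le> 1" using \<alpha> \<beta> by auto
  let ?M = "lebesgue_on {0..1::real}"
  have sub: "{a..b} \<subseteq> {0..1}" using ab by auto
  obtain s where s: "\<And>k. simple_function ?M (s k)" "\<And>k. s k \<in> space ?M \<rightarrow> C0_hoelder n \<alpha>"
    and lim: "AE t in ?M. (\<lambda>k. hoelder_norm n \<alpha> (u t - s k t)) \<longlonglongrightarrow> 0"
    using L1_C0_D(2)[OF u \<alpha>] unfolding bochner_integrable_in_def by blast
  show ?thesis
  proof (rule borel_measurable_AE_limit)
    show "(\<lambda>t. s k t (y t)) \<in> borel_measurable (lebesgue_on {a..b})" for k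
    proof (rule measurable_compose_countable'[where I = "s k ` {0..1}" and f = "\<lambda>f t. f (y t)"])
      fix f assume "f \<in> s k ` {0..1}"
      then have "f \<in> C0_hoelder n \<alpha>" using s(2)[of k] by auto
      then have "continuous_on UNIV f"
        using C0_hoelder_imp_hoelder_le hoelder_le_continuous \<alpha>1 by blast
      then have "continuous_on {a..b} (\<lambda>t. f (y t))"
        using y by (rule continuous_on_compose2) simp
      then show "(\<lambda>t. f (y t)) \<in> borel_measurable (lebesgue_on {a..b})"
        by (rule continuous_imp_measurable_on_sets_lebesgue) simp
    next
      have fin: "finite (s k ` {0..1})" using simple_functionD(1)[OF s(1)] by simp
      then show "countable (s k ` {0..1})" by (rule countable_finite)
      have "s k \<in> measurable ?M (count_space (s k ` {0..1}))"
        using fin simple_functionD(2)[OF s(1)] by (simp add: measurable_count_space_eq2)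
      then show "s k \<in> measurable (lebesgue_on {a..b}) (count_space (s k ` {0..1}))"
        using sub by (rule measurable_restrict_mono)
    qed
    have "AE t in lebesgue_on {0..1}. (\<lambda>k. s k t (z t)) \<longlonglongrightarrow> u t (z t)" for z
      using lim AE_space
    proof eventually_elim
      case (elim t)
      then have V: "u t \<in> C0_hoelder n \<alpha>" "s k t \<in> C0_hoelder n \<alpha>" for k
        using L1_C0_D(1)[OF u \<alpha>] s(2)[of k] by auto
      have "u t - s k t \<in> C0_hoelder n \<alpha>" for k
        using V by (intro subspace_diff[OF seminorm_subspace[OF seminorm_family_C0_hoelder[OF \<alpha>1]]])
      from hoelder_le_norm[OF C0_hoelder_imp_hoelder_le[OF this]]
      have "norm (s k t (z t) - u t (z t)) \<le> hoelder_norm n \<alpha> (u t - s k t)" for k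
        by (simp add: norm_minus_commute)
      then have "(\<lambda>k. s k t (z t) - u t (z t)) \<longlonglongrightarrow> 0"
        using elim(1) by (rule Lim_null_comparison[OF always_eventually[OF allI]])
      then show ?case by (rule LIM_zero_cancel)
    qed
    then have "AE t in lebesgue. t \<in> {0..1} \<longrightarrow> (\<lambda>k. s k t (y t)) \<longlonglongrightarrow> u t (y t)"
      by (simp add: AE_restrict_space_iff)
    then have "AE t in lebesgue. t \<in> {a..b} \<longrightarrow> (\<lambda>k. s k t (y t)) \<longlonglongrightarrow> u t (y t)"
      by eventually_elim (use sub in blast)
    then show "AE t in lebesgue_on {a..b}. (\<lambda>k. s k t (y t)) \<longlonglongrightarrow> u t (y t)"
      by (simp add: AE_restrict_space_iff)
  qed simp
qed

lemma L1_C0_hoelder_field: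
  assumes "u \<in> L1_C0 n \<beta>" "\<alpha> \<in> {0<..<\<beta>}" "\<beta> \<le> 1" "1 \<le> n"
  shows "hoelder_field n \<alpha> u (\<lambda>t. hoelder_norm n \<alpha> (u t))"
proof
  show "(\<lambda>t. hoelder_norm n \<alpha> (u t)) integrable_on {0..1}"
    using L1_C0_integrable[OF assms(1-3)] by (rule integrable_on_lebesgue_on) simp
  show "hoelder_le n \<alpha> (hoelder_norm n \<alpha> (u t)) (u t)" if "t \<in> {0..1}" for t
    using L1_C0_D(1)[OF assms(1,2) that] by (rule C0_hoelder_imp_hoelder_le)
  show "(\<lambda>s. u s (z s)) \<in> borel_measurable (lebesgue_on {a..b})"
    if "0 \<le> a" "b \<le> 1" "continuous_on {a..b} z" for a b z
    using assms(1-3) that by (rule L1_C0_measurable)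
qed (use assms in auto)

section \<open>The flow map\<close>

text \<open>A version for the norm itself that includes \<epsilon> = 0, where f vanishes and 0 powr
  \<gamma> is 0. The range E + 1 covers E = 0.\<close>

lemma hoelder_norm_interpolation:
  assumes "0 < \<alpha>" "\<alpha> < \<alpha>'" "\<alpha>' \<le> 1" "0 \<le> K" "0 \<le> E"
  obtains C \<gamma> where "0 < C" "0 < \<gamma>"
    "\<And>\<epsilon> (f :: 'a::euclidean_space \<Rightarrow> 'a). hoelder_le n \<alpha>' K f \<Longrightarrow> 0 \<le> \<epsilon> \<Longrightarrow> \<epsilon> \<le> E \<Longrightarrow>
      (\<And>x. norm (f x) \<le> \<epsilon>) \<Longrightarrow> hoelder_norm n \<alpha> f \<le> C * \<epsilon> powr \<gamma>"
proof -
  have "0 < E + 1" using \<open>0 \<le> E\<close> by simp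
  then obtain C \<gamma> where "0 < C" "0 < \<gamma>" and
    C: "\<And>\<epsilon> (f :: 'a \<Rightarrow> 'a). hoelder_le n \<alpha>' K f \<Longrightarrow> 0 < \<epsilon> \<Longrightarrow> \<epsilon> \<le> E + 1 \<Longrightarrow>
      (\<And>x. norm (f x) \<le> \<epsilon>) \<Longrightarrow> hoelder_le n \<alpha> (C * \<epsilon> powr \<gamma>) f"
    using hoelder_le_interpolation[OF assms(1-4), of "E + 1" n, where ?'a = 'a and ?'b = 'a] by blast
  show ?thesis
  proof (rule that[OF \<open>0 < C\<close> \<open>0 < \<gamma>\<close>])
    fix \<epsilon> and f :: "'a \<Rightarrow> 'a"
    assume f: "hoelder_le n \<alpha>' K f" and \<epsilon>: "0 \<le> \<epsilon>" "\<epsilon> \<le> E" and le: "\<And>x. norm (f x) \<le> \<epsilon>"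
    have "hoelder_le n \<alpha> (C * \<epsilon> powr \<gamma>) f"
    proof (cases "\<epsilon> = 0")
      case True
      then have "f = (\<lambda>_. 0)" using le by auto
      then show ?thesis using hoelder_le_const[of "0 :: 'a" 0 n \<alpha>] True by simp
    next
      case False
      then show ?thesis using \<epsilon> le by (intro C[OF f]) auto
    qed
    then show "hoelder_norm n \<alpha> f \<le> C * \<epsilon> powr \<gamma>"
      using assms by (intro hoelder_norm_le) auto
  qed
qed

lemma powr_small:
  fixes C \<gamma> e :: real
  assumes "0 < C" "0 < \<gamma>" "0 < e"
  shows "\<exists>\<eta>>0. \<forall>\<epsilon>\<ge>0. \<epsilon> < \<eta> \<longrightarrow> C * \<epsilon> powr \<gamma> < e"
proof (intro exI[of _ "(e / C) powr (1 / \<gamma>)"] conjI allI impI)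
  fix \<epsilon> :: real assume "0 \<le> \<epsilon>" "\<epsilon> < (e / C) powr (1 / \<gamma>)"
  then have "\<epsilon> powr \<gamma> < ((e / C) powr (1 / \<gamma>)) powr \<gamma>"
    using assms by (intro powr_less_mono2) auto
  then show "C * \<epsilon> powr \<gamma> < e" using assms by (simp add: powr_powr field_simps)
qed (use assms in auto)

lemma L1_C0_solves:
  assumes "u \<in> L1_C0 n \<beta>" "0 < \<beta>" "\<beta> \<le> 1" "1 \<le> n"
  shows "Lipschitz_field.solves u x (\<lambda>t. flow u t x)"
proof -
  obtain \<alpha> where \<alpha>: "\<alpha> \<in> {0<..<\<beta>}" using dense[OF assms(2)] by auto
  interpret hoelder_field n \<alpha> u "\<lambda>t. hoelder_norm n \<alpha> (u t)"
    using assms \<alpha> by (intro L1_C0_hoelder_field)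
  show ?thesis by (rule solves_flow)
qed

lemma L1_C0_flow_bound:
  assumes n: "1 \<le> n" and \<alpha>: "\<alpha> \<in> {0<..<\<beta>}" and \<beta>: "\<beta> \<le> 1"
  obtains K where "0 \<le> K"
    "\<And>(u :: real \<Rightarrow> 'a::euclidean_space \<Rightarrow> 'a) t. u \<in> L1_C0 n \<beta> \<Longrightarrow> L1_seminorm n \<alpha> u \<le> R \<Longrightarrow>
      t \<in> {0..1} \<Longrightarrow> hoelder_le n \<alpha> K (\<lambda>x. flow u t x - x)"
proof -
  have \<alpha>1: "0 < \<alpha>" "\<alpha> \<le> 1" and "0 < \<beta>" using \<alpha> \<beta> by auto
  obtain K where "0 \<le> K" and K: "\<And>(u :: real \<Rightarrow> 'a \<Rightarrow> 'a) k \<Phi> t. hoelder_field n \<alpha> u k \<Longrightarrow>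
      integral {0..1} k \<le> R \<Longrightarrow> (\<forall>x. Lipschitz_field.solves u x (\<lambda>t. \<Phi> t x)) \<Longrightarrow> t \<in> {0..1} \<Longrightarrow>
      hoelder_le n \<alpha> K (\<lambda>x. \<Phi> t x - x)"
    using flow_hoelder_bound[OF n \<alpha>1, of R, where ?'a = 'a] by blast
  show ?thesis
  proof (rule that[OF \<open>0 \<le> K\<close>])
    fix u :: "real \<Rightarrow> 'a \<Rightarrow> 'a" and t :: real
    assume u: "u \<in> L1_C0 n \<beta>" and R: "L1_seminorm n \<alpha> u \<le> R" and t: "t \<in> {0..1}"
    show "hoelder_le n \<alpha> K (\<lambda>x. flow u t x - x)"
      using L1_C0_solves[OF u \<open>0 < \<beta>\<close> \<beta> n] R
      by (intro K[OF L1_C0_hoelder_field[OF u \<alpha> \<beta> n] _ _ t]) (auto simp: L1_seminorm_eq_integral[OF u \<alpha> \<beta>])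
  qed
qed

lemma L1_C0_flow_hoelder_le:
  fixes u :: "real \<Rightarrow> 'a::euclidean_space \<Rightarrow> 'a"
  assumes "1 \<le> n" "\<alpha> \<in> {0<..<\<beta>}" "\<beta> \<le> 1" and u: "u \<in> L1_C0 n \<beta>"
  shows "\<exists>K\<ge>0. \<forall>t\<in>{0..1}. hoelder_le n \<alpha> K (\<lambda>x. flow u t x - x)"
proof -
  obtain K where "0 \<le> K" and "\<And>(v :: real \<Rightarrow> 'a \<Rightarrow> 'a) t. v \<in> L1_C0 n \<beta> \<Longrightarrow>
      L1_seminorm n \<alpha> v \<le> L1_seminorm n \<alpha> u \<Longrightarrow> t \<in> {0..1} \<Longrightarrow> hoelder_le n \<alpha> K (\<lambda>x. flow v t x - x)"
    using L1_C0_flow_bound[OF assms(1-3), of "L1_seminorm n \<alpha> u", where ?'a = 'a] by blast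
  then show ?thesis using u by blast
qed

lemma flow_minus_id: "(\<lambda>x. flow u t x - x) = flow u t - id"
  by (simp add: fun_eq_iff)

lemma flow_minus_id_in_C0_hoelder:
  fixes u :: "real \<Rightarrow> 'a::euclidean_space \<Rightarrow> 'a"
  assumes n: "1 \<le> n" and A: "\<alpha> \<in> {0<..<\<beta>}" and \<beta>: "\<beta> \<le> 1" and u: "u \<in> L1_C0 n \<beta>" and t: "t \<in> {0..1}"
  shows "flow u t - id \<in> C0_hoelder n \<alpha>"
proof -
  have \<alpha>1: "0 < \<alpha>" "\<alpha> \<le> 1" and "0 < \<beta>" using A \<beta> by auto
  interpret hoelder_field n \<alpha> u "\<lambda>t. hoelder_norm n \<alpha> (u t)"
    using u A \<beta> n by (rule L1_C0_hoelder_field)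
  obtain K where K: "hoelder_le n \<alpha> K (\<lambda>x. flow u t x - x)"
    using L1_C0_flow_hoelder_le[OF n A \<beta> u] t by blast
  have "((\<lambda>x. flow u t x - x) \<longlongrightarrow> 0) at_infinity"
    using C0_hoelder_tendsto[OF L1_C0_D(1)[OF u A]] solves_flow t by (rule flow_vanishes_at_infinity)
  with K show ?thesis
    unfolding flow_minus_id[symmetric] using \<alpha>1 by (rule C0_hoelderI)
qed

text \<open>In the supremum norm the displacement moves by at most the increment of the integral M
  of k, which is continuous in time. A bound with a larger exponent \<alpha>' and interpolation lift
  this to the exponent \<alpha>.\<close>

lemma minus_Id_flow_in_CI_C0:
  fixes u :: "real \<Rightarrow> 'a::euclidean_space \<Rightarrow> 'a"
  assumes n: "1 \<le> n" and \<beta>: "0 < \<beta>" "\<beta> \<le> 1" and u: "u \<in> L1_C0 n \<beta>"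
  shows "minus_Id (flow u) \<in> CI_C0 n \<beta>"
  unfolding CI_C0_iff[OF \<beta>] minus_Id_def
proof (intro conjI ballI allI impI)
  show "flow u t - id \<in> C0_minus n \<beta>" if "t \<in> {0..1}" for t
    using flow_minus_id_in_C0_hoelder[OF n _ \<beta>(2) u that] by (auto simp: C0_minus_def)
  fix t \<alpha> e :: real assume t: "t \<in> {0..1}" and A: "\<alpha> \<in> {0<..<\<beta>}" and e: "0 < e"
  obtain \<alpha>' where \<alpha>': "\<alpha> < \<alpha>'" "\<alpha>' < \<beta>" using A dense by auto
  then have \<alpha>'\<beta>: "\<alpha>' \<in> {0<..<\<beta>}" using A by auto
  define k where "k t = hoelder_norm n \<alpha>' (u t)" for t
  interpret hoelder_field n \<alpha>' u k
    unfolding k_def[abs_def] using u \<alpha>'\<beta> \<beta>(2) n by (rule L1_C0_hoelder_field)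
  obtain K where "0 \<le> K" and K: "\<And>t. t \<in> {0..1} \<Longrightarrow> hoelder_le n \<alpha>' K (\<lambda>x. flow u t x - x)"
    using L1_C0_flow_hoelder_le[OF n \<alpha>'\<beta> \<beta>(2) u] by blast
  define M where "M t = integral {0..t} k" for t
  have M: "norm (flow u r x - flow u q x) \<le> \<bar>M r - M q\<bar>" if rq: "r \<in> {0..1}" "q \<in> {0..1}" for r q x
  proof -
    have *: "norm (flow u r x - flow u q x) \<le> \<bar>M r - M q\<bar>"
      if "q \<le> r" "r \<in> {0..1}" "q \<in> {0..1}" for r q
    proof -
      have "integral {0..q} k + integral {q..r} k = integral {0..r} k"
        using that k_int_sub by (intro Henstock_Kurzweil_Integration.integral_combine) auto
      then show ?thesis
        using norm_solves_diff_le[OF solves_flow, of q r x] that by (simp add: M_def)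
    qed
    show ?thesis
      using *[of q r] *[of r q] rq by (cases "q \<le> r") (auto simp: norm_minus_commute abs_minus_commute)
  qed
  have "0 \<le> integral {0..1} k" by (rule k_integral_nonneg) auto
  \<comment> \<open>Differences of two displacements have bound K + K, and increments of M do not
    exceed the total mass, which serves as the range of \<epsilon>.\<close>
  then obtain C \<gamma> where "0 < C" "0 < \<gamma>" and C: "\<And>\<epsilon> (f :: 'a \<Rightarrow> 'a). hoelder_le n \<alpha>' (K + K) f \<Longrightarrow> 0 \<le> \<epsilon> \<Longrightarrow>
      \<epsilon> \<le> integral {0..1} k \<Longrightarrow> (\<And>x. norm (f x) \<le> \<epsilon>) \<Longrightarrow> hoelder_norm n \<alpha> f \<le> C * \<epsilon> powr \<gamma>"
    using hoelder_norm_interpolation[of \<alpha> \<alpha>' "K + K" "integral {0..1} k" n, where ?'a = 'a]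
      A \<alpha>' \<beta> \<open>0 \<le> K\<close> by auto
  obtain \<eta> where "0 < \<eta>" and \<eta>: "\<And>\<epsilon>. 0 \<le> \<epsilon> \<Longrightarrow> \<epsilon> < \<eta> \<Longrightarrow> C * \<epsilon> powr \<gamma> < e"
    using powr_small[OF \<open>0 < C\<close> \<open>0 < \<gamma>\<close> e] by blast
  have "continuous_on {0..1} M"
    unfolding M_def[abs_def] using k_int by (rule indefinite_integral_continuous_1)
  then obtain d where "0 < d" and d: "\<And>s. s \<in> {0..1} \<Longrightarrow> dist s t < d \<Longrightarrow> dist (M s) (M t) < \<eta>"
    using t \<open>0 < \<eta>\<close> unfolding continuous_on_iff by blast
  have "hoelder_norm n \<alpha> (flow u s - id - (flow u t - id)) < e" if s: "s \<in> {0..1}" "dist s t < d" for s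
  proof -
    have "hoelder_le n \<alpha>' (K + K) (\<lambda>x. (flow u s x - x) - (flow u t x - x))"
      using s t by (intro hoelder_le_diff K)
    moreover have "(\<lambda>x. (flow u s x - x) - (flow u t x - x)) = flow u s - id - (flow u t - id)"
      by (simp add: fun_eq_iff)
    moreover have "\<bar>M s - M t\<bar> \<le> integral {0..1} k"
    proof -
      have "0 \<le> M r" "M r \<le> integral {0..1} k" if "r \<in> {0..1}" for r
        unfolding M_def using that by (auto intro!: k_integral_nonneg k_integral_mono)
      from this[OF s(1)] this[OF t] show ?thesis by linarith
    qed
    ultimately have "hoelder_norm n \<alpha> (flow u s - id - (flow u t - id)) \<le> C * \<bar>M s - M t\<bar> powr \<gamma>"
      using M[OF s(1) t] by (intro C) auto
    also have "\<dots> < e" using d[OF s] by (intro \<eta>) (auto simp: dist_real_def)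
    finally show ?thesis .
  qed
  then show "\<exists>d>0. \<forall>s\<in>{0..1}. dist s t < d \<longrightarrow> hoelder_norm n \<alpha> (flow u s - id - (flow u t - id)) < e"
    using \<open>0 < d\<close> by blast
qed

text \<open>The key estimate: Hoelder continuity of the flow map on balls of the source seminorm
  with exponent \<alpha>', measured in the target seminorm with exponent \<alpha>. Both
  displacements lie in one ball by \<open>L1_C0_flow_bound\<close>, so the order-zero estimate
  \<open>flow_stability\<close> can be interpolated.\<close>

lemma flow_stability_hoelder:
  assumes n: "1 \<le> n" and \<alpha>: "0 < \<alpha>" "\<alpha> < \<alpha>'" "\<alpha>' < \<beta>" and \<beta>: "\<beta> \<le> 1" and "0 \<le> R"
  obtains C \<gamma> where "0 < C" "0 < \<gamma>"
    "\<And>u v :: real \<Rightarrow> 'a::euclidean_space \<Rightarrow> 'a. u \<in> L1_C0 n \<beta> \<Longrightarrow> v \<in> L1_C0 n \<beta> \<Longrightarrow>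
      L1_seminorm n \<alpha>' u \<le> R \<Longrightarrow> L1_seminorm n \<alpha>' v \<le> R \<Longrightarrow>
      CI_seminorm n \<alpha> (minus_Id (flow u) - minus_Id (flow v)) \<le> C * L1_seminorm n \<alpha>' (u - v) powr \<gamma>"
proof -
  have \<alpha>'\<beta>: "\<alpha>' \<in> {0<..<\<beta>}" and "0 < \<beta>" using \<alpha> by auto
  have fam: "seminorm_family (L1_C0 n \<beta> :: (real \<Rightarrow> 'a \<Rightarrow> 'a) set) (L1_C0_seminorms n \<beta>)"
    using \<open>0 < \<beta>\<close> \<beta> by (rule seminorm_family_L1_C0)
  have P: "L1_seminorm n \<alpha>' \<in> (L1_C0_seminorms n \<beta> :: ((real \<Rightarrow> 'a \<Rightarrow> 'a) \<Rightarrow> real) set)"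
    using \<alpha>'\<beta> by (simp add: L1_C0_seminorms_eq)
  obtain K where "0 \<le> K" and K: "\<And>(u :: real \<Rightarrow> 'a \<Rightarrow> 'a) t. u \<in> L1_C0 n \<beta> \<Longrightarrow> L1_seminorm n \<alpha>' u \<le> R \<Longrightarrow>
      t \<in> {0..1} \<Longrightarrow> hoelder_le n \<alpha>' K (\<lambda>x. flow u t x - x)"
    using L1_C0_flow_bound[OF n \<alpha>'\<beta> \<beta>, of R, where ?'a = 'a] by blast
  \<comment> \<open>The factor from \<open>flow_stability\<close> for fields of mass at most R.
    Since the seminorm of u - v is at most R + R, the supremum distance of the flows is at most L *
    (R + R), the range used for the interpolation.\<close>
  define L where "L = 2 * exp (4 * R)"
  have "0 < L" by (simp add: L_def)
  obtain C \<gamma> where "0 < C" "0 < \<gamma>" and C: "\<And>\<epsilon> (f :: 'a \<Rightarrow> 'a). hoelder_le n \<alpha>' (K + K) f \<Longrightarrow> 0 \<le> \<epsilon> \<Longrightarrow>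
      \<epsilon> \<le> L * (R + R) \<Longrightarrow> (\<And>x. norm (f x) \<le> \<epsilon>) \<Longrightarrow> hoelder_norm n \<alpha> f \<le> C * \<epsilon> powr \<gamma>"
    using hoelder_norm_interpolation[of \<alpha> \<alpha>' "K + K" "L * (R + R)" n, where ?'a = 'a]
      \<alpha> \<beta> \<open>0 \<le> K\<close> \<open>0 < L\<close> \<open>0 \<le> R\<close> by auto
  have "0 < C * L powr \<gamma>" using \<open>0 < C\<close> \<open>0 < L\<close> by simp
  then show ?thesis
  proof (rule that[OF _ \<open>0 < \<gamma>\<close>])
    fix u v :: "real \<Rightarrow> 'a \<Rightarrow> 'a"
    assume u: "u \<in> L1_C0 n \<beta>" and v: "v \<in> L1_C0 n \<beta>"
      and uR: "L1_seminorm n \<alpha>' u \<le> R" and vR: "L1_seminorm n \<alpha>' v \<le> R"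
    have uv: "u - v \<in> L1_C0 n \<beta>" using subspace_diff[OF seminorm_subspace[OF fam] u v] .
    define D where "D = L1_seminorm n \<alpha>' (u - v)"
    have D: "0 \<le> D" "D \<le> R + R"
      using seminorm_nonneg[OF fam P uv] seminorm_diff_le_add[OF fam P u v] uR vR by (auto simp: D_def)
    interpret u: hoelder_field n \<alpha>' u "\<lambda>t. hoelder_norm n \<alpha>' (u t)"
      using u \<alpha>'\<beta> \<beta> n by (rule L1_C0_hoelder_field)
    interpret v: hoelder_field n \<alpha>' v "\<lambda>t. hoelder_norm n \<alpha>' (v t)"
      using v \<alpha>'\<beta> \<beta> n by (rule L1_C0_hoelder_field)
    interpret uv: hoelder_field n \<alpha>' "u - v" "\<lambda>t. hoelder_norm n \<alpha>' ((u - v) t)"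
      using uv \<alpha>'\<beta> \<beta> n by (rule L1_C0_hoelder_field)
    have C0: "norm (flow u t x - flow v t x) \<le> L * D" if t: "t \<in> {0..1}" for t x
    proof -
      have "norm (flow u t x - flow v t x) \<le>
          2 * integral {0..1} (\<lambda>t. hoelder_norm n \<alpha>' ((u - v) t)) * exp (4 * integral {0..1} (\<lambda>t. hoelder_norm n \<alpha>' (u t)))"
        by (rule flow_stability[OF u.Lipschitz_field_axioms v.Lipschitz_field_axioms uv.k_int _
              u.solves_flow v.solves_flow t]) (use uv.norm_u in simp)
      also have "\<dots> = 2 * D * exp (4 * L1_seminorm n \<alpha>' u)"
        by (simp only: D_def L1_seminorm_eq_integral[OF uv \<alpha>'\<beta> \<beta>] L1_seminorm_eq_integral[OF u \<alpha>'\<beta> \<beta>])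
      also have "\<dots> \<le> 2 * D * exp (4 * R)" using D uR by (intro mult_left_mono) auto
      finally show ?thesis by (simp add: L_def mult_ac)
    qed
    show "CI_seminorm n \<alpha> (minus_Id (flow u) - minus_Id (flow v)) \<le> C * L powr \<gamma> * L1_seminorm n \<alpha>' (u - v) powr \<gamma>"
    proof (rule CI_seminorm_le)
      fix t :: real assume t: "t \<in> {0..1}"
      have "hoelder_le n \<alpha>' (K + K) (\<lambda>x. (flow u t x - x) - (flow v t x - x))"
        using u v uR vR t by (intro hoelder_le_diff K)
      moreover have "(\<lambda>x. (flow u t x - x) - (flow v t x - x)) = (minus_Id (flow u) - minus_Id (flow v)) t"
        by (simp add: fun_eq_iff minus_Id_def)
      ultimately have "hoelder_norm n \<alpha> ((minus_Id (flow u) - minus_Id (flow v)) t) \<le> C * (L * D) powr \<gamma>"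
        using C0[OF t] D \<open>0 < L\<close> by (intro C) (auto simp: minus_Id_def intro!: mult_left_mono)
      then show "hoelder_norm n \<alpha> ((minus_Id (flow u) - minus_Id (flow v)) t) \<le>
          C * L powr \<gamma> * L1_seminorm n \<alpha>' (u - v) powr \<gamma>"
        using D \<open>0 < L\<close> by (simp add: D_def powr_mult mult.assoc)
    qed
  qed
qed

section \<open>Positivity of the determinant of the derivative\<close>

lemma continuous_on_det:
  fixes A :: "'t::topological_space \<Rightarrow> real^'n^'n"
  assumes "\<And>i j. continuous_on S (\<lambda>t. A t $ i $ j)"
  shows "continuous_on S (\<lambda>t. det (A t))"
  unfolding det_def by (intro continuous_intros assms)

text \<open>The determinant is 1 at time 0 and continuous in time, so it stays positive if it never
  vanishes. It never vanishes because a kernel vector of the derivative would violate the lower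
  Lipschitz bound \<open>solves_expanding\<close>.\<close>

lemma flow_det_pos:
  fixes u :: "real \<Rightarrow> real^'d \<Rightarrow> real^'d"
  assumes n: "1 \<le> n" and \<beta>: "0 < \<beta>" "\<beta> \<le> 1" and u: "u \<in> L1_C0 n \<beta>" and t: "t \<in> {0..1}"
  shows "0 < det (matrix (frechet_derivative (flow u t) (at x)))"
proof -
  obtain \<alpha> where A: "\<alpha> \<in> {0<..<\<beta>}" using dense[OF \<beta>(1)] by auto
  then have \<alpha>1: "0 < \<alpha>" "\<alpha> \<le> 1" using \<beta> by auto
  obtain m where m: "n = Suc m" using n by (cases n) auto
  interpret hoelder_field n \<alpha> u "\<lambda>t. hoelder_norm n \<alpha> (u t)"
    using u A \<beta>(2) n by (rule L1_C0_hoelder_field)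
  obtain K where "0 \<le> K" and K: "\<And>t. t \<in> {0..1} \<Longrightarrow> hoelder_le n \<alpha> K (\<lambda>x. flow u t x - x)"
    using L1_C0_flow_hoelder_le[OF n A \<beta>(2) u] by blast
  define \<phi> where "\<phi> t x = flow u t x - x" for t x
  have \<phi>: "hoelder_le n \<alpha> K (\<phi> t)" if "t \<in> {0..1}" for t
    using K[OF that] by (simp add: \<phi>_def[abs_def])
  define D where "D t v = v + frechet_derivative (\<phi> t) (at x) v" for t v
  have flow_D: "(flow u t has_derivative D t) (at x)" if "t \<in> {0..1}" for t
  proof -
    have "((\<lambda>x. x + \<phi> t x) has_derivative (\<lambda>v. v + frechet_derivative (\<phi> t) (at x) v)) (at x)"
      using hoelder_le_has_derivative[OF \<phi>[OF that, unfolded m]]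
      by (intro has_derivative_add has_derivative_ident)
    then show ?thesis by (simp add: \<phi>_def D_def[abs_def])
  qed
  have inj: "inj (D t)" if t: "t \<in> {0..1}" for t
  proof -
    have lin: "linear (D t)" using flow_D[OF t] by (rule has_derivative_linear)
    have "v = 0" if v: "D t v = 0" for v
    proof (rule ccontr)
      assume "v \<noteq> 0"
      \<comment> \<open>c is the lower Lipschitz constant of the flow map, and r is a length for
        which the Taylor error factor 2 * K * r powr \<alpha> is less than c. For a kernel vector w
        of length r the increment of the flow is pure Taylor error, which contradicts the lower
        bound.\<close>
      define c where "c = 1 / (2 * exp (4 * integral {0..1} (\<lambda>t. hoelder_norm n \<alpha> (u t))))"
      define r where "r = (c / (2 * K + 1)) powr (1 / \<alpha>)"
      have "0 < c" by (simp add: c_def)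
      then have "0 < r" using \<open>0 \<le> K\<close> by (simp add: r_def)
      define w where "w = (r / norm v) *\<^sub>R v"
      have w: "norm w = r" "w \<noteq> 0" using \<open>v \<noteq> 0\<close> \<open>0 < r\<close> by (auto simp: w_def)
      have "D t w = 0" unfolding w_def linear_scale[OF lin] v by simp
      have "norm (\<phi> t (x + w) - \<phi> t x - frechet_derivative (\<phi> t) (at x) w) \<le> norm w * (2 * K * norm w powr \<alpha>)"
        using \<phi>[OF t, unfolded m] \<alpha>1 by (rule hoelder_le_Taylor)
      moreover have "\<phi> t (x + w) - \<phi> t x - frechet_derivative (\<phi> t) (at x) w = flow u t (x + w) - flow u t x"
        using \<open>D t w = 0\<close> by (simp add: \<phi>_def D_def algebra_simps add_eq_0_iff)
      moreover have "c * norm w \<le> norm (flow u t (x + w) - flow u t x)"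
        using solves_expanding[OF solves_flow solves_flow t, of "x + w" x]
        by (simp add: c_def field_simps)
      ultimately have "norm w * c \<le> norm w * (2 * K * norm w powr \<alpha>)"
        by (simp add: mult.commute)
      then have "c \<le> 2 * K * norm w powr \<alpha>" using w \<open>0 < r\<close> by simp
      also have "norm w powr \<alpha> = c / (2 * K + 1)"
        using w \<alpha>1 \<open>0 < c\<close> \<open>0 \<le> K\<close> by (simp add: r_def powr_powr)
      finally show False using \<open>0 < c\<close> \<open>0 \<le> K\<close> by (simp add: field_simps)
    qed
    then show ?thesis using linear_injective_0[OF lin] by blast
  qed
  have CI: "\<forall>t\<in>{0..1}. \<forall>\<alpha>\<in>{0<..<\<beta>}. \<forall>e>0. \<exists>d>0. \<forall>s\<in>{0..1}. dist s t < d \<longrightarrow>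
      hoelder_norm n \<alpha> (minus_Id (flow u) s - minus_Id (flow u) t) < e"
    using minus_Id_flow_in_CI_C0[OF n \<beta> u] unfolding CI_C0_iff[OF \<beta>] by (rule conjunct2)
  \<comment> \<open>Continuity of the derivative in time is inherited from that of the displacement
    in the Hoelder norm, which controls first derivatives since n is at least 1.\<close>
  have D_cont: "continuous_on {0..1} (\<lambda>t. D t v)" for v
    unfolding continuous_on_iff
  proof (intro ballI allI impI)
    fix t e :: real assume t: "t \<in> {0..1}" and "0 < e"
    then have "0 < e / (norm v + 1)" by (simp add: add_nonneg_pos)
    then obtain d where "0 < d" and d: "\<And>s. s \<in> {0..1} \<Longrightarrow> dist s t < d \<Longrightarrow>
        hoelder_norm n \<alpha> (minus_Id (flow u) s - minus_Id (flow u) t) < e / (norm v + 1)"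
      using CI[rule_format, OF t A] by blast
    have "dist (D s v) (D t v) < e" if s: "s \<in> {0..1}" "dist s t < d" for s
    proof -
      define H where "H = hoelder_norm n \<alpha> (minus_Id (flow u) s - minus_Id (flow u) t)"
      have "minus_Id (flow u) r \<in> C0_hoelder n \<alpha>" if "r \<in> {0..1}" for r
        using flow_minus_id_in_C0_hoelder[OF n A \<beta>(2) u that] by (simp add: minus_Id_def)
      then have "minus_Id (flow u) s - minus_Id (flow u) t \<in> C0_hoelder n \<alpha>"
        using s t by (intro subspace_diff[OF seminorm_subspace[OF seminorm_family_C0_hoelder[OF \<alpha>1]]])
      then have "hoelder_le n \<alpha> H (minus_Id (flow u) s - minus_Id (flow u) t)"
        unfolding H_def by (rule C0_hoelder_imp_hoelder_le)
      moreover have "minus_Id (flow u) s - minus_Id (flow u) t = (\<lambda>x. \<phi> s x - \<phi> t x)"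
        by (simp add: fun_eq_iff minus_Id_def \<phi>_def)
      ultimately have "norm (frechet_derivative (\<lambda>x. \<phi> s x - \<phi> t x) (at x) v) \<le> H * norm v"
        using m by (intro hoelder_le_norm_derivative) auto
      moreover have "((\<lambda>x. \<phi> s x - \<phi> t x) has_derivative
          (\<lambda>v. frechet_derivative (\<phi> s) (at x) v - frechet_derivative (\<phi> t) (at x) v)) (at x)"
        using \<phi>[OF s(1)] \<phi>[OF t] unfolding m by (intro has_derivative_diff hoelder_le_has_derivative)
      from frechet_derivative_at[OF this, symmetric]
      have "frechet_derivative (\<lambda>x. \<phi> s x - \<phi> t x) (at x) v = D s v - D t v"
        by (simp add: D_def)
      ultimately have "norm (D s v - D t v) \<le> H * norm v" by simp
      also have "\<dots> \<le> e / (norm v + 1) * norm v"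
        using d[OF s] by (intro mult_right_mono) (auto simp: H_def)
      also have "\<dots> < e" using \<open>0 < e\<close> by (simp add: divide_simps add_nonneg_pos)
      finally show ?thesis by (simp add: dist_norm)
    qed
    then show "\<exists>d>0. \<forall>s\<in>{0..1}. dist s t < d \<longrightarrow> dist (D s v) (D t v) < e"
      using \<open>0 < d\<close> by blast
  qed
  define \<delta> where "\<delta> t = det (matrix (D t))" for t
  have "continuous_on {0..1} \<delta>"
    unfolding \<delta>_def[abs_def]
    by (rule continuous_on_det) (simp add: matrix_def continuous_on_component D_cont)
  have nz: "\<delta> t \<noteq> 0" if "t \<in> {0..1}" for t
    using inj[OF that] det_nz_iff_inj[OF has_derivative_linear[OF flow_D[OF that]]] by (simp add: \<delta>_def)
  have "\<delta> 0 = 1"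
  proof -
    have "flow u 0 = (\<lambda>x. x)" using solves_0[OF solves_flow] by blast
    then have "(flow u 0 has_derivative (\<lambda>v. v)) (at x)" by (simp add: has_derivative_ident)
    then have "D 0 = (\<lambda>v. v)" using flow_D[of 0] by (intro has_derivative_unique) auto
    then show ?thesis by (simp add: \<delta>_def matrix_id_mat_1 flip: id_def)
  qed
  have "0 < \<delta> t"
  proof (rule ccontr)
    assume "\<not> 0 < \<delta> t"
    then have "\<exists>s\<ge>0. s \<le> t \<and> \<delta> s = 0"
      using t \<open>\<delta> 0 = 1\<close> continuous_on_subset[OF \<open>continuous_on {0..1} \<delta>\<close>, of "{0..t}"]
      by (intro IVT2') auto
    then show False using nz t by auto
  qed
  then show ?thesis using frechet_derivative_at[OF flow_D[OF t]] by (simp add: \<delta>_def)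
qed

section \<open>The flow map between the function spaces\<close>

lemma flow_in_CI_Diff:
  fixes u :: "real \<Rightarrow> real^'d \<Rightarrow> real^'d"
  assumes n: "1 \<le> n" and \<beta>: "0 < \<beta>" "\<beta> \<le> 1" and u: "u \<in> L1_C0 n \<beta>"
  shows "flow u \<in> CI_Diff n \<beta>"
proof -
  have CI: "minus_Id (flow u) \<in> CI_C0 n \<beta>" using n \<beta> u by (rule minus_Id_flow_in_CI_C0)
  have "flow u t \<in> Diff_minus n \<beta>" if t: "t \<in> {0..1}" for t
    using CI flow_det_pos[OF n \<beta> u t] t unfolding CI_C0_iff[OF \<beta>]
    by (simp add: Diff_minus_def minus_Id_def)
  moreover have "continuous_map (top_of_set {0..1}) (C0_minus_topology n \<beta>) ((\<lambda>\<Phi>. \<Phi> - id) \<circ> flow u)"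
    using CI by (simp add: CI_C0_def minus_Id_def comp_def)
  ultimately show ?thesis
    unfolding CI_Diff_def Diff_minus_topology_def by (auto intro!: continuous_map_pullback')
qed

text \<open>Near u, a target seminorm with exponent \<alpha> is controlled by the single source
  seminorm with a larger exponent \<alpha>', through \<open>flow_stability_hoelder\<close>.\<close>

lemma flow_continuous:
  assumes n: "1 \<le> n" and \<beta>: "0 < \<beta>" "\<beta> \<le> 1"
  shows "continuous_map (L1_C0_topology n \<beta>) (CI_Diff_topology n \<beta>)
    (flow :: (real \<Rightarrow> real^'d \<Rightarrow> real^'d) \<Rightarrow> real \<Rightarrow> real^'d \<Rightarrow> real^'d)"
  unfolding CI_Diff_topology_def
proof (rule continuous_map_pullback')
  let ?V = "L1_C0 n \<beta> :: (real \<Rightarrow> real^'d \<Rightarrow> real^'d) set"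
  have fam: "seminorm_family ?V (L1_C0_seminorms n \<beta>)" using \<beta> by (rule seminorm_family_L1_C0)
  note top = topspace_lcs[OF fam]
  show "topspace (lcs_topology ?V (L1_C0_seminorms n \<beta>)) \<subseteq> flow -` CI_Diff n \<beta>"
    unfolding top using flow_in_CI_Diff[OF n \<beta>] by blast
  show "continuous_map (lcs_topology ?V (L1_C0_seminorms n \<beta>)) (lcs_topology (CI_C0 n \<beta>) (CI_C0_seminorms n \<beta>))
      (minus_Id \<circ> flow)"
  proof (rule continuous_map_lcsI[OF seminorm_family_CI_C0[OF \<beta>]], unfold top comp_apply)
    show "minus_Id (flow u) \<in> CI_C0 n \<beta>" if "u \<in> ?V" for u
      using n \<beta> that by (rule minus_Id_flow_in_CI_C0)
    fix u p and e :: real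
    assume u: "u \<in> ?V" and "p \<in> (CI_C0_seminorms n \<beta> :: ((real \<Rightarrow> real^'d \<Rightarrow> real^'d) \<Rightarrow> real) set)" and e: "0 < e"
    then obtain \<alpha> where \<alpha>: "0 < \<alpha>" "\<alpha> < \<beta>" and p: "p = CI_seminorm n \<alpha>"
      by (auto simp: CI_C0_seminorms_eq)
    obtain \<alpha>' where \<alpha>': "\<alpha> < \<alpha>'" "\<alpha>' < \<beta>" using dense[OF \<alpha>(2)] by blast
    have P: "L1_seminorm n \<alpha>' \<in> (L1_C0_seminorms n \<beta> :: ((real \<Rightarrow> real^'d \<Rightarrow> real^'d) \<Rightarrow> real) set)"
      using \<alpha> \<alpha>' by (simp add: L1_C0_seminorms_eq)
    have "0 \<le> L1_seminorm n \<alpha>' u + 1" using seminorm_nonneg[OF fam P u] by simp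
    then obtain C \<gamma> where "0 < C" "0 < \<gamma>" and C: "\<And>w v :: real \<Rightarrow> real^'d \<Rightarrow> real^'d. w \<in> ?V \<Longrightarrow> v \<in> ?V \<Longrightarrow>
      L1_seminorm n \<alpha>' w \<le> L1_seminorm n \<alpha>' u + 1 \<Longrightarrow> L1_seminorm n \<alpha>' v \<le> L1_seminorm n \<alpha>' u + 1 \<Longrightarrow>
      CI_seminorm n \<alpha> (minus_Id (flow w) - minus_Id (flow v)) \<le> C * L1_seminorm n \<alpha>' (w - v) powr \<gamma>"
      using flow_stability_hoelder[OF n \<alpha>(1) \<alpha>' \<beta>(2), of "L1_seminorm n \<alpha>' u + 1", where ?'a = "real^'d"] by blast
    obtain \<eta> where "0 < \<eta>" and \<eta>: "\<And>\<epsilon>. 0 \<le> \<epsilon> \<Longrightarrow> \<epsilon> < \<eta> \<Longrightarrow> C * \<epsilon> powr \<gamma> < e"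
      using powr_small[OF \<open>0 < C\<close> \<open>0 < \<gamma>\<close> e] by blast
    \<comment> \<open>Radius 1 keeps every v in the ball of radius
      \<open>L1_seminorm n \<alpha>' u + 1\<close> on which C and \<gamma> are valid; radius \<eta>
      makes the estimate smaller than e.\<close>
    let ?U = "{v \<in> ?V. L1_seminorm n \<alpha>' (v - u) < min 1 \<eta>}"
    have "p (minus_Id (flow v) - minus_Id (flow u)) < e" if v: "v \<in> ?U" for v
    proof -
      have vV: "v \<in> ?V" and vu: "L1_seminorm n \<alpha>' (v - u) < 1" "L1_seminorm n \<alpha>' (v - u) < \<eta>" using v by auto
      have "L1_seminorm n \<alpha>' v \<le> L1_seminorm n \<alpha>' u + 1"
        using seminorm_diff_le[OF fam P vV u] vu by simp
      then have "p (minus_Id (flow v) - minus_Id (flow u)) \<le> C * L1_seminorm n \<alpha>' (v - u) powr \<gamma>"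
        unfolding p using u vV by (intro C) auto
      also have "\<dots> < e"
        using vu seminorm_nonneg[OF fam P subspace_diff[OF seminorm_subspace[OF fam] vV u]] by (intro \<eta>)
      finally show ?thesis .
    qed
    moreover have "openin (lcs_topology ?V (L1_C0_seminorms n \<beta>)) ?U"
      using \<open>0 < \<eta>\<close> by (intro openin_lcs_ball[OF fam P u]) auto
    moreover have "u \<in> ?U" using u \<open>0 < \<eta>\<close> seminorm_zero[OF fam P] by simp
    ultimately show "\<exists>U. openin (lcs_topology ?V (L1_C0_seminorms n \<beta>)) U \<and> u \<in> U \<and>
        (\<forall>v\<in>U. p (minus_Id (flow v) - minus_Id (flow u)) < e)" by blast
  qed
qed

text \<open>A smooth curve is Lipschitz on bounded intervals for every source seminorm, so along it
  the flow is Hoelder for each target seminorm, with some exponent \<gamma> depending on it. On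
  bounded ranges of r, \<omega> r dominates r powr \<gamma> up to a constant.\<close>

lemma flow_C0_omega:
  assumes n: "1 \<le> n" and \<beta>: "0 < \<beta>" "\<beta> \<le> 1" and \<omega>: "slowly_vanishing \<omega>"
  shows "C0_omega_map (L1_C0 n \<beta>) (L1_C0_seminorms n \<beta>) (CI_C0 n \<beta>) (CI_C0_seminorms n \<beta>) \<omega>
    (\<lambda>u :: real \<Rightarrow> 'a::euclidean_space \<Rightarrow> 'a. minus_Id (flow u))"
  unfolding C0_omega_map_def C0_omega_curve_def
proof (intro allI impI conjI)
  let ?V = "L1_C0 n \<beta> :: (real \<Rightarrow> 'a \<Rightarrow> 'a) set"
  let ?f = "\<lambda>u :: real \<Rightarrow> 'a \<Rightarrow> 'a. minus_Id (flow u)"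
  have fam: "seminorm_family ?V (L1_C0_seminorms n \<beta>)" using \<beta> by (rule seminorm_family_L1_C0)
  have fam': "seminorm_family (CI_C0 n \<beta> :: (real \<Rightarrow> 'a \<Rightarrow> 'a) set) (CI_C0_seminorms n \<beta>)"
    using \<beta> by (rule seminorm_family_CI_C0)
  fix c assume c: "smooth_curve ?V (L1_C0_seminorms n \<beta>) c"
  have cV: "c t \<in> ?V" for t using c by (rule smooth_curve_in)
  have fV: "?f (c t) \<in> CI_C0 n \<beta>" for t using n \<beta> cV by (rule minus_Id_flow_in_CI_C0)
  then show "range (?f \<circ> c) \<subseteq> CI_C0 n \<beta>" by auto
  fix J :: "real set" assume "is_interval J \<and> bounded J"
  then obtain B where "0 < B" and "\<forall>x\<in>J. norm x \<le> B" using bounded_pos by blast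
  \<comment> \<open>J is enlarged to a symmetric interval, which is compact and contains 0, so that
    the curve can be bounded relative to \<open>c 0\<close>.\<close>
  then have J: "x \<in> {-B..B}" if "x \<in> J" for x using that by (auto simp: abs_le_iff)
  show "lcs_bounded (CI_C0 n \<beta>) (CI_C0_seminorms n \<beta>)
      {(1 / \<omega> \<bar>t - s\<bar>) *\<^sub>R ((?f \<circ> c) t - (?f \<circ> c) s) |s t. s \<in> J \<and> t \<in> J \<and> s \<noteq> t}"
    unfolding lcs_bounded_def
  proof (intro conjI ballI)
    show "{(1 / \<omega> \<bar>t - s\<bar>) *\<^sub>R ((?f \<circ> c) t - (?f \<circ> c) s) |s t. s \<in> J \<and> t \<in> J \<and> s \<noteq> t} \<subseteq> CI_C0 n \<beta>"
      using fV by (auto intro!: subspace_scale[OF seminorm_subspace[OF fam']] subspace_diff[OF seminorm_subspace[OF fam']])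
    fix p assume pP: "p \<in> (CI_C0_seminorms n \<beta> :: ((real \<Rightarrow> 'a \<Rightarrow> 'a) \<Rightarrow> real) set)"
    then obtain \<alpha> where \<alpha>: "0 < \<alpha>" "\<alpha> < \<beta>" and p: "p = CI_seminorm n \<alpha>"
      by (auto simp: CI_C0_seminorms_eq)
    obtain \<alpha>' where \<alpha>': "\<alpha> < \<alpha>'" "\<alpha>' < \<beta>" using dense[OF \<alpha>(2)] by blast
    define q :: "(real \<Rightarrow> 'a \<Rightarrow> 'a) \<Rightarrow> real" where "q = L1_seminorm n \<alpha>'"
    have P: "q \<in> L1_C0_seminorms n \<beta>"
      using \<alpha> \<alpha>' by (simp add: q_def L1_C0_seminorms_eq)
    obtain B' where "0 \<le> B'" and B': "\<And>s t. s \<in> {-B..B} \<Longrightarrow> t \<in> {-B..B} \<Longrightarrow> q (c t - c s) \<le> B' * \<bar>t - s\<bar>"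
      using smooth_curve_Lipschitz[OF fam c P, of "- B" B] by blast
    define R where "R = B' * B + q (c 0)"
    have "0 \<le> R" using \<open>0 \<le> B'\<close> \<open>0 < B\<close> seminorm_nonneg[OF fam P cV[of 0]] by (simp add: R_def)
    have qR: "q (c t) \<le> R" if "t \<in> {-B..B}" for t
    proof -
      have "q (c t - c 0) \<le> B' * \<bar>t - 0\<bar>" using that \<open>0 < B\<close> by (intro B') auto
      also have "\<dots> \<le> B' * B" using that \<open>0 \<le> B'\<close> by (intro mult_left_mono) auto
      finally show ?thesis using seminorm_diff_le[OF fam P cV[of t] cV[of 0]] by (simp add: R_def)
    qed
    obtain C \<gamma> where "0 < C" "0 < \<gamma>" and C: "\<And>u v :: real \<Rightarrow> 'a \<Rightarrow> 'a. u \<in> ?V \<Longrightarrow> v \<in> ?V \<Longrightarrow>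
      q u \<le> R \<Longrightarrow> q v \<le> R \<Longrightarrow> p (?f u - ?f v) \<le> C * q (u - v) powr \<gamma>"
      unfolding p q_def using flow_stability_hoelder[OF n \<alpha>(1) \<alpha>' \<beta>(2) \<open>0 \<le> R\<close>, where ?'a = 'a] by blast
    obtain w where "0 < w" and w: "\<And>r. 0 < r \<Longrightarrow> r \<le> 2 * B \<Longrightarrow> w * r powr \<gamma> \<le> \<omega> r"
      using slowly_vanishing_lower_bound[OF \<omega> \<open>0 < \<gamma>\<close>, of "2 * B"] by blast
    have "p ((1 / \<omega> \<bar>t - s\<bar>) *\<^sub>R (?f (c t) - ?f (c s))) \<le> C * B' powr \<gamma> / w"
      if st: "s \<in> J" "t \<in> J" "s \<noteq> t" for s t
    proof -
      define r where "r = \<bar>t - s\<bar>"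
      have r: "0 < r" "r \<le> 2 * B" using J[OF st(1)] J[OF st(2)] st(3) by (auto simp: r_def)
      have "0 < w * r powr \<gamma>" using r \<open>0 < w\<close> by simp
      then have "0 < \<omega> r" using w[OF r] by linarith
      have "p ((1 / \<omega> r) *\<^sub>R (?f (c t) - ?f (c s))) \<le> \<bar>1 / \<omega> r\<bar> * p (?f (c t) - ?f (c s))"
        using fV by (intro seminorm_scaleR_le[OF fam' pP] subspace_diff[OF seminorm_subspace[OF fam']])
      also have "\<dots> \<le> (1 / \<omega> r) * (C * (B' * r) powr \<gamma>)"
      proof -
        have "p (?f (c t) - ?f (c s)) \<le> C * q (c t - c s) powr \<gamma>"
          using cV J st by (intro C qR)
        also have "\<dots> \<le> C * (B' * r) powr \<gamma>"
          using \<open>0 < C\<close> \<open>0 < \<gamma>\<close> B'[OF J J, OF st(1,2)] seminorm_nonneg[OF fam P] cV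
          by (intro mult_left_mono powr_mono2) (auto simp: r_def intro!: subspace_diff[OF seminorm_subspace[OF fam]])
        finally show ?thesis using \<open>0 < \<omega> r\<close> by (simp add: divide_right_mono)
      qed
      also have "\<dots> = C * B' powr \<gamma> * r powr \<gamma> / \<omega> r"
        using \<open>0 \<le> B'\<close> r by (simp add: powr_mult)
      also have "\<dots> \<le> C * B' powr \<gamma> * r powr \<gamma> / (w * r powr \<gamma>)"
        using w[OF r] \<open>0 < w * r powr \<gamma>\<close> \<open>0 < C\<close> by (intro divide_left_mono) auto
      also have "\<dots> = C * B' powr \<gamma> / w" using r by simp
      finally show ?thesis by (simp add: r_def)
    qed
    then show "bdd_above (p ` {(1 / \<omega> \<bar>t - s\<bar>) *\<^sub>R ((?f \<circ> c) t - (?f \<circ> c) s) |s t. s \<in> J \<and> t \<in> J \<and> s \<noteq> t})"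
      by (intro bdd_aboveI[of _ "C * B' powr \<gamma> / w"]) auto
  qed
qed

theorem theorem5p7:
  fixes n :: nat and \<beta> :: real
  assumes "2 \<le> n" and "0 < \<beta>" and "\<beta> \<le> 1"
  shows "continuous_map (L1_C0_topology n \<beta>) (CI_Diff_topology n \<beta>)
           (flow :: (real \<Rightarrow> real^'d \<Rightarrow> real^'d) \<Rightarrow> real \<Rightarrow> real^'d \<Rightarrow> real^'d)
       \<and> (\<forall>\<omega>. slowly_vanishing \<omega> \<longrightarrow>
            C0_omega_map (L1_C0 n \<beta>) (L1_C0_seminorms n \<beta>) (CI_C0 n \<beta>) (CI_C0_seminorms n \<beta>) \<omega>
              (\<lambda>u :: real \<Rightarrow> real^'d \<Rightarrow> real^'d. minus_Id (flow u)))"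
  using assms by (intro conjI allI impI flow_continuous flow_C0_omega) auto

end
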